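(* Let $T$ be a compact tree as described in the context, and let $\tilde T$ be the same tree (same vertices, edges, edge lengths $1$, and the same matching coefficients $a_{kj},a^1_{kj},a^0_{kj}$) but with possibly different potential $\tilde q=[\tilde q_j]_{j=1}^r$ and boundary coefficients $\tilde h_0,\dots,\tilde h_p$. Fix $k\in\{1,\dots,p\}$. If $M_k(\lambda)\equiv\tilde M_k(\lambda)$ (as meromorphic functions of $\lambda$), then $q_k(x)=\tilde q_k(x)$ for a.e. $x\in[0,1]$ and $h_k=\tilde h_k$. That is, the Weyl function $M_k$ uniquely determines the potential on the boundary edge $e_k$ and the coefficient $h_k$.
   Context: Tree setup. $T$ is a compact connected tree with vertices $v_0,\dots,v_r$ and edges $e_1,\dots,e_r$, each of length $1$. The root $v_0$ is a boundary vertex (a vertex belonging to exactly one edge). The boundary vertices are $v_0,v_1,\dots,v_p$; every edge is $e_j=[v_{j_k},v_j]$ with $j_k<j$, where $v_{j_k}$ (initial point) lies on the simple path from $v_0$ to $v_j$ (end point); in particular $e_{p+1}=[v_0,v_{p+1}]$, and $e_1,\dots,e_p$ are the boundary edges ending at $v_1,\dots,v_p$. Each edge $e_j$ is parametrized by $x\in[0,1]$ with $x=0$ at its end point $v_j$ and $x=1$ at its initial point. For an internal vertex $v_k$ ($k=p+1,\dots,r$), $R(v_k)$ is the set of edges $e_j=[v_k,v_j]$ emanating from $v_k$. A function on $T$ is $Y=[y_j]_{j=1}^r$ with $y_j$ defined on $e_j$. Equation. $q=[q_j]_{j=1}^r$ with $q_j\in L^1(0,1)$ complex-valued (the potential). Consider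 $-y_j''+q_j(x)y_j=\lambda y_j$, $x\in[0,1]$, $j=1,\dots,r$, with $y_j,y_j'$ absolutely continuous, and matching conditions at each internal vertex $v_k$, $k=p+1,\dots,r$: $y_k(0)=a_{kj}y_j(1)$ for all $e_j\in R(v_k)$, and $y_k'(0)=\sum_{e_j\in R(v_k)}(a^1_{kj}y_j'(1)+a^0_{kj}y_j(1))$, where $a_{kj},a^1_{kj},a^0_{kj}\in\mathbb C$, $a_{kj}a^1_{kj}\neq0$, and the regularity condition $\sum_{e_j\in R(v_k)}a^1_{kj}/a_{kj}\neq-1$ holds for every internal $v_k$. Boundary forms. For $j=1,\dots,p$: $U_{j0}(Y)=y_j'(0)+h_jy_j(0)$, $U_{j1}(Y)=y_j(0)$; at the root: $U_{00}(Y)=y_{p+1}'(1)+h_0y_{p+1}(1)$, $U_{01}(Y)=y_{p+1}(1)$; here $h_0,\dots,h_p\in\mathbb C$. Weyl functions. For $k=1,\dots,p$, the Weyl solution $\Psi_k=[\psi_{kj}]_{j=1}^r$ is the solution of the equation satisfying the matching conditions and $U_{j0}(\Psi_k)=\delta_{jk}$, $j=0,\dots,p$. Writing each component as a combination of the fundamental solutions on the edge reduces this to a linear algebraic system whose determinant $\Delta(\lambda)$ (the characteristic function of the problem $B$: equation, matching conditions, and $U_{j0}(Y)=0$, $j=0,\dots,p$) is entire; $\Psi_k$ exists for $\lambda$ outside the zeros of $\Delta$. The Weyl function is $M_k(\lambda):=U_{k1}(\Psi_k)=\psi_{kk}(0,\lambda)$, a meromorphic function; $M(\lambda)=[M_k(\lambda)]_{k=1}^p$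 is the Weyl vector. *)

theory Defs
  imports "HOL-Analysis.Analysis"
begin

definition ac_on_interval :: "real \<Rightarrow> real \<Rightarrow> (real \<Rightarrow> 'a::real_normed_vector) \<Rightarrow> bool" where
  "ac_on_interval a b f \<longleftrightarrow>
     (\<forall>e>0. \<exists>d>0. \<forall>(n::nat) (s::nat \<Rightarrow> real) t.
        (\<forall>i<n. a \<le> s i \<and> s i \<le> t i \<and> t i \<le> b) \<and>
        (\<forall>i<n. \<forall>j<n. i \<noteq> j \<longrightarrow> t i \<le> s j \<or> t j \<le> s i) \<and>
        (\<Sum>i<n. t i - s i) < d
        \<longrightarrow> (\<Sum>i<n. norm (f (t i) - f (s i))) < e)"

definition D :: "(real \<Rightarrow> complex) \<Rightarrow> real \<Rightarrow> complex" where
  "D f x = vector_derivative f (at x within {0..1})"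

text \<open>Tree: vertices v_0..v_r, edges e_1..e_r, edge e_j = [v_(par j), v_j].
  Boundary vertices are v_0,...,v_p; e_(p+1) = [v_0, v_(p+1)] is the only edge at the root;
  e_1..e_p are the boundary edges ending at v_1..v_p; internal vertices v_(p+1)..v_r.\<close>
definition tree_ok :: "nat \<Rightarrow> nat \<Rightarrow> (nat \<Rightarrow> nat) \<Rightarrow> bool" where
  "tree_ok r p par \<longleftrightarrow>
     1 \<le> p \<and> p < r \<and> par (Suc p) = 0 \<and>
     (\<forall>j\<in>{1..r}. j \<noteq> Suc p \<longrightarrow> par j \<in> {Suc p..r}) \<and>
     (\<forall>j\<in>{Suc p..r}. par j < j) \<and>
     (\<forall>k\<in>{Suc p..r}. \<exists>j\<in>{1..r}. par j = k)"

definition Rset :: "nat \<Rightarrow> (nat \<Rightarrow> nat) \<Rightarrow> nat \<Rightarrow> nat set" where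
  "Rset r par k = {j\<in>{1..r}. par j = k}"

definition coef_ok :: "nat \<Rightarrow> nat \<Rightarrow> (nat \<Rightarrow> nat) \<Rightarrow> (nat \<Rightarrow> nat \<Rightarrow> complex) \<Rightarrow>
    (nat \<Rightarrow> nat \<Rightarrow> complex) \<Rightarrow> bool" where
  "coef_ok r p par a a1 \<longleftrightarrow>
     (\<forall>k\<in>{Suc p..r}. (\<forall>j\<in>Rset r par k. a k j * a1 k j \<noteq> 0) \<and>
        (\<Sum>j\<in>Rset r par k. a1 k j / a k j) \<noteq> -1)"

definition potential_ok :: "nat \<Rightarrow> (nat \<Rightarrow> real \<Rightarrow> complex) \<Rightarrow> bool" where
  "potential_ok r q \<longleftrightarrow> (\<forall>j\<in>{1..r}. set_integrable lborel {0..1::real} (q j))"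

definition edge_sol :: "(real \<Rightarrow> complex) \<Rightarrow> complex \<Rightarrow> (real \<Rightarrow> complex) \<Rightarrow> bool" where
  "edge_sol qj lam f \<longleftrightarrow>
     ac_on_interval 0 1 f \<and>
     (\<forall>x\<in>{0..1}. (f has_vector_derivative D f x) (at x within {0..1})) \<and>
     ac_on_interval 0 1 (D f) \<and>
     (AE x in lborel. x \<in> {0..1} \<longrightarrow>
        (D f has_vector_derivative ((qj x - lam) * f x)) (at x within {0..1}))"

definition tree_sol :: "nat \<Rightarrow> nat \<Rightarrow> (nat \<Rightarrow> nat) \<Rightarrow> (nat \<Rightarrow> nat \<Rightarrow> complex) \<Rightarrow>
    (nat \<Rightarrow> nat \<Rightarrow> complex) \<Rightarrow> (nat \<Rightarrow> nat \<Rightarrow> complex) \<Rightarrow> (nat \<Rightarrow> real \<Rightarrow> complex) \<Rightarrow>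
    complex \<Rightarrow> (nat \<Rightarrow> real \<Rightarrow> complex) \<Rightarrow> bool" where
  "tree_sol r p par a a1 a0 q lam Y \<longleftrightarrow>
     (\<forall>j\<in>{1..r}. edge_sol (q j) lam (Y j)) \<and>
     (\<forall>k\<in>{Suc p..r}.
        (\<forall>j\<in>Rset r par k. Y k 0 = a k j * Y j 1) \<and>
        D (Y k) 0 = (\<Sum>j\<in>Rset r par k. a1 k j * D (Y j) 1 + a0 k j * Y j 1))"

definition U0 :: "nat \<Rightarrow> (nat \<Rightarrow> complex) \<Rightarrow> (nat \<Rightarrow> real \<Rightarrow> complex) \<Rightarrow> nat \<Rightarrow> complex" where
  "U0 p h Y j = (if j = 0 then D (Y (Suc p)) 1 + h 0 * Y (Suc p) 1
                 else D (Y j) 0 + h j * Y j 0)"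

text \<open>lam is an eigenvalue of problem B (i.e. a zero of the characteristic function).\<close>
definition eigenvalue_B where
  "eigenvalue_B r p par a a1 a0 q h lam \<longleftrightarrow>
     (\<exists>Y. tree_sol r p par a a1 a0 q lam Y \<and> (\<forall>j\<le>p. U0 p h Y j = 0) \<and>
          (\<exists>j\<in>{1..r}. \<exists>x\<in>{0..1}. Y j x \<noteq> 0))"

definition weyl_solution where
  "weyl_solution r p par a a1 a0 q h k lam Psi \<longleftrightarrow>
     tree_sol r p par a a1 a0 q lam Psi \<and> (\<forall>j\<le>p. U0 p h Psi j = (if j = k then 1 else 0))"

text \<open>Weyl function M_k(lam) = psi_kk(0,lam) (meaningful for lam not an eigenvalue of B).\<close>
definition weyl_fun where
  "weyl_fun r p par a a1 a0 q h k lam =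
     (THE m. \<exists>Psi. weyl_solution r p par a a1 a0 q h k lam Psi \<and> Psi k 0 = m)"

end

theory Submission
  imports Defs "HOL-Complex_Analysis.Complex_Analysis"
begin

text \<open>
  Put \<open>\<lambda> = -\<tau>\<^sup>2\<close> with \<open>\<tau>\<close> large. Along an edge, the ratio \<open>y'/(\<tau> y)\<close> is driven to \<open>1\<close> in either direction
  of travel unless it starts at \<open>-1\<close>, and the regularity condition is exactly what excludes this
  at the vertices. Hence these \<open>\<lambda>\<close> are not eigenvalues, and the Weyl solution decays like \<open>e\<^sup>-\<^sup>\<tau>\<^sup>x\<close> on the
  edge \<open>e\<^sub>k\<close>. On that edge let \<open>S\<close> and \<open>\<phi>\<close> be the solutions with \<open>S(0) = 0\<close>, \<open>S'(0) = 1\<close> and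
  \<open>\<phi>(0) = 1\<close>, \<open>\<phi>'(0) = -h\<^sub>k\<close>, and let a tilde mark the second problem. The Weyl solution is \<open>\<psi> = S + M\<phi>\<close>,
  so if the Weyl functions agree, then \<open>g = S~\<phi> - S\<phi>~ = \<psi>~\<phi> - \<psi>\<phi>~\<close>. For fixed \<open>x\<close> the left side is an
  entire function of \<open>\<lambda>\<close> of order one half that is bounded for \<open>\<lambda> > 0\<close>, while the right side tends to
  zero as \<open>\<lambda> \<rightarrow> -\<infinity>\<close>; by Phragmen--Lindelof and Liouville \<open>g\<close> vanishes. Since both Wronskians equal one,
  \<open>S~\<phi> = S\<phi>~\<close> forces \<open>\<phi>\<^sup>2 = \<phi>~\<^sup>2\<close> and \<open>S\<^sup>2 = S~\<^sup>2\<close>, and differentiating twice gives the claim.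
  This is the Borg--Marchenko argument of Bennewitz.
\<close>

section \<open>Absolutely continuous functions\<close>

text \<open>All information about the tree is gathered on the ray
  \<open>\<lambda> = -\<tau>\<^sup>2\<close>. Solutions of the homogeneous problem vanish there for
  large \<tau>, so the linear system for the Weyl solution is solvable. Its component on
  \<open>e\<^sub>k\<close> has a logarithmic derivative asymptotic to \<open>-\<tau>\<close> at
  \<open>v\<^sub>k\<close>, which forces \<open>M = O(1/\<tau>)\<close>. To obtain this sign one
  travels from the root down to \<open>v\<^sub>k\<close>, and at each vertex of that path the side
  branches enter through ratios computed from their leaves upwards. The rest concerns a single edge.
  Since the potentials are merely integrable, the equation holds only almost everywhere, and
  integral formulas and constancy of Wronskians have to come from absolute continuity. Entire
  dependence on \<lambda> comes from a Neumann series whose terms are polynomials in \<lambda>.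
  Squares fix a solution only up to sign, but the sign drops out of the equation. Both squares are
  used: at a zero of \<phi> the Wronskian makes \<open>S\<close> nonzero, so together they cover
  every point of the edge.\<close>

lemma sum_integral_nonoverlapping_le:
  fixes \<phi> :: "real \<Rightarrow> real" and s t :: "nat \<Rightarrow> real"
  assumes int: "\<phi> integrable_on {a..b}" and nn: "\<And>x. x \<in> {a..b} \<Longrightarrow> 0 \<le> \<phi> x"
    and st: "\<And>i. i < n \<Longrightarrow> a \<le> s i \<and> s i \<le> t i \<and> t i \<le> b"
    and dis: "\<And>i j. i < n \<Longrightarrow> j < n \<Longrightarrow> i \<noteq> j \<Longrightarrow> t i \<le> s j \<or> t j \<le> s i"
  shows "(\<Sum>i<n. integral {s i..t i} \<phi>) \<le> integral {a..b} \<phi>"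
proof -
  \<comment> \<open>Open intervals: touching neighbours may share an end point, but a given point
    lies in at most one of the open intervals, so the restricted integrands add up to at most
    \<open>\<phi>\<close>.\<close>
  let ?\<chi> = "\<lambda>i x. if x \<in> {s i<..<t i} then \<phi> x else 0"
  have *: "(?\<chi> i has_integral integral {s i..t i} \<phi>) {a..b}" if "i < n" for i
  proof -
    have "\<phi> integrable_on {s i..t i}"
      using int st[OF that] by (intro integrable_on_subinterval[OF int]) auto
    then have "(\<phi> has_integral integral {s i..t i} \<phi>) {s i<..<t i}"
      using has_integral_Icc_iff_Ioo by blast
    moreover have "{s i<..<t i} \<subseteq> {a..b}"
      using st[OF that] by auto
    ultimately show ?thesis
      using has_integral_restrict[of "{s i<..<t i}" "{a..b}" \<phi>] by blast
  qed
  have "((\<lambda>x. \<Sum>i<n. ?\<chi> i x) has_integral (\<Sum>i<n. integral {s i..t i} \<phi>)) {a..b}"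
    by (intro has_integral_sum) (use * in auto)
  moreover have "(\<Sum>i<n. ?\<chi> i x) \<le> \<phi> x" if x: "x \<in> {a..b}" for x
  proof (cases "\<exists>i<n. x \<in> {s i<..<t i}")
    case True
    then obtain i where i: "i < n" "x \<in> {s i<..<t i}" by blast
    have "(\<Sum>j<n. ?\<chi> j x) = (\<Sum>j\<in>{i}. ?\<chi> j x)"
    proof (rule sum.mono_neutral_right)
      show "\<forall>j\<in>{..<n} - {i}. ?\<chi> j x = 0"
      proof
        fix j assume "j \<in> {..<n} - {i}"
        then have "t i \<le> s j \<or> t j \<le> s i" using dis[of i j] i by auto
        then show "?\<chi> j x = 0" using i by auto
      qed
    qed (use i in auto)
    then show ?thesis using i by simp
  next
    case False
    then have "(\<Sum>i<n. ?\<chi> i x) = 0" by (intro sum.neutral) auto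
    then show ?thesis using nn[OF x] by simp
  qed
  ultimately show ?thesis
    using int has_integral_le integrable_integral by blast
qed

section \<open>Absolute continuity as a rule, and its closure properties\<close>

abbreviation ac_modulus :: "real \<Rightarrow> real \<Rightarrow> (real \<Rightarrow> 'a::real_normed_vector) \<Rightarrow> real \<Rightarrow> real \<Rightarrow> bool" where
  "ac_modulus a b f d e \<equiv> \<forall>(n::nat) (s::nat \<Rightarrow> real) t.
      (\<forall>i<n. a \<le> s i \<and> s i \<le> t i \<and> t i \<le> b) \<longrightarrow>
      (\<forall>i<n. \<forall>j<n. i \<noteq> j \<longrightarrow> t i \<le> s j \<or> t j \<le> s i) \<longrightarrow>
      (\<Sum>i<n. t i - s i) < d \<longrightarrow> (\<Sum>i<n. norm (f (t i) - f (s i))) < e"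

lemma ac_on_interval_iff_modulus:
  "ac_on_interval a b f \<longleftrightarrow> (\<forall>e>0. \<exists>d>0. ac_modulus a b f d e)"
  unfolding ac_on_interval_def imp_conjL ..

lemma ac_on_intervalE:
  assumes "ac_on_interval a b f" "e > 0"
  obtains d where "d > 0" "ac_modulus a b f d e"
  using assms unfolding ac_on_interval_iff_modulus by (elim allE[of _ e] impE exE conjE)

lemma ac_on_intervalI:
  assumes "\<And>e. e > 0 \<Longrightarrow> \<exists>d>0. ac_modulus a b f d e"
  shows "ac_on_interval a b f"
  unfolding ac_on_interval_iff_modulus by (intro allI impI assms)

lemma ac_on_interval_imp_continuous_on:
  assumes "ac_on_interval a b f"
  shows "continuous_on {a..b} f"
proof -
  have "\<exists>d>0. \<forall>x'\<in>{a..b}. dist x' x < d \<longrightarrow> dist (f x') (f x) < e" if "x \<in> {a..b}" "e > 0" for x e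
  proof (rule ac_on_intervalE[OF assms \<open>e > 0\<close>], intro exI conjI ballI impI)
    fix d x'
    assume "d > 0" and d_mod: "ac_modulus a b f d e"
    note d = d_mod[rule_format]
    show "d > 0" by fact
    assume x': "x' \<in> {a..b}" "dist x' x < d"
    have "norm (f (max x x') - f (min x x')) < e"
      using d[of 1 "\<lambda>_. min x x'" "\<lambda>_. max x x'"] x' \<open>x \<in> {a..b}\<close>
      by (auto simp: dist_real_def min_def max_def)
    then show "dist (f x') (f x) < e"
      by (cases "x \<le> x'") (auto simp: dist_norm norm_minus_commute max_def min_def)
  qed
  then show ?thesis unfolding continuous_on_iff by blast
qed

text \<open>Common source of the closure properties: Lipschitz functions, sums, products and
  functions changed off the interval all have increments controlled in this way.\<close>

lemma ac_on_interval_dominated: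
  assumes f: "ac_on_interval a b f" and g: "ac_on_interval a b g"
    and dom: "\<And>x y. x \<in> {a..b} \<Longrightarrow> y \<in> {a..b} \<Longrightarrow>
      norm (F x - F y) \<le> A * norm (f x - f y) + B * norm (g x - g y)"
    and "A > 0" "B > 0"
  shows "ac_on_interval a b F"
proof (rule ac_on_intervalI)
  fix e :: real assume "e > 0"
  then have e: "e / (2*A) > 0" "e / (2*B) > 0" using \<open>A > 0\<close> \<open>B > 0\<close> by auto
  show "\<exists>d>0. ac_modulus a b F d e"
  proof (rule ac_on_intervalE[OF f e(1)], rule ac_on_intervalE[OF g e(2)],
      rule exI, intro conjI allI impI)
    fix d1 d2 :: real and n :: nat and s t :: "nat \<Rightarrow> real"
    assume "d1 > 0" and d1_mod: "ac_modulus a b f d1 (e / (2*A))"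
    note d1 = d1_mod[rule_format]
    assume "d2 > 0" and d2_mod: "ac_modulus a b g d2 (e / (2*B))"
    note d2 = d2_mod[rule_format]
    show "min d1 d2 > 0" using \<open>d1 > 0\<close> \<open>d2 > 0\<close> by simp
    assume st: "\<forall>i<n. a \<le> s i \<and> s i \<le> t i \<and> t i \<le> b"
      and dis: "\<forall>i<n. \<forall>j<n. i \<noteq> j \<longrightarrow> t i \<le> s j \<or> t j \<le> s i"
      and small: "(\<Sum>i<n. t i - s i) < min d1 d2"
    have 1: "A * (\<Sum>i<n. norm (f (t i) - f (s i))) < e / 2"
      using d1[of n s t] st dis small \<open>A > 0\<close> by (simp add: field_simps)
    have 2: "B * (\<Sum>i<n. norm (g (t i) - g (s i))) < e / 2"
      using d2[of n s t] st dis small \<open>B > 0\<close> by (simp add: field_simps)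
    have "(\<Sum>i<n. norm (F (t i) - F (s i)))
        \<le> (\<Sum>i<n. A * norm (f (t i) - f (s i)) + B * norm (g (t i) - g (s i)))"
    proof (rule sum_mono, rule dom)
      fix i assume "i \<in> {..<n}"
      then have "a \<le> s i \<and> s i \<le> t i \<and> t i \<le> b" using st by simp
      then show "t i \<in> {a..b}" "s i \<in> {a..b}" by auto
    qed
    also have "\<dots> = A * (\<Sum>i<n. norm (f (t i) - f (s i))) + B * (\<Sum>i<n. norm (g (t i) - g (s i)))"
      by (simp add: sum.distrib sum_distrib_left)
    finally show "(\<Sum>i<n. norm (F (t i) - F (s i))) < e" using 1 2 by linarith
  qed
qed

lemma ac_on_interval_id: "ac_on_interval a b (\<lambda>x::real. x)"
proof (rule ac_on_intervalI)
  fix e :: real assume "e > 0"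
  have "(\<Sum>i<n. norm (t i - s i)) = (\<Sum>i<n. t i - s i)"
    if "\<forall>i<n. a \<le> s i \<and> s i \<le> t i \<and> t i \<le> b" for n :: nat and s t :: "nat \<Rightarrow> real"
    by (rule sum.cong) (use that in auto)
  then show "\<exists>d>0. ac_modulus a b (\<lambda>x. x) d e"
    using \<open>e > 0\<close> by (intro exI[of _ e]) simp
qed

lemma ac_on_interval_lipschitz:
  assumes "\<And>x y. x \<in> {a..b} \<Longrightarrow> y \<in> {a..b} \<Longrightarrow> norm (f x - f y) \<le> K * \<bar>x - y\<bar>"
  shows "ac_on_interval a b f"
proof (rule ac_on_interval_dominated[OF ac_on_interval_id ac_on_interval_id])
  fix x y assume "x \<in> {a..b}" "y \<in> {a..b}"
  then have "norm (f x - f y) \<le> K * \<bar>x - y\<bar>" by (rule assms)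
  \<comment> \<open>The domination lemma wants positive constants, and \<open>K\<close> may have any
    sign; hence \<open>\<bar>K\<bar> + 1\<close> and the extra summand.\<close>
  also have "\<dots> \<le> (\<bar>K\<bar> + 1) * norm (x - y) + 1 * norm (x - y)"
    using mult_right_mono[OF abs_ge_self abs_ge_zero, of K "x - y"] abs_ge_zero[of "x - y"]
    unfolding real_norm_def distrib_right mult_1 by linarith
  finally show "norm (f x - f y) \<le> (\<bar>K\<bar> + 1) * norm (x - y) + 1 * norm (x - y)" .
qed auto

lemma ac_on_interval_C1:
  fixes f :: "real \<Rightarrow> 'a::real_normed_vector"
  assumes der: "\<And>x. x \<in> {a..b} \<Longrightarrow> (f has_vector_derivative f' x) (at x within {a..b})"
    and cont: "continuous_on {a..b} f'"
  shows "ac_on_interval a b f"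
proof -
  have "bounded (f' ` {a..b})"
    using cont compact_Icc compact_continuous_image compact_imp_bounded by blast
  then obtain K where K: "\<And>x. x \<in> {a..b} \<Longrightarrow> norm (f' x) \<le> K"
    unfolding bounded_iff by blast
  show ?thesis
  proof (rule ac_on_interval_lipschitz[where K=K])
    fix x y assume xy: "x \<in> {a..b}" "y \<in> {a..b}"
    have "norm (f x - f y) \<le> K * norm (x - y)"
    proof (rule differentiable_bound[of "{a..b}" f "\<lambda>x h. h *\<^sub>R f' x"])
      show "(f has_derivative (\<lambda>h. h *\<^sub>R f' x)) (at x within {a..b})" if "x \<in> {a..b}" for x
        using der[OF that] by (simp add: has_vector_derivative_def)
      show "onorm (\<lambda>h. h *\<^sub>R f' x) \<le> K" if "x \<in> {a..b}" for x
        by (rule onorm_le) (use K[OF that] in \<open>simp add: mult.commute[of K] mult_left_mono\<close>)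
    qed (use xy in auto)
    then show "norm (f x - f y) \<le> K * \<bar>x - y\<bar>" by simp
  qed
qed

lemma ac_on_interval_add:
  assumes "ac_on_interval a b f" "ac_on_interval a b g"
  shows "ac_on_interval a b (\<lambda>x. f x + g x)"
proof (rule ac_on_interval_dominated[OF assms, where A=1 and B=1])
  fix x y
  have "f x + g x - (f y + g y) = (f x - f y) + (g x - g y)" by simp
  then show "norm (f x + g x - (f y + g y)) \<le> 1 * norm (f x - f y) + 1 * norm (g x - g y)"
    by (metis mult_1 norm_triangle_ineq)
qed auto

lemma ac_on_interval_mult:
  fixes f g :: "real \<Rightarrow> 'a::real_normed_algebra"
  assumes f: "ac_on_interval a b f" and g: "ac_on_interval a b g"
  shows "ac_on_interval a b (\<lambda>x. f x * g x)"
proof -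
  have "bounded (f ` {a..b})" "bounded (g ` {a..b})"
    using f g ac_on_interval_imp_continuous_on compact_Icc compact_continuous_image
      compact_imp_bounded by metis+
  then obtain A B where A: "A > 0" "\<And>x. x \<in> {a..b} \<Longrightarrow> norm (f x) \<le> A"
    and B: "B > 0" "\<And>x. x \<in> {a..b} \<Longrightarrow> norm (g x) \<le> B"
    unfolding bounded_pos by (metis imageI)
  show ?thesis
  proof (rule ac_on_interval_dominated[OF f g _ B(1) A(1)])
    fix x y assume xy: "x \<in> {a..b}" "y \<in> {a..b}"
    have "f x * g x - f y * g y = (f x - f y) * g x + f y * (g x - g y)"
      by (simp add: algebra_simps)
    also have "norm \<dots> \<le> norm (f x - f y) * norm (g x) + norm (f y) * norm (g x - g y)"
      by (metis add_mono norm_mult_ineq norm_triangle_le)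
    also have "\<dots> \<le> norm (f x - f y) * B + A * norm (g x - g y)"
      using A(1) A(2)[OF xy(2)] B(2)[OF xy(1)] by (intro add_mono mult_mono) auto
    finally show "norm (f x * g x - f y * g y) \<le> B * norm (f x - f y) + A * norm (g x - g y)"
      by (simp add: mult.commute)
  qed
qed

lemma ac_on_interval_const: "ac_on_interval a b (\<lambda>x. c)"
  by (rule ac_on_interval_lipschitz[where K=0]) auto

lemma ac_on_interval_reflect:
  fixes f :: "real \<Rightarrow> 'a::real_normed_vector"
  assumes "ac_on_interval 0 1 f"
  shows "ac_on_interval 0 1 (\<lambda>x. f (1 - x))"
proof (rule ac_on_intervalI)
  fix e :: real assume "e > 0"
  show "\<exists>d>0. ac_modulus 0 1 (\<lambda>x. f (1 - x)) d e"
  proof (rule ac_on_intervalE[OF assms \<open>e > 0\<close>], rule exI, intro conjI allI impI)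
    fix d :: real and n :: nat and s t :: "nat \<Rightarrow> real"
    assume "d > 0" and d_mod: "ac_modulus 0 1 f d e"
    note d = d_mod[rule_format]
    show "d > 0" by fact
    assume st: "\<forall>i<n. 0 \<le> s i \<and> s i \<le> t i \<and> t i \<le> 1"
      and dis: "\<forall>i<n. \<forall>j<n. i \<noteq> j \<longrightarrow> t i \<le> s j \<or> t j \<le> s i"
      and small: "(\<Sum>i<n. t i - s i) < d"
    have "(\<Sum>i<n. norm (f (1 - s i) - f (1 - t i))) < e"
    proof (rule d[of n "\<lambda>i. 1 - t i" "\<lambda>i. 1 - s i"])
      fix i j assume "i < n" "j < n" "i \<noteq> j"
      then have "t i \<le> s j \<or> t j \<le> s i" using dis by blast
      then show "1 - s i \<le> 1 - t j \<or> 1 - s j \<le> 1 - t i" by linarith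
    qed (use st small in auto)
    then show "(\<Sum>i<n. norm (f (1 - t i) - f (1 - s i))) < e"
      by (simp add: norm_minus_commute)
  qed
qed

section \<open>Integrals of derivatives and derivatives of integrals\<close>

text \<open>The null set where the derivative is unknown is covered by an open set so small that, by
  absolute continuity, the intervals tagged in it contribute little to any Riemann sum.\<close>

lemma ac_on_interval_has_integral:
  fixes f :: "real \<Rightarrow> 'a::euclidean_space"
  assumes ac: "ac_on_interval a b f" and "a \<le> b"
    and der: "AE x in lborel. x \<in> {a..b} \<longrightarrow> (f has_vector_derivative g x) (at x within {a..b})"
  shows "(g has_integral f b - f a) {a..b}"
proof -
  obtain N where N: "N \<in> null_sets lborel"
    and derN: "\<And>x. x \<in> {a..b} \<Longrightarrow> x \<notin> N \<Longrightarrow> (f has_vector_derivative g x) (at x within {a..b})"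
    using der by (force simp: eventually_ae_filter)
  \<comment> \<open>On the null set \<open>g\<close> is arbitrary, so the Riemann sums are formed
    with value 0 there; the closing spike argument returns to \<open>g\<close>.\<close>
  define g' where "g' x = (if x \<in> N then 0 else g x)" for x
  have "(g' has_integral f b - f a) {a..b}"
    unfolding has_integral_real
  proof (intro allI impI)
    fix e :: real assume "e > 0"
    then have "e/2 > 0" by simp
    show "\<exists>\<gamma>. gauge \<gamma> \<and> (\<forall>\<D>. \<D> tagged_division_of {a..b} \<and> \<gamma> fine \<D> \<longrightarrow>
        norm (sum (\<lambda>(x,k). measure lborel k *\<^sub>R g' x) \<D> - (f b - f a)) < e)"
    proof (rule ac_on_intervalE[OF ac \<open>e/2 > 0\<close>])
      fix d :: real
      assume "d > 0" and d_mod: "ac_modulus a b f d (e/2)"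
      note d = d_mod[rule_format]
      have "N \<in> sets borel" using N by (auto simp: null_sets_def)
      from outer_regular_lborel[OF this \<open>d > 0\<close>]
      obtain U where U: "open U" "N \<subseteq> U" and Ud: "emeasure lborel (U - N) < ennreal d" .
      have Um: "measure lebesgue (U \<inter> {a..b}) < d"
      proof -
        have "U \<in> sets lborel" using U by simp
        then have "emeasure lborel (U \<inter> {a..b}) \<le> emeasure lborel U"
          by (intro emeasure_mono) auto
        also have "\<dots> = emeasure lborel (U - N)"
          using N \<open>U \<in> sets lborel\<close> by (simp add: emeasure_Diff_null_set)
        finally have "emeasure lborel (U \<inter> {a..b}) < ennreal d" using Ud by simp
        then have "emeasure lebesgue (U \<inter> {a..b}) < ennreal d" using U by simp
        then show ?thesis
          by (metis \<open>0 < d\<close> emeasure_eq_ennreal_measure ennreal_less_iff measure_nonneg top.not_eq_extremum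
              order_less_imp_not_less)
      qed
      have Ulm: "U \<inter> {a..b} \<in> lmeasurable"
        by (rule bounded_set_imp_lmeasurable) (use U in \<open>simp_all add: bounded_Int\<close>)
      \<comment> \<open>Makes the contribution of the good tags, at most
        \<open>\<epsilon> * (b - a)\<close>, no larger than \<open>e/2\<close>; the added 1 covers
        \<open>a = b\<close>.\<close>
      define \<epsilon> where "\<epsilon> = e / (2 * (b - a + 1))"
      have "\<epsilon> > 0" using \<open>e > 0\<close> \<open>a \<le> b\<close> by (simp add: \<epsilon>_def)
      have "\<exists>\<delta>>0. x \<in> {a..b} \<longrightarrow> x \<notin> N \<longrightarrow>
          (\<forall>y\<in>{a..b}. \<bar>y - x\<bar> < \<delta> \<longrightarrow> norm (f y - f x - (y - x) *\<^sub>R g x) \<le> \<epsilon> * \<bar>y - x\<bar>)" for x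
      proof (cases "x \<in> {a..b} \<and> x \<notin> N")
        case True
        then have "(f has_derivative (\<lambda>h. h *\<^sub>R g x)) (at x within {a..b})"
          using derN by (simp add: has_vector_derivative_def)
        then obtain \<delta> where "\<delta> > 0"
          "\<forall>y\<in>{a..b}. norm (y - x) < \<delta> \<longrightarrow> norm (f y - f x - (y - x) *\<^sub>R g x) \<le> \<epsilon> * norm (y - x)"
          using \<open>\<epsilon> > 0\<close> unfolding has_derivative_within_alt by blast
        then show ?thesis by auto
      next
        case False
        then show ?thesis by (intro exI[of _ 1]) auto
      qed
      then obtain \<delta> where \<delta>: "\<And>x. \<delta> x > 0"
        "\<And>x y. x \<in> {a..b} \<Longrightarrow> x \<notin> N \<Longrightarrow> y \<in> {a..b} \<Longrightarrow> \<bar>y - x\<bar> < \<delta> x \<Longrightarrow>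
          norm (f y - f x - (y - x) *\<^sub>R g x) \<le> \<epsilon> * \<bar>y - x\<bar>"
        by metis
      \<comment> \<open>At points of \<open>N\<close> the gauge is \<open>U\<close> itself, which
        forces every interval tagged in \<open>N\<close> into \<open>U\<close>.\<close>
      define \<gamma> where "\<gamma> x = (if x \<in> N then U else ball x (\<delta> x))" for x
      have gauge: "gauge \<gamma>"
        unfolding gauge_def \<gamma>_def using U \<delta>(1) by auto
      have main: "norm (sum (\<lambda>(x,k). measure lborel k *\<^sub>R g' x) p - (f b - f a)) < e"
        if p: "p tagged_division_of {a..b}" and fine: "\<gamma> fine p" for p
      proof -
        have fin: "finite p" using p by blast
        have el: "\<exists>u v. k = {u..v} \<and> u \<le> v \<and> a \<le> u \<and> v \<le> b \<and> x \<in> {u..v} \<and> {u..v} \<subseteq> \<gamma> x"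
          if "(x, k) \<in> p" for x k
        proof -
          have "x \<in> k" "k \<subseteq> {a..b}" "\<exists>u v. k = cbox u v" "k \<subseteq> \<gamma> x"
            using tagged_division_ofD(2-4)[OF p that] that fine by (auto simp: fine_def)
          then show ?thesis by fastforce
        qed
        \<comment> \<open>One-point intervals are left out: they contribute nothing, but may lie
          inside another interval of the division and would break the ordering required by
          \<open>ac_modulus\<close>.\<close>
        define P where "P = {y \<in> p. fst y \<in> N \<and> Inf (snd y) < Sup (snd y)}"
        have finP: "finite P" using fin by (simp add: P_def)
        have bad: "(\<Sum>y\<in>P. norm (f (Sup (snd y)) - f (Inf (snd y)))) < e/2"
        proof -
          obtain h where h: "bij_betw h {..<card P} P"
            using ex_bij_betw_nat_finite[OF finP] by (auto simp: atLeast0LessThan)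
          define s t where "s i = Inf (snd (h i))" and "t i = Sup (snd (h i))" for i
          have hP: "h i \<in> P" if "i < card P" for i
            using h that by (auto simp: bij_betw_def)
          have st: "a \<le> s i \<and> s i < t i \<and> t i \<le> b \<and> snd (h i) = {s i..t i} \<and> {s i..t i} \<subseteq> U"
            if "i < card P" for i
          proof -
            have "(fst (h i), snd (h i)) \<in> p" "fst (h i) \<in> N" "s i < t i"
              using hP[OF that] by (auto simp: P_def s_def t_def)
            with el[OF this(1)] show ?thesis
              by (auto simp: s_def t_def \<gamma>_def)
          qed
          have dis: "t i \<le> s j \<or> t j \<le> s i" if "i < card P" "j < card P" "i \<noteq> j" for i j
          proof -
            have ne: "h i \<noteq> h j"
              using h that by (auto simp: bij_betw_def inj_on_def)
            have "(fst (h i), snd (h i)) \<in> p" "(fst (h j), snd (h j)) \<in> p"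
              using hP that by (auto simp: P_def)
            from tagged_division_ofD(5)[OF p this] ne
            have "interior (snd (h i)) \<inter> interior (snd (h j)) = {}"
              by (simp add: prod_eq_iff)
            then have emp: "{s i<..<t i} \<inter> {s j<..<t j} = {}"
              using st that by (simp add: interior_atLeastAtMost_real)
            show ?thesis
            proof (rule ccontr)
              assume "\<not> ?thesis"
              then have "max (s i) (s j) < min (t i) (t j)" using st that by auto
              then obtain z where "max (s i) (s j) < z" "z < min (t i) (t j)" using dense by blast
              then show False using emp by auto
            qed
          qed
          \<comment> \<open>The bad intervals lie in \<open>U\<close>, so their total length is an
            integral of the indicator of \<open>U\<close> and is bounded by the measure of
            \<open>U\<close>.\<close>
          have "(\<Sum>i<card P. t i - s i) = (\<Sum>i<card P. integral {s i..t i} (indicator U))"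
          proof (rule sum.cong)
            fix i assume "i \<in> {..<card P}"
            then have "integral {s i..t i} (indicator U) = integral {s i..t i} (\<lambda>x. 1::real)"
              using st[of i] by (intro integral_cong) (auto simp: indicator_def)
            then show "t i - s i = integral {s i..t i} (indicator U)"
              using st[of i] \<open>i \<in> {..<card P}\<close> by simp
          qed simp
          also have "\<dots> \<le> integral {a..b} (indicator U)"
          proof (rule sum_integral_nonoverlapping_le)
            show "(indicator U::real\<Rightarrow>real) integrable_on {a..b}"
              using Ulm integrable_on_indicator by blast
          qed (use st dis in \<open>auto intro: less_imp_le\<close>)
          also have "\<dots> < d"
            using Um Ulm by (simp add: integral_indicator)
          finally have "(\<Sum>i<card P. t i - s i) < d" .
          then have "(\<Sum>i<card P. norm (f (t i) - f (s i))) < e/2"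
            using st dis by (intro d) (auto intro: less_imp_le)
          also have "(\<Sum>i<card P. norm (f (t i) - f (s i))) = (\<Sum>y\<in>P. norm (f (Sup (snd y)) - f (Inf (snd y))))"
            unfolding s_def t_def by (rule sum.reindex_bij_betw[OF h])
          finally show ?thesis .
        qed
        have "norm (sum (\<lambda>(x,k). measure lborel k *\<^sub>R g' x) p - (f b - f a))
            = norm (\<Sum>(x,k)\<in>p. measure lborel k *\<^sub>R g' x - (f (Sup k) - f (Inf k)))"
          unfolding additive_tagged_division_1[OF \<open>a \<le> b\<close> p, of f, symmetric]
          by (simp add: sum_subtractf split_def)
        also have "\<dots> \<le> (\<Sum>y\<in>p. (if y \<in> P then norm (f (Sup (snd y)) - f (Inf (snd y))) else 0)
            + \<epsilon> * measure lborel (snd y))"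
        proof (rule sum_norm_le, clarify)
          fix x k assume xk: "(x, k) \<in> p"
          then obtain u v where k: "k = {u..v}" "u \<le> v" "a \<le> u" "v \<le> b" "x \<in> {u..v}" "{u..v} \<subseteq> \<gamma> x"
            using el by blast
          have cont: "measure lborel k = v - u" using k by simp
          have IS: "Inf k = u" "Sup k = v" using k by auto
          have "norm (measure lborel k *\<^sub>R g' x - (f v - f u)) \<le>
            (if (x, k) \<in> P then norm (f v - f u) else 0) + \<epsilon> * measure lborel k"
          proof (cases "x \<in> N")
            case True
            then show ?thesis
              using xk IS cont k \<open>\<epsilon> > 0\<close>
              by (cases "u = v") (auto simp: P_def g'_def norm_minus_commute)
          next
            case False
            then have sub: "{u..v} \<subseteq> ball x (\<delta> x)" using k by (simp add: \<gamma>_def)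
            have "u \<in> {u..v}" "v \<in> {u..v}" using k(2) by simp_all
            with sub have "u \<in> ball x (\<delta> x)" "v \<in> ball x (\<delta> x)" by blast+
            then have uv: "\<bar>u - x\<bar> < \<delta> x" "\<bar>v - x\<bar> < \<delta> x" by (auto simp: dist_real_def)
            have x: "x \<in> {a..b}" "u \<in> {a..b}" "v \<in> {a..b}" using k by auto
            have "norm (f v - f x - (v - x) *\<^sub>R g x) \<le> \<epsilon> * \<bar>v - x\<bar>"
              "norm (f u - f x - (u - x) *\<^sub>R g x) \<le> \<epsilon> * \<bar>u - x\<bar>"
              using \<delta>(2) x uv False by blast+
            moreover have "measure lborel k *\<^sub>R g' x - (f v - f u) =
                (f u - f x - (u - x) *\<^sub>R g x) - (f v - f x - (v - x) *\<^sub>R g x)"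
              using False by (simp add: g'_def cont algebra_simps)
            ultimately have "norm (measure lborel k *\<^sub>R g' x - (f v - f u)) \<le> \<epsilon> * \<bar>u - x\<bar> + \<epsilon> * \<bar>v - x\<bar>"
              by (metis add_mono norm_triangle_le_diff)
            also have "\<dots> = \<epsilon> * measure lborel k"
              using k(5) by (simp add: cont algebra_simps)
            finally show ?thesis using False by (simp add: P_def)
          qed
          then show "norm (measure lborel k *\<^sub>R g' x - (f (Sup k) - f (Inf k))) \<le>
            (if (x, k) \<in> P then norm (f (Sup (snd (x, k))) - f (Inf (snd (x, k)))) else 0) + \<epsilon> * measure lborel (snd (x, k))"
            unfolding IS snd_conv .
        qed
        also have "\<dots> = (\<Sum>y\<in>P. norm (f (Sup (snd y)) - f (Inf (snd y)))) + \<epsilon> * (\<Sum>y\<in>p. measure lborel (snd y))"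
        proof -
          have "(\<Sum>y\<in>p. if y \<in> P then norm (f (Sup (snd y)) - f (Inf (snd y))) else 0) =
              (\<Sum>y\<in>P. norm (f (Sup (snd y)) - f (Inf (snd y))))"
            using fin by (subst sum.inter_restrict[symmetric]) (auto simp: P_def intro: sum.cong)
          then show ?thesis by (simp add: sum.distrib sum_distrib_left)
        qed
        also have "(\<Sum>y\<in>p. measure lborel (snd y)) = b - a"
          using additive_content_tagged_division[of p a b] p \<open>a \<le> b\<close> by (simp add: split_def)
        also have "\<epsilon> * (b - a) \<le> e/2"
          using \<open>e > 0\<close> \<open>a \<le> b\<close> by (simp add: \<epsilon>_def field_simps)
        finally show ?thesis using bad by linarith
      qed
      show ?thesis
        by (rule exI[of _ \<gamma>], intro conjI allI impI gauge main) simp_all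
    qed
  qed
  moreover have "negligible N"
    using N by (simp add: negligible_iff_null_sets null_sets_completionI)
  ultimately show ?thesis
    by (rule has_integral_spike[rotated 2]) (auto simp: g'_def)
qed

text \<open>Truncate the norm of \<open>g\<close> at a level \<open>n\<close> with remainder of
  integral below \<open>e/2\<close>. On intervals of small total length the truncated part
  contributes at most \<open>n\<close> times that length. The \<open>n + 1\<close> in the choice of
  the modulus keeps the denominator positive.\<close>

lemma ac_on_interval_indefinite_integral:
  fixes g :: "real \<Rightarrow> 'a::euclidean_space"
  assumes g: "g absolutely_integrable_on {a..b}"
  shows "ac_on_interval a b (\<lambda>x. integral {a..x} g)"
proof (rule ac_on_intervalI)
  fix e :: real assume "e > 0"
  define G where "G n x = min (norm (g x)) (real n)" for n x
  have ng: "(\<lambda>x. norm (g x)) absolutely_integrable_on {a..b}"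
    using absolutely_integrable_norm[OF g] by (simp add: o_def)
  have Gi: "G n integrable_on {a..b}" for n
  proof -
    have "(\<lambda>x. min (norm (g x)) (real n)) absolutely_integrable_on {a..b}"
      by (intro absolutely_integrable_min_1 ng) auto
    then show ?thesis
      unfolding G_def using set_lebesgue_integral_eq_integral(1) by blast
  qed
  have ngi: "(\<lambda>x. norm (g x)) integrable_on {a..b}"
    using ng set_lebesgue_integral_eq_integral(1) by blast
  have "(\<lambda>n. integral {a..b} (G n)) \<longlonglongrightarrow> integral {a..b} (\<lambda>x. norm (g x))"
  proof (rule dominated_convergence(2)[OF Gi ngi])
    show "norm (G n x) \<le> norm (g x)" for n x by (simp add: G_def)
    show "(\<lambda>n. G n x) \<longlonglongrightarrow> norm (g x)" for x
    proof (rule tendsto_eventually)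
      obtain m :: nat where "norm (g x) \<le> real m" using real_arch_simple by blast
      then show "\<forall>\<^sub>F n in sequentially. G n x = norm (g x)"
        by (intro eventually_sequentiallyI[of m]) (auto simp: G_def)
    qed
  qed
  from LIMSEQ_D[OF this, of "e/2"] \<open>e > 0\<close> obtain n
    where n: "norm (integral {a..b} (G n) - integral {a..b} (\<lambda>x. norm (g x))) < e/2" by auto
  show "\<exists>d>0. ac_modulus a b (\<lambda>x. integral {a..x} g) d e"
  proof (rule exI[of _ "e / (2 * (real n + 1))"], intro conjI allI impI)
    show "e / (2 * (real n + 1)) > 0" using \<open>e > 0\<close> by simp
    fix m :: nat and s t :: "nat \<Rightarrow> real"
    assume st: "\<forall>i<m. a \<le> s i \<and> s i \<le> t i \<and> t i \<le> b"
      and dis: "\<forall>i<m. \<forall>j<m. i \<noteq> j \<longrightarrow> t i \<le> s j \<or> t j \<le> s i"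
      and small: "(\<Sum>i<m. t i - s i) < e / (2 * (real n + 1))"
    have gi: "g integrable_on {a..b}" using g set_lebesgue_integral_eq_integral(1) by blast
    have "norm (integral {a..t i} g - integral {a..s i} g)
        \<le> integral {s i..t i} (\<lambda>x. norm (g x) - G n x) + real n * (t i - s i)" if "i < m" for i
    proof -
      have i: "a \<le> s i" "s i \<le> t i" "t i \<le> b" using st that by auto
      have sub: "{s i..t i} \<subseteq> {a..b}" using i by auto
      have "integral {a..s i} g + integral {s i..t i} g = integral {a..t i} g"
        using i by (intro Henstock_Kurzweil_Integration.integral_combine integrable_on_subinterval[OF gi]) auto
      then have "norm (integral {a..t i} g - integral {a..s i} g) = norm (integral {s i..t i} g)"
        by (metis add_diff_cancel_left')
      also have "\<dots> \<le> integral {s i..t i} (\<lambda>x. norm (g x))"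
        by (intro integral_norm_bound_integral integrable_on_subinterval[OF gi sub]
            integrable_on_subinterval[OF ngi sub]) auto
      also have "\<dots> = integral {s i..t i} (\<lambda>x. (norm (g x) - G n x) + G n x)" by simp
      also have "\<dots> = integral {s i..t i} (\<lambda>x. norm (g x) - G n x) + integral {s i..t i} (G n)"
        by (intro Henstock_Kurzweil_Integration.integral_add Henstock_Kurzweil_Integration.integrable_diff
            integrable_on_subinterval[OF ngi sub] integrable_on_subinterval[OF Gi sub])
      also have "integral {s i..t i} (G n) \<le> integral {s i..t i} (\<lambda>x. real n)"
        by (intro integral_le integrable_on_subinterval[OF Gi sub]) (auto simp: G_def)
      also have "\<dots> = real n * (t i - s i)" using i by simp
      finally show ?thesis by simp
    qed
    then have "(\<Sum>i<m. norm (integral {a..t i} g - integral {a..s i} g))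
        \<le> (\<Sum>i<m. integral {s i..t i} (\<lambda>x. norm (g x) - G n x) + real n * (t i - s i))"
      by (intro sum_mono) auto
    also have "\<dots> = (\<Sum>i<m. integral {s i..t i} (\<lambda>x. norm (g x) - G n x)) + real n * (\<Sum>i<m. t i - s i)"
      by (simp add: sum.distrib sum_distrib_left)
    also have "(\<Sum>i<m. integral {s i..t i} (\<lambda>x. norm (g x) - G n x))
        \<le> integral {a..b} (\<lambda>x. norm (g x) - G n x)"
      by (rule sum_integral_nonoverlapping_le[OF Henstock_Kurzweil_Integration.integrable_diff[OF ngi Gi]])
        (use st dis in \<open>auto simp: G_def\<close>)
    also have "\<dots> = integral {a..b} (\<lambda>x. norm (g x)) - integral {a..b} (G n)"
      by (rule Henstock_Kurzweil_Integration.integral_diff[OF ngi Gi])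
    also have "\<dots> < e/2" using n by (simp add: abs_real_def split: if_splits)
    finally have "(\<Sum>i<m. norm (integral {a..t i} g - integral {a..s i} g)) < e/2 + real n * (\<Sum>i<m. t i - s i)"
      by simp
    moreover have "real n * (\<Sum>i<m. t i - s i) \<le> real n * (e / (2 * (real n + 1)))"
      using small by (intro mult_left_mono) auto
    moreover have "real n * (e / (2 * (real n + 1))) \<le> e/2"
      using \<open>e > 0\<close> by (simp add: field_simps)
    ultimately show "(\<Sum>i<m. norm (integral {a..t i} g - integral {a..s i} g)) < e" by linarith
  qed
qed

text \<open>Lebesgue differentiation. \<open>integrable_ccontinuous_explicit\<close> treats
  intervals to the right of a point; applied to the extension of \<open>g\<close> by zero and to its
  reflection it yields both one-sided derivatives.\<close>

lemma AE_has_vector_derivative_indefinite_integral: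
  fixes g :: "real \<Rightarrow> 'a::euclidean_space"
  assumes g: "g integrable_on {a..b}"
  shows "AE x in lborel. x \<in> {a..b} \<longrightarrow>
    ((\<lambda>x. integral {a..x} g) has_vector_derivative g x) (at x within {a..b})"
proof -
  define f where "f x = (if x \<in> {a..b} then g x else 0)" for x
  have "f integrable_on UNIV"
    unfolding f_def using g integrable_restrict_UNIV by blast
  then have fi: "f integrable_on cbox u v" for u v
    using integrable_on_subcbox by blast
  have fi': "(\<lambda>x. f (- x)) integrable_on cbox u v" for u v
    using fi[of "-v" "-u"] Henstock_Kurzweil_Integration.integrable_reflect_real[where f=f and a="-v" and b="-u"] by simp
  obtain N1 where N1: "negligible N1" "\<And>x e. \<lbrakk>x \<notin> N1; 0 < e\<rbrakk> \<Longrightarrow> \<exists>d>0. \<forall>h. 0 < h \<and> h < d \<longrightarrow>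
      norm (integral (cbox x (x + h *\<^sub>R One)) f /\<^sub>R h ^ DIM(real) - f x) < e"
    using integrable_ccontinuous_explicit[OF fi] by metis
  obtain N2 where N2: "negligible N2" "\<And>x e. \<lbrakk>x \<notin> N2; 0 < e\<rbrakk> \<Longrightarrow> \<exists>d>0. \<forall>h. 0 < h \<and> h < d \<longrightarrow>
      norm (integral (cbox x (x + h *\<^sub>R One)) (\<lambda>x. f (- x)) /\<^sub>R h ^ DIM(real) - f (- x)) < e"
    using integrable_ccontinuous_explicit[OF fi'] by metis
  define N where "N = N1 \<union> uminus ` N2"
  have "negligible N"
    unfolding N_def using N1 N2
    by (intro negligible_Un negligible_differentiable_image_negligible differentiable_on_minus) auto
  \<comment> \<open>A negligible set is null for the completed measure only, while
    \<open>AE x in lborel\<close> asks for a Borel null set; hence the enlargement.\<close>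
  then obtain N' where N': "N' \<in> null_sets lborel" "N \<subseteq> N'"
    by (auto simp: negligible_iff_null_sets null_sets_completion_iff2)
  have "((\<lambda>x. integral {a..x} g) has_vector_derivative g x) (at x within {a..b})"
    if x: "x \<in> {a..b}" "x \<notin> N" for x
    unfolding has_vector_derivative_def has_derivative_within_alt
  proof (intro conjI allI impI)
    fix e :: real assume "e > 0"
    from x have "x \<notin> N1" "- x \<notin> N2" by (auto simp: N_def image_iff)
    have fx: "f x = g x" using x by (simp add: f_def)
    obtain d1 where d1: "d1 > 0" "\<And>h. 0 < h \<Longrightarrow> h < d1 \<Longrightarrow> norm (integral {x..x + h} f /\<^sub>R h - g x) < e"
      using N1(2)[OF \<open>x \<notin> N1\<close> \<open>e > 0\<close>] fx by auto
    obtain d2 where d2: "d2 > 0" "\<And>h. 0 < h \<Longrightarrow> h < d2 \<Longrightarrow>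
        norm (integral {-x..-x + h} (\<lambda>x. f (- x)) /\<^sub>R h - g x) < e"
      using N2(2)[OF \<open>- x \<notin> N2\<close> \<open>e > 0\<close>] fx by auto
    have comb: "integral {a..v} g - integral {a..u} g = integral {u..v} f"
      if "a \<le> u" "u \<le> v" "v \<le> b" for u v
    proof -
      have "integral {a..u} g + integral {u..v} g = integral {a..v} g"
        using that by (intro Henstock_Kurzweil_Integration.integral_combine integrable_on_subinterval[OF g]) auto
      moreover have "integral {u..v} g = integral {u..v} f"
        using that by (intro integral_cong) (auto simp: f_def)
      ultimately show ?thesis by (metis add_diff_cancel_left')
    qed
    have *: "norm (I - h *\<^sub>R g x) \<le> e * h" if "0 < h" "norm (I /\<^sub>R h - g x) < e" for I h
    proof -
      have "norm (I - h *\<^sub>R g x) = norm (h *\<^sub>R (I /\<^sub>R h - g x))"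
        using that by (simp add: scaleR_right_diff_distrib)
      also have "\<dots> = h * norm (I /\<^sub>R h - g x)" using that by simp
      also have "\<dots> \<le> h * e" using that by (intro mult_left_mono) auto
      finally show ?thesis by (simp add: mult.commute)
    qed
    show "\<exists>d>0. \<forall>y\<in>{a..b}. norm (y - x) < d \<longrightarrow>
        norm (integral {a..y} g - integral {a..x} g - (y - x) *\<^sub>R g x) \<le> e * norm (y - x)"
    proof (intro exI[of _ "min d1 d2"] conjI ballI impI)
      show "min d1 d2 > 0" using d1 d2 by simp
      fix y assume y: "y \<in> {a..b}" "norm (y - x) < min d1 d2"
      consider "y = x" | "y > x" | "y < x" by linarith
      then show "norm (integral {a..y} g - integral {a..x} g - (y - x) *\<^sub>R g x) \<le> e * norm (y - x)"
      proof cases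
        case 1 then show ?thesis by simp
      next
        case 2
        have "norm (integral {x..x + (y - x)} f /\<^sub>R (y - x) - g x) < e"
          using 2 y by (intro d1) auto
        then have "norm (integral {x..y} f - (y - x) *\<^sub>R g x) \<le> e * (y - x)"
          using *[of "y - x" "integral {x..y} f"] 2 by simp
        then show ?thesis using comb[of x y] 2 x y by simp
      next
        case 3
        have "norm (integral {-x..-x + (x - y)} (\<lambda>x. f (- x)) /\<^sub>R (x - y) - g x) < e"
          using 3 y by (intro d2) auto
        moreover have "integral {-x..-x + (x - y)} (\<lambda>x. f (- x)) = integral {y..x} f"
          using Henstock_Kurzweil_Integration.integral_reflect_real[where f=f and a=y and b=x] by simp
        ultimately have "norm (integral {y..x} f - (x - y) *\<^sub>R g x) \<le> e * (x - y)"
          using *[of "x - y" "integral {y..x} f"] 3 by simp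
        moreover have "integral {a..y} g - integral {a..x} g - (y - x) *\<^sub>R g x = - (integral {y..x} f - (x - y) *\<^sub>R g x)"
          using comb[of y x] 3 x y by (simp add: algebra_simps)
        ultimately show ?thesis using 3 by (simp only: norm_minus_cancel) simp
      qed
    qed
  qed (rule bounded_linear_scaleR_left)
  then show ?thesis
    using N' by (intro AE_I'[OF N'(1)]) auto
qed

section \<open>Solutions of the equation on one edge\<close>

lemma set_integrable_lborel_imp_lebesgue:
  fixes f :: "real \<Rightarrow> 'a::euclidean_space"
  assumes "set_integrable lborel S f"
  shows "f absolutely_integrable_on S"
proof -
  have "(\<lambda>x. indicator S x *\<^sub>R f x) \<in> borel_measurable lborel"
    using assms unfolding set_integrable_def by (rule borel_measurable_integrable)
  then show ?thesis
    using assms unfolding set_integrable_def by (simp add: integrable_completion)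
qed

lemma absolutely_integrable_onD:
  fixes f :: "real \<Rightarrow> 'a::euclidean_space"
  assumes "f absolutely_integrable_on S"
  shows "f integrable_on S" "(\<lambda>x. norm (f x)) integrable_on S"
  using assms by (simp_all add: absolutely_integrable_on_def)

lemma absolutely_integrable_potential_mult:
  fixes q f :: "real \<Rightarrow> complex"
  assumes q: "q absolutely_integrable_on {a..b}" and f: "continuous_on {a..b} f"
  shows "(\<lambda>t. (q t - lam) * f t) absolutely_integrable_on {a..b}"
proof -
  have "(\<lambda>t. f t * (q t - lam)) absolutely_integrable_on {a..b}"
  proof (rule absolutely_integrable_bounded_measurable_product[where h="(*)" and f=f and g="\<lambda>t. q t - lam"])
    show "f \<in> borel_measurable (lebesgue_on {a..b})"
      using f by (simp add: continuous_imp_measurable_on_sets_lebesgue)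
    show "bounded (f ` {a..b})"
      using f compact_Icc compact_continuous_image compact_imp_bounded by blast
    show "(\<lambda>t. q t - lam) absolutely_integrable_on {a..b}"
      by (intro set_integral_diff(1) q) simp
  qed (auto simp: bilinear_times)
  then show ?thesis by (simp add: mult.commute)
qed

text \<open>Volterra operator obtained by integrating the equation twice from 0: the solutions with
  Cauchy data \<open>A\<close>, \<open>B\<close> at 0 are the continuous fixed points of
  \<open>A + B * x + schr_op q lam f x\<close>.\<close>

definition schr_op :: "(real \<Rightarrow> complex) \<Rightarrow> complex \<Rightarrow> (real \<Rightarrow> complex) \<Rightarrow> real \<Rightarrow> complex" where
  "schr_op q lam f x = integral {0..x} (\<lambda>s. integral {0..s} (\<lambda>t. (q t - lam) * f t))"

definition l1norm :: "(real \<Rightarrow> complex) \<Rightarrow> real" where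
  "l1norm q = integral {0..1} (\<lambda>t. norm (q t))"

lemma l1norm_nonneg: "0 \<le> l1norm q"
  unfolding l1norm_def
  \<comment> \<open>A function that is not integrable has integral 0 by default.\<close>
  by (cases "(\<lambda>t. norm (q t)) integrable_on {0..1}")
    (auto intro: integral_nonneg simp: not_integrable_integral)

lemma norm_integral_mult_le:
  fixes q f :: "real \<Rightarrow> complex"
  assumes q: "q absolutely_integrable_on {0..1}" and f: "continuous_on {0..1} f"
    and x: "x \<in> {0..1}" and bd: "\<And>t. t \<in> {0..x} \<Longrightarrow> norm (f t) \<le> C"
  shows "norm (integral {0..x} (\<lambda>t. q t * f t)) \<le> l1norm q * C"
proof -
  have sub: "{0..x} \<subseteq> {0..1}" using x by auto
  have C: "C \<ge> 0" using bd[of 0] x by (meson atLeastAtMost_iff norm_ge_zero order_refl order_trans)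
  have qi: "(\<lambda>t. norm (q t)) integrable_on {0..1}"
    by (rule absolutely_integrable_onD(2)[OF q])
  have "(\<lambda>t. q t * f t) integrable_on {0..1}"
    using absolutely_integrable_onD(1)[OF absolutely_integrable_potential_mult[OF q f, of 0]] by simp
  then have "norm (integral {0..x} (\<lambda>t. q t * f t)) \<le> integral {0..x} (\<lambda>t. C * norm (q t))"
  proof (intro integral_norm_bound_integral integrable_on_subinterval[OF _ sub])
    show "(\<lambda>t. C * norm (q t)) integrable_on {0..1}" using qi by (rule integrable_on_mult_right)
    show "norm (q t * f t) \<le> C * norm (q t)" if "t \<in> {0..x}" for t
      using bd[OF that] by (simp add: norm_mult mult.commute mult_right_mono)
  qed auto
  also have "\<dots> = C * integral {0..x} (\<lambda>t. norm (q t))" by simp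
  also have "\<dots> \<le> C * integral {0..1} (\<lambda>t. norm (q t))"
    using C sub by (intro mult_left_mono integral_subset_le integrable_on_subinterval[OF qi] qi) auto
  finally show ?thesis by (simp add: l1norm_def mult.commute)
qed

lemma l1norm_diff_const_le:
  assumes "q absolutely_integrable_on {0..1}"
  shows "l1norm (\<lambda>t. q t - lam) \<le> l1norm q + norm lam"
proof -
  have qi: "(\<lambda>t. norm (q t)) integrable_on {0..1}"
    by (rule absolutely_integrable_onD(2)[OF assms])
  have "(\<lambda>t. q t - lam) absolutely_integrable_on {0..1}"
    by (intro set_integral_diff(1) assms) simp
  then have "(\<lambda>t. norm (q t - lam)) integrable_on {0..1}"
    by (rule absolutely_integrable_onD(2))
  then have "integral {0..1} (\<lambda>t. norm (q t - lam)) \<le> integral {0..1} (\<lambda>t. norm (q t) + norm lam)"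
    by (intro integral_le Henstock_Kurzweil_Integration.integrable_add qi) (auto intro: norm_triangle_ineq4)
  also have "\<dots> = l1norm q + norm lam"
    unfolding l1norm_def by (subst Henstock_Kurzweil_Integration.integral_add[OF qi]) auto
  finally show ?thesis by (simp add: l1norm_def)
qed

lemma continuous_on_inner_integral:
  fixes q f :: "real \<Rightarrow> complex"
  assumes "q absolutely_integrable_on {0..1}" "continuous_on {0..1} f"
  shows "continuous_on {0..1} (\<lambda>s. integral {0..s} (\<lambda>t. (q t - lam) * f t))"
  by (intro indefinite_integral_continuous_1 absolutely_integrable_onD(1)
      absolutely_integrable_potential_mult assms)

lemma continuous_on_schr_op:
  assumes "q absolutely_integrable_on {0..1}" "continuous_on {0..1} f"
  shows "continuous_on {0..1} (schr_op q lam f)"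
  unfolding schr_op_def
  by (intro indefinite_integral_continuous_1 integrable_continuous_interval
      continuous_on_inner_integral assms)

lemma schr_op_add:
  assumes q: "q absolutely_integrable_on {0..1}" and f: "continuous_on {0..1} f"
    and g: "continuous_on {0..1} g" and x: "x \<in> {0..1}"
  shows "schr_op q lam (\<lambda>t. f t + g t) x = schr_op q lam f x + schr_op q lam g x"
proof -
  have int: "(\<lambda>t. (q t - lam) * h t) integrable_on {0..s}" if "continuous_on {0..1} h" "s \<in> {0..1}" for h s
    using absolutely_integrable_onD(1)[OF absolutely_integrable_potential_mult[OF q that(1), of lam]]
    by (rule integrable_on_subinterval) (use that(2) in auto)
  have "schr_op q lam (\<lambda>t. f t + g t) x =
    integral {0..x} (\<lambda>s. integral {0..s} (\<lambda>t. (q t - lam) * f t) + integral {0..s} (\<lambda>t. (q t - lam) * g t))"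
    unfolding schr_op_def
  proof (rule integral_cong)
    fix s assume "s \<in> {0..x}"
    then have "s \<in> {0..1}" using x by auto
    then show "integral {0..s} (\<lambda>t. (q t - lam) * (f t + g t)) =
      integral {0..s} (\<lambda>t. (q t - lam) * f t) + integral {0..s} (\<lambda>t. (q t - lam) * g t)"
      by (subst Henstock_Kurzweil_Integration.integral_add[symmetric]) (auto simp: distrib_left intro: int f g)
  qed
  also have "\<dots> = schr_op q lam f x + schr_op q lam g x"
    unfolding schr_op_def using x
    by (intro Henstock_Kurzweil_Integration.integral_add integrable_continuous_interval
        continuous_on_subset[OF continuous_on_inner_integral[OF q]] f g) auto
  finally show ?thesis .
qed

text \<open>In the sup norm weighted by $e^{-\kappa x}$ the outer integration gains a factor $1/\kappa$,
  so the operator is a contraction for large $\kappa$ even though \<^term>\<open>q\<close> is only integrable.\<close>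

lemma norm_schr_op_le:
  assumes q: "q absolutely_integrable_on {0..1}" and f: "continuous_on {0..1} f"
    and bd: "\<And>t. t \<in> {0..1} \<Longrightarrow> norm (f t) \<le> C * exp (\<kappa> * t)"
    and \<kappa>: "\<kappa> > 0" "2 * (l1norm q + norm lam) \<le> \<kappa>" and C: "C \<ge> 0" and x: "x \<in> {0..1}"
  shows "norm (schr_op q lam f x) \<le> C / 2 * exp (\<kappa> * x)"
proof -
  let ?L = "l1norm q + norm lam"
  have q': "(\<lambda>t. q t - lam) absolutely_integrable_on {0..1}"
    by (intro set_integral_diff(1) q) simp
  \<comment> \<open>The weight is increasing, so on \<open>{0..s}\<close> it is replaced by its
    value at \<open>s\<close>, and only the L1 norm of the coefficient remains.\<close>
  have inner: "norm (integral {0..s} (\<lambda>t. (q t - lam) * f t)) \<le> ?L * (C * exp (\<kappa> * s))"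
    if s: "s \<in> {0..1}" for s
  proof -
    have "norm (integral {0..s} (\<lambda>t. (q t - lam) * f t)) \<le> l1norm (\<lambda>t. q t - lam) * (C * exp (\<kappa> * s))"
    proof (rule norm_integral_mult_le[OF q' f s])
      fix t assume t: "t \<in> {0..s}"
      then have "norm (f t) \<le> C * exp (\<kappa> * t)" using s by (intro bd) auto
      also have "\<dots> \<le> C * exp (\<kappa> * s)" using t C \<kappa> by (intro mult_left_mono) auto
      finally show "norm (f t) \<le> C * exp (\<kappa> * s)" .
    qed
    also have "\<dots> \<le> ?L * (C * exp (\<kappa> * s))"
      using C by (intro mult_right_mono l1norm_diff_const_le q) auto
    finally show ?thesis .
  qed
  have I: "((\<lambda>s. ?L * (C * exp (\<kappa> * s))) has_integral ?L * (C * exp (\<kappa> * x)) / \<kappa> - ?L * (C * exp (\<kappa> * 0)) / \<kappa>) {0..x}"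
  proof (rule fundamental_theorem_of_calculus)
    show "((\<lambda>s. ?L * (C * exp (\<kappa> * s)) / \<kappa>) has_vector_derivative ?L * (C * exp (\<kappa> * s))) (at s within {0..x})" for s
      unfolding has_real_derivative_iff_has_vector_derivative[symmetric]
      using \<kappa> by (auto intro!: derivative_eq_intros)
  qed (use x in auto)
  have "norm (schr_op q lam f x) \<le> integral {0..x} (\<lambda>s. ?L * (C * exp (\<kappa> * s)))"
    unfolding schr_op_def
  proof (rule integral_norm_bound_integral)
    show "(\<lambda>s. integral {0..s} (\<lambda>t. (q t - lam) * f t)) integrable_on {0..x}"
      using x by (intro integrable_continuous_interval
          continuous_on_subset[OF continuous_on_inner_integral[OF q f]]) auto
    show "(\<lambda>s. ?L * (C * exp (\<kappa> * s))) integrable_on {0..x}"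
      using I by (rule has_integral_integrable)
  qed (use inner x in auto)
  also have "\<dots> = ?L * (C * exp (\<kappa> * x)) / \<kappa> - ?L * (C * exp (\<kappa> * 0)) / \<kappa>"
    using I by (rule integral_unique)
  also have "\<dots> \<le> ?L * (C * exp (\<kappa> * x)) / \<kappa>"
    using C \<kappa> l1norm_nonneg[of q] by simp
  also have "\<dots> = (?L / \<kappa>) * (C * exp (\<kappa> * x))" by simp
  also have "\<dots> \<le> (1/2) * (C * exp (\<kappa> * x))"
    using C \<kappa> by (intro mult_right_mono) (auto simp: field_simps)
  finally show ?thesis by simp
qed

text \<open>Each application of the operator halves the weighted bound, so a fixed point is smaller
  than every \<open>C / 2 ^ n\<close> in the weighted norm. This is uniqueness for the Cauchy
  problem.\<close>

lemma schr_op_fixpoint_zero: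
  assumes q: "q absolutely_integrable_on {0..1}" and f: "continuous_on {0..1} f"
    and fp: "\<And>x. x \<in> {0..1} \<Longrightarrow> f x = schr_op q lam f x" and x: "x \<in> {0..1}"
  shows "f x = 0"
proof -
  define \<kappa> where "\<kappa> = 2 * (l1norm q + norm lam) + 1"
  have \<kappa>: "\<kappa> > 0" "2 * (l1norm q + norm lam) \<le> \<kappa>"
    using l1norm_nonneg[of q] by (auto simp: \<kappa>_def add_nonneg_pos)
  have "bounded (f ` {0..1})"
    using f compact_Icc compact_continuous_image compact_imp_bounded by blast
  then obtain C where C: "C > 0" "\<And>t. t \<in> {0..1} \<Longrightarrow> norm (f t) \<le> C"
    unfolding bounded_pos by (metis imageI)
  have *: "\<forall>t\<in>{0..1}. norm (f t) \<le> C / 2 ^ n * exp (\<kappa> * t)" for n :: nat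
  proof (induction n)
    case 0
    show ?case
    proof
      fix t :: real assume t: "t \<in> {0..1}"
      have "C * 1 \<le> C * exp (\<kappa> * t)" using C t \<kappa> by (intro mult_left_mono) auto
      then show "norm (f t) \<le> C / 2 ^ 0 * exp (\<kappa> * t)" using C(2)[OF t] by simp
    qed
  next
    case (Suc n)
    show ?case
    proof
      fix t :: real assume t: "t \<in> {0..1}"
      have "norm (schr_op q lam f t) \<le> C / 2 ^ n / 2 * exp (\<kappa> * t)"
        using Suc C by (intro norm_schr_op_le[OF q f _ \<kappa> _ t]) auto
      then show "norm (f t) \<le> C / 2 ^ Suc n * exp (\<kappa> * t)" using fp[OF t] by (simp add: field_simps)
    qed
  qed
  have "norm (f x) \<le> C * exp (\<kappa> * x) * (1/2) ^ n" for n :: nat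
  proof -
    have "norm (f x) \<le> C / 2 ^ n * exp (\<kappa> * x)" using * x by blast
    then show ?thesis by (simp add: power_one_over)
  qed
  moreover have "(\<lambda>n. C * exp (\<kappa> * x) * (1/2) ^ n) \<longlonglongrightarrow> C * exp (\<kappa> * x) * 0"
    by (intro tendsto_intros LIMSEQ_power_zero) auto
  ultimately have "norm (f x) \<le> C * exp (\<kappa> * x) * 0"
    by (meson LIMSEQ_le_const)
  then show ?thesis by simp
qed

lemma schr_op_cong:
  assumes "x \<in> {0..1}" "\<And>t. t \<in> {0..1} \<Longrightarrow> f t = g t"
  shows "schr_op q lam f x = schr_op q lam g x"
  unfolding schr_op_def using assms by (intro integral_cong) auto

lemma schr_op_cmult: "schr_op q lam (\<lambda>t. c * f t) x = c * schr_op q lam f x"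
proof -
  have "(\<lambda>t. (q t - lam) * (c * f t)) = (\<lambda>t. c * ((q t - lam) * f t))"
    by (simp add: algebra_simps)
  then show ?thesis unfolding schr_op_def by simp
qed

lemma schr_op_zero: "schr_op q lam (\<lambda>t. 0) x = 0"
  unfolding schr_op_def by simp

lemma schr_op_sum:
  assumes q: "q absolutely_integrable_on {0..1}" and x: "x \<in> {0..1}"
    and f: "\<And>n. continuous_on {0..1} (f n)"
  shows "schr_op q lam (\<lambda>t. \<Sum>n<N::nat. f n t) x = (\<Sum>n<N. schr_op q lam (f n) x)"
proof (induction N)
  case 0 then show ?case by (simp add: schr_op_zero)
next
  case (Suc N)
  have "continuous_on {0..1} (\<lambda>t. \<Sum>n<N. f n t)" by (intro continuous_on_sum f)
  then show ?case using schr_op_add[OF q _ f x] Suc by simp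
qed

text \<open>Affine dependence on \<open>lam\<close>, which makes the iterates polynomials in
  \<open>lam\<close>. The operator \<open>schr_op (\<lambda>t. 0) 1\<close> is minus the double
  integral.\<close>

lemma schr_op_split:
  assumes q: "q absolutely_integrable_on {0..1}" and f: "continuous_on {0..1} f" and x: "x \<in> {0..1}"
  shows "schr_op q lam f x = schr_op q 0 f x + lam * schr_op (\<lambda>t. 0) 1 f x"
proof -
  have "schr_op q lam f x = schr_op q 0 f x + schr_op (\<lambda>t. 0) lam f x"
  proof -
    have 0: "(\<lambda>t::real. 0::complex) absolutely_integrable_on {0..1}" by simp
    have "schr_op q lam f x = integral {0..x} (\<lambda>s. integral {0..s} (\<lambda>t. (q t - 0) * f t) + integral {0..s} (\<lambda>t. (0 - lam) * f t))"
      unfolding schr_op_def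
    proof (rule integral_cong)
      fix s assume "s \<in> {0..x}"
      then have s: "{0..s} \<subseteq> {0..1}" using x by auto
      show "integral {0..s} (\<lambda>t. (q t - lam) * f t) =
        integral {0..s} (\<lambda>t. (q t - 0) * f t) + integral {0..s} (\<lambda>t. (0 - lam) * f t)"
        using integrable_on_subinterval[OF absolutely_integrable_onD(1)[OF absolutely_integrable_potential_mult[OF q f, of 0]] s]
          integrable_on_subinterval[OF absolutely_integrable_onD(1)[OF absolutely_integrable_potential_mult[OF 0 f, of lam]] s]
        by (subst Henstock_Kurzweil_Integration.integral_add[symmetric]) (auto simp: algebra_simps)
    qed
    also have "\<dots> = schr_op q 0 f x + schr_op (\<lambda>t. 0) lam f x"
      unfolding schr_op_def using x
      by (intro Henstock_Kurzweil_Integration.integral_add integrable_continuous_interval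
        continuous_on_subset[OF continuous_on_inner_integral[OF q f]]
        continuous_on_subset[OF continuous_on_inner_integral[OF 0 f]]) auto
    finally show ?thesis .
  qed
  also have "schr_op (\<lambda>t. 0) lam f x = lam * schr_op (\<lambda>t. 0) 1 f x"
    unfolding schr_op_def by simp
  finally show ?thesis .
qed

section \<open>The Neumann series and its dependence on the spectral parameter\<close>

definition schr_iter :: "(real \<Rightarrow> complex) \<Rightarrow> complex \<Rightarrow> complex \<Rightarrow> complex \<Rightarrow> nat \<Rightarrow> real \<Rightarrow> complex" where
  "schr_iter q A B lam n = (schr_op q lam ^^ n) (\<lambda>x. A + B * of_real x)"

text \<open>Solution of the Cauchy problem as the Neumann series of the fixed point equation;
  \<open>A\<close> and \<open>B\<close> turn out to be value and derivative at 0.\<close>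

definition schr_sol :: "(real \<Rightarrow> complex) \<Rightarrow> complex \<Rightarrow> complex \<Rightarrow> complex \<Rightarrow> real \<Rightarrow> complex" where
  "schr_sol q A B lam x = (\<Sum>n. schr_iter q A B lam n x)"

lemma schr_iter_0: "schr_iter q A B lam 0 = (\<lambda>x. A + B * of_real x)"
  and schr_iter_Suc: "schr_iter q A B lam (Suc n) = schr_op q lam (schr_iter q A B lam n)"
  by (simp_all add: schr_iter_def)

lemma continuous_on_schr_iter:
  assumes q: "q absolutely_integrable_on {0..1}"
  shows "continuous_on {0..1} (schr_iter q A B lam n)"
proof (induction n)
  case 0 then show ?case unfolding schr_iter_0 by (intro continuous_intros)
next
  case (Suc n) then show ?case unfolding schr_iter_Suc by (rule continuous_on_schr_op[OF q])
qed

lemma norm_schr_iter_le: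
  assumes q: "q absolutely_integrable_on {0..1}"
    and \<kappa>: "\<kappa> > 0" "2 * (l1norm q + norm lam) \<le> \<kappa>" and x: "x \<in> {0..1}"
  shows "norm (schr_iter q A B lam n x) \<le> (norm A + norm B) / 2 ^ n * exp (\<kappa> * x)"
  using x
proof (induction n arbitrary: x)
  case 0
  have "norm (A + B * of_real x) \<le> norm A + norm B * \<bar>x\<bar>"
    by (metis norm_mult norm_of_real norm_triangle_ineq)
  also have "\<dots> \<le> norm A + norm B * 1" using 0 by (intro add_left_mono mult_left_mono) auto
  also have "\<dots> \<le> (norm A + norm B) * exp (\<kappa> * x)"
    using 0 \<kappa> mult_left_mono[of 1 "exp (\<kappa> * x)" "norm A + norm B"] by simp
  finally show ?case by (simp add: schr_iter_0)
next
  case (Suc n)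
  have "norm (schr_op q lam (schr_iter q A B lam n) x) \<le> (norm A + norm B) / 2 ^ n / 2 * exp (\<kappa> * x)"
    using Suc by (intro norm_schr_op_le[OF q continuous_on_schr_iter[OF q] _ \<kappa>]) auto
  then show ?case by (simp add: schr_iter_Suc field_simps)
qed

text \<open>The weight is chosen for the radius \<open>R\<close> instead of for \<open>lam\<close>,
  so that one geometric majorant serves all \<open>x\<close> on the edge and all \<open>lam\<close>
  in a disc. It feeds the Weierstrass test for continuity in \<open>x\<close> and for holomorphy in
  \<open>lam\<close>.\<close>

lemma norm_schr_iter_le_geometric:
  assumes q: "q absolutely_integrable_on {0..1}" and R: "norm lam \<le> R" and x: "x \<in> {0..1}"
  shows "norm (schr_iter q A B lam n x) \<le> (norm A + norm B) * exp (2 * (l1norm q + R) + 1) * (1/2) ^ n"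
proof -
  let ?\<kappa> = "2 * (l1norm q + R) + 1"
  have "R \<ge> 0" using R norm_ge_zero order_trans by blast
  then have \<kappa>: "?\<kappa> > 0" "2 * (l1norm q + norm lam) \<le> ?\<kappa>"
    using R l1norm_nonneg[of q] by auto
  have "norm (schr_iter q A B lam n x) \<le> (norm A + norm B) / 2 ^ n * exp (?\<kappa> * x)"
    by (rule norm_schr_iter_le[OF q \<kappa> x])
  also have "\<dots> \<le> (norm A + norm B) / 2 ^ n * exp ?\<kappa>"
    using \<kappa>(1) x by (intro mult_left_mono) (auto simp: mult_left_le)
  finally show ?thesis by (simp add: power_one_over field_simps)
qed

lemma uniform_limit_schr_sol:
  assumes q: "q absolutely_integrable_on {0..1}"
  shows "uniform_limit {0..1} (\<lambda>N x. \<Sum>n<N. schr_iter q A B lam n x) (schr_sol q A B lam) sequentially"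
  unfolding schr_sol_def
proof (rule Weierstrass_m_test)
  show "norm (schr_iter q A B lam n x) \<le> (norm A + norm B) * exp (2 * (l1norm q + norm lam) + 1) * (1/2) ^ n"
    if "x \<in> {0..1}" for n x
    using norm_schr_iter_le_geometric[OF q order_refl that] .
  show "summable (\<lambda>n. (norm A + norm B) * exp (2 * (l1norm q + norm lam) + 1) * (1/2::real) ^ n)"
    by (intro summable_mult summable_geometric) simp
qed

lemma continuous_on_schr_sol:
  assumes q: "q absolutely_integrable_on {0..1}"
  shows "continuous_on {0..1} (schr_sol q A B lam)"
proof (rule uniform_limit_theorem[OF _ uniform_limit_schr_sol[OF q]])
  show "\<forall>\<^sub>F N in sequentially. continuous_on {0..1} (\<lambda>x. \<Sum>n<N. schr_iter q A B lam n x)"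
    by (intro always_eventually allI continuous_on_sum continuous_on_schr_iter q)
qed simp

text \<open>The partial sums satisfy the equation with an index shift. The weighted bound, applied
  to partial sum minus limit, shows that the operator passes to the uniform limit.\<close>

lemma schr_sol_fixpoint:
  assumes q: "q absolutely_integrable_on {0..1}" and x: "x \<in> {0..1}"
  shows "schr_sol q A B lam x = A + B * of_real x + schr_op q lam (schr_sol q A B lam) x"
proof -
  define S where "S N x = (\<Sum>n<N. schr_iter q A B lam n x)" for N x
  let ?Y = "schr_sol q A B lam"
  have ul: "uniform_limit {0..1} S ?Y sequentially"
    unfolding S_def by (rule uniform_limit_schr_sol[OF q])
  have contS: "continuous_on {0..1} (S N)" for N
    unfolding S_def by (intro continuous_on_sum continuous_on_schr_iter q)
  have contY: "continuous_on {0..1} ?Y" by (rule continuous_on_schr_sol[OF q])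
  define \<kappa> where "\<kappa> = 2 * (l1norm q + norm lam) + 1"
  have \<kappa>: "\<kappa> > 0" "2 * (l1norm q + norm lam) \<le> \<kappa>"
    using l1norm_nonneg[of q] by (auto simp: \<kappa>_def add_nonneg_pos)
  have Suc: "S (Suc N) x = A + B * of_real x + schr_op q lam (S N) x" for N
  proof -
    have "schr_op q lam (S N) x = (\<Sum>n<N. schr_iter q A B lam (Suc n) x)"
      unfolding S_def schr_iter_Suc by (rule schr_op_sum[OF q x continuous_on_schr_iter[OF q]])
    then show ?thesis
      unfolding S_def sum.lessThan_Suc_shift by (simp add: schr_iter_0)
  qed
  have "(\<lambda>N. schr_op q lam (S N) x) \<longlonglongrightarrow> schr_op q lam ?Y x"
  proof (rule LIMSEQ_I)
    fix e :: real assume "e > 0"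
    define \<epsilon> where "\<epsilon> = e / exp \<kappa>"
    have "\<epsilon> > 0" using \<open>e > 0\<close> by (simp add: \<epsilon>_def)
    from uniform_limitD[OF ul this] obtain N0 where
      N0: "\<And>N t. N \<ge> N0 \<Longrightarrow> t \<in> {0..1} \<Longrightarrow> dist (S N t) (?Y t) < \<epsilon>"
      unfolding eventually_sequentially by blast
    show "\<exists>no. \<forall>n\<ge>no. norm (schr_op q lam (S n) x - schr_op q lam ?Y x) < e"
    proof (intro exI[of _ N0] allI impI)
      fix N assume N: "N \<ge> N0"
      have cont: "continuous_on {0..1} (\<lambda>t. S N t - ?Y t)"
        by (intro continuous_on_diff contS contY)
      have "schr_op q lam (S N) x = schr_op q lam (\<lambda>t. (S N t - ?Y t) + ?Y t) x" by simp
      also have "\<dots> = schr_op q lam (\<lambda>t. S N t - ?Y t) x + schr_op q lam ?Y x"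
        by (rule schr_op_add[OF q cont contY x])
      finally have "norm (schr_op q lam (S N) x - schr_op q lam ?Y x) = norm (schr_op q lam (\<lambda>t. S N t - ?Y t) x)"
        by simp
      also have "\<dots> \<le> \<epsilon> / 2 * exp (\<kappa> * x)"
      proof (rule norm_schr_op_le[OF q cont _ \<kappa> _ x])
        fix t :: real assume t: "t \<in> {0..1}"
        have "norm (S N t - ?Y t) \<le> \<epsilon> * 1" using N0[OF N t] by (simp add: dist_norm)
        also have "\<dots> \<le> \<epsilon> * exp (\<kappa> * t)" using \<open>\<epsilon> > 0\<close> t \<kappa> by (intro mult_left_mono) auto
        finally show "norm (S N t - ?Y t) \<le> \<epsilon> * exp (\<kappa> * t)" .
      qed (use \<open>\<epsilon> > 0\<close> in simp)
      also have "\<dots> \<le> \<epsilon> / 2 * exp \<kappa>"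
        using \<open>\<epsilon> > 0\<close> \<kappa>(1) x by (intro mult_left_mono) (auto simp: mult_left_le)
      also have "\<dots> < e" using \<open>e > 0\<close> by (simp add: \<epsilon>_def)
      finally show "norm (schr_op q lam (S N) x - schr_op q lam ?Y x) < e" .
    qed
  qed
  then have "(\<lambda>N. S (Suc N) x) \<longlonglongrightarrow> A + B * of_real x + schr_op q lam ?Y x"
    unfolding Suc by (intro tendsto_intros)
  moreover have "(\<lambda>N. S (Suc N) x) \<longlonglongrightarrow> ?Y x"
    using tendsto_uniform_limitI[OF ul x] by (rule LIMSEQ_Suc)
  ultimately show ?thesis using LIMSEQ_unique by blast
qed

lemma schr_iter_polynomial:
  assumes q: "q absolutely_integrable_on {0..1}"
  shows "\<exists>c N. (\<forall>m. continuous_on {0..1} (c m)) \<and>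
    (\<forall>lam. \<forall>x\<in>{0..1}. schr_iter q A B lam n x = (\<Sum>m<N::nat. lam ^ m * c m x))"
proof (induction n)
  case 0
  show ?case
    by (rule exI[of _ "\<lambda>m x. A + B * of_real x"], rule exI[of _ 1])
      (auto simp: schr_iter_0 intro!: continuous_intros)
next
  case (Suc n)
  then obtain c N where c: "\<And>m. continuous_on {0..1} (c m)"
    and eq: "\<And>lam x. x \<in> {0..1} \<Longrightarrow> schr_iter q A B lam n x = (\<Sum>m<N::nat. lam ^ m * c m x)"
    by blast
  have 0: "(\<lambda>t::real. 0::complex) absolutely_integrable_on {0..1}" by simp
  \<comment> \<open>The coefficient of \<open>lam ^ m\<close> comes from the old one of the same
    degree through the potential and from the previous one through the spectral term; the degree
    bound rises by one.\<close>
  define c' where "c' m x = (if m < N then schr_op q 0 (c m) x else 0) +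
      (if 0 < m then schr_op (\<lambda>t. 0) 1 (c (m - 1)) x else 0)" for m x
  have "continuous_on {0..1} (c' m)" for m
  proof -
    have "continuous_on {0..1} (\<lambda>x. if m < N then schr_op q 0 (c m) x else 0)"
      using continuous_on_schr_op[OF q c] by (cases "m < N") auto
    moreover have "continuous_on {0..1} (\<lambda>x. if 0 < m then schr_op (\<lambda>t. 0) 1 (c (m - 1)) x else 0)"
      using continuous_on_schr_op[OF 0 c] by (cases "0 < m") auto
    ultimately show ?thesis unfolding c'_def by (rule continuous_on_add)
  qed
  moreover have "schr_iter q A B lam (Suc n) x = (\<Sum>m<Suc N. lam ^ m * c' m x)" if x: "x \<in> {0..1}" for lam x
  proof -
    have "schr_iter q A B lam (Suc n) x = schr_op q lam (\<lambda>t. \<Sum>m<N. lam ^ m * c m t) x"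
      unfolding schr_iter_Suc by (rule schr_op_cong[OF x eq])
    also have "\<dots> = (\<Sum>m<N. lam ^ m * schr_op q lam (c m) x)"
      by (subst schr_op_sum[OF q x]) (auto intro!: continuous_intros c simp: schr_op_cmult)
    also have "\<dots> = (\<Sum>m<N. lam ^ m * schr_op q 0 (c m) x) + (\<Sum>m<N. lam ^ Suc m * schr_op (\<lambda>t. 0) 1 (c m) x)"
      by (subst schr_op_split[OF q c x]) (simp add: sum.distrib algebra_simps)
    also have "(\<Sum>m<N. lam ^ m * schr_op q 0 (c m) x) =
        (\<Sum>m<Suc N. lam ^ m * (if m < N then schr_op q 0 (c m) x else 0))"
      by simp
    also have "(\<Sum>m<N. lam ^ Suc m * schr_op (\<lambda>t. 0) 1 (c m) x) =
        (\<Sum>m<Suc N. lam ^ m * (if 0 < m then schr_op (\<lambda>t. 0) 1 (c (m - 1)) x else 0))"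
      unfolding sum.lessThan_Suc_shift by simp
    finally show ?thesis
      unfolding c'_def by (simp only: sum.distrib distrib_left)
  qed
  ultimately show ?case by blast
qed

text \<open>For fixed \<open>x\<close> the partial sums are polynomials in \<open>lam\<close>
  converging uniformly on discs of radius 1.\<close>

lemma holomorphic_schr_sol:
  assumes q: "q absolutely_integrable_on {0..1}" and x: "x \<in> {0..1}"
  shows "(\<lambda>lam. schr_sol q A B lam x) holomorphic_on UNIV"
proof (rule holomorphic_uniform_sequence)
  show "(\<lambda>lam. \<Sum>n<N. schr_iter q A B lam n x) holomorphic_on UNIV" for N
  proof (intro holomorphic_on_sum)
    fix n
    obtain c and M :: nat where "\<And>lam. schr_iter q A B lam n x = (\<Sum>m<M. lam ^ m * c m x)"
      using schr_iter_polynomial[OF q, of A B n] x by blast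
    then show "(\<lambda>lam. schr_iter q A B lam n x) holomorphic_on UNIV"
      by (simp add: holomorphic_intros)
  qed
  show "\<exists>d. 0 < d \<and> cball z d \<subseteq> UNIV \<and>
     uniform_limit (cball z d) (\<lambda>N lam. \<Sum>n<N. schr_iter q A B lam n x) (\<lambda>lam. schr_sol q A B lam x) sequentially" for z
  proof (intro exI[of _ 1] conjI)
    show "uniform_limit (cball z 1) (\<lambda>N lam. \<Sum>n<N. schr_iter q A B lam n x) (\<lambda>lam. schr_sol q A B lam x) sequentially"
      unfolding schr_sol_def
    proof (rule Weierstrass_m_test)
      show "norm (schr_iter q A B lam n x) \<le> (norm A + norm B) * exp (2 * (l1norm q + (norm z + 1)) + 1) * (1/2) ^ n"
        if "lam \<in> cball z 1" for n lam
      proof (rule norm_schr_iter_le_geometric[OF q _ x])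
        show "norm lam \<le> norm z + 1"
          using that norm_triangle_sub[of lam z] by (simp add: dist_norm norm_minus_commute)
      qed
      show "summable (\<lambda>n. (norm A + norm B) * exp (2 * (l1norm q + (norm z + 1)) + 1) * (1/2::real) ^ n)"
        by (intro summable_mult summable_geometric) simp
    qed
  qed auto
qed simp

section \<open>From fixed points to solutions: existence, uniqueness, reversal of an edge\<close>

lemma D_eqI:
  assumes "(f has_vector_derivative d) (at x within {0..1})" "x \<in> {0..1}"
  shows "D f x = d"
  unfolding D_def using assms by (intro vector_derivative_within_closed_interval) auto

lemma ac_on_interval_subset:
  assumes "ac_on_interval a b f" "a \<le> c" "d \<le> b"
  shows "ac_on_interval c d f"
proof (rule ac_on_intervalI)
  fix e :: real assume "e > 0"
  show "\<exists>\<delta>>0. ac_modulus c d f \<delta> e"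
  proof (rule ac_on_intervalE[OF assms(1) \<open>e > 0\<close>], rule exI, intro conjI allI impI)
    fix \<delta> :: real and n :: nat and s t :: "nat \<Rightarrow> real"
    assume "\<delta> > 0" and mod: "ac_modulus a b f \<delta> e"
    note \<delta> = mod[rule_format]
    show "\<delta> > 0" by fact
    assume st: "\<forall>i<n. c \<le> s i \<and> s i \<le> t i \<and> t i \<le> d"
      and dis: "\<forall>i<n. \<forall>j<n. i \<noteq> j \<longrightarrow> t i \<le> s j \<or> t j \<le> s i"
      and small: "(\<Sum>i<n. t i - s i) < \<delta>"
    show "(\<Sum>i<n. norm (f (t i) - f (s i))) < e"
    proof (rule \<delta>)
      show "a \<le> s i \<and> s i \<le> t i \<and> t i \<le> b" if "i < n" for i
        using st that assms(2,3) by force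
    qed (use dis small in auto)
  qed
qed

lemma ac_on_interval_cong:
  assumes "ac_on_interval a b f" "\<And>x. x \<in> {a..b} \<Longrightarrow> f x = g x"
  shows "ac_on_interval a b g"
  by (rule ac_on_interval_dominated[OF assms(1) assms(1), where A=1 and B=1]) (auto simp: assms(2))

lemma ac_on_interval_has_integral_initial:
  fixes f :: "real \<Rightarrow> 'a::euclidean_space"
  assumes ac: "ac_on_interval 0 1 f" and x: "x \<in> {0..1}"
    and der: "AE x in lborel. x \<in> {0..1} \<longrightarrow> (f has_vector_derivative g x) (at x within {0..1})"
  shows "(g has_integral f x - f 0) {0..x}"
proof (rule ac_on_interval_has_integral)
  show "ac_on_interval 0 x f" using ac x by (intro ac_on_interval_subset[OF ac]) auto
  show "AE y in lborel. y \<in> {0..x} \<longrightarrow> (f has_vector_derivative g y) (at y within {0..x})"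
    using der
  proof eventually_elim
    case (elim y)
    then show ?case using x by (auto intro: has_vector_derivative_within_subset)
  qed
qed (use x in auto)

lemma edge_sol_continuous:
  assumes "edge_sol q lam f"
  shows "continuous_on {0..1} f" "continuous_on {0..1} (D f)"
  using assms unfolding edge_sol_def by (auto intro: ac_on_interval_imp_continuous_on)

lemma edge_sol_D:
  assumes "edge_sol q lam f" "x \<in> {0..1}"
  shows "(f has_vector_derivative D f x) (at x within {0..1})"
  using assms unfolding edge_sol_def by blast

lemma edge_sol_AE:
  assumes "edge_sol q lam f"
  shows "AE x in lborel. x \<in> {0..1} \<longrightarrow> (D f has_vector_derivative ((q x - lam) * f x)) (at x within {0..1})"
  using assms unfolding edge_sol_def by blast

lemma edge_sol_ac:
  assumes "edge_sol q lam f"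
  shows "ac_on_interval 0 1 f" "ac_on_interval 0 1 (D f)"
  using assms unfolding edge_sol_def by blast+

lemma edge_sol_fixpoint:
  assumes f: "edge_sol q lam f" and x: "x \<in> {0..1}"
  shows "D f x = D f 0 + integral {0..x} (\<lambda>t. (q t - lam) * f t)"
    and "f x = f 0 + D f 0 * of_real x + schr_op q lam f x"
proof -
  have Df: "D f x = D f 0 + integral {0..x} (\<lambda>t. (q t - lam) * f t)" if "x \<in> {0..1}" for x
    using integral_unique[OF ac_on_interval_has_integral_initial[OF edge_sol_ac(2)[OF f] that edge_sol_AE[OF f]]]
    by simp
  then show "D f x = D f 0 + integral {0..x} (\<lambda>t. (q t - lam) * f t)" using x .
  have "(D f has_integral f x - f 0) {0..x}"
    using x by (intro fundamental_theorem_of_calculus) (auto intro: has_vector_derivative_within_subset[OF edge_sol_D[OF f]])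
  then have "f x - f 0 = integral {0..x} (D f)" by (simp add: integral_unique)
  also have "\<dots> = integral {0..x} (\<lambda>s. D f 0 + integral {0..s} (\<lambda>t. (q t - lam) * f t))"
    using x by (intro integral_cong Df) auto
  also have "\<dots> = integral {0..x} (\<lambda>s. D f 0) + integral {0..x} (\<lambda>s. integral {0..s} (\<lambda>t. (q t - lam) * f t))"
  proof (rule Henstock_Kurzweil_Integration.integral_add)
    \<comment> \<open>The inner integral equals \<open>D f s - D f 0\<close>; its integrability is
      read off from the continuity of \<open>D f\<close>.\<close>
    have "continuous_on {0..x} (\<lambda>s. D f s - D f 0)"
      using x by (intro continuous_intros continuous_on_subset[OF edge_sol_continuous(2)[OF f]]) auto
    then have "continuous_on {0..x} (\<lambda>s. integral {0..s} (\<lambda>t. (q t - lam) * f t))"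
    proof (rule continuous_on_eq)
      fix s assume "s \<in> {0..x}"
      then have "s \<in> {0..1}" using x by auto
      from Df[OF this] show "D f s - D f 0 = integral {0..s} (\<lambda>t. (q t - lam) * f t)"
        by (simp only: add_diff_cancel_left')
    qed
    then show "(\<lambda>s. integral {0..s} (\<lambda>t. (q t - lam) * f t)) integrable_on {0..x}"
      by (rule integrable_continuous_interval)
  qed auto
  also have "\<dots> = D f 0 * of_real x + schr_op q lam f x"
    using x by (simp add: schr_op_def scaleR_conv_of_real mult.commute)
  finally show "f x = f 0 + D f 0 * of_real x + schr_op q lam f x"
    by (simp add: algebra_simps)
qed

text \<open>The derivative of a fixed point is \<open>B\<close> plus the indefinite integral of an
  integrable function, hence absolutely continuous, and Lebesgue differentiation recovers the
  equation almost everywhere.\<close>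

lemma edge_solI:
  assumes q: "q absolutely_integrable_on {0..1}" and f: "continuous_on {0..1} f"
    and fp: "\<And>x. x \<in> {0..1} \<Longrightarrow> f x = A + B * of_real x + schr_op q lam f x"
  shows "edge_sol q lam f" "f 0 = A" "D f 0 = B"
proof -
  define J where "J x = integral {0..x} (\<lambda>t. (q t - lam) * f t)" for x
  have contJ: "continuous_on {0..1} J"
    unfolding J_def by (rule continuous_on_inner_integral[OF q f])
  have der: "(f has_vector_derivative B + J x) (at x within {0..1})" if x: "x \<in> {0..1}" for x
  proof (rule has_vector_derivative_transform[OF x fp])
    show "((\<lambda>x. A + B * of_real x + schr_op q lam f x) has_vector_derivative B + J x) (at x within {0..1})"
      unfolding schr_op_def J_def[symmetric]
      by (rule derivative_eq_intros integral_has_vector_derivative[OF contJ x] refl)+ simp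
  qed simp
  have Df: "D f x = B + J x" if "x \<in> {0..1}" for x
    using D_eqI[OF der[OF that] that] .
  have g: "(\<lambda>t. (q t - lam) * f t) absolutely_integrable_on {0..1}"
    by (rule absolutely_integrable_potential_mult[OF q f])
  show "edge_sol q lam f"
    unfolding edge_sol_def
  proof (intro conjI ballI)
    show "ac_on_interval 0 1 f"
      by (rule ac_on_interval_C1[OF der]) (auto intro!: continuous_intros contJ)
    show "(f has_vector_derivative D f x) (at x within {0..1})" if "x \<in> {0..1}" for x
      using der[OF that] Df[OF that] by simp
    have "ac_on_interval 0 1 (\<lambda>x. B + J x)"
      unfolding J_def by (intro ac_on_interval_add ac_on_interval_const ac_on_interval_indefinite_integral g)
    then show "ac_on_interval 0 1 (D f)"
      by (rule ac_on_interval_cong) (simp add: Df)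
    show "AE x in lborel. x \<in> {0..1} \<longrightarrow> (D f has_vector_derivative (q x - lam) * f x) (at x within {0..1})"
      using AE_has_vector_derivative_indefinite_integral[OF absolutely_integrable_onD(1)[OF g]]
    proof eventually_elim
      case (elim x)
      show ?case
      proof
        assume x: "x \<in> {0..1}"
        then have "(J has_vector_derivative (q x - lam) * f x) (at x within {0..1})"
          using elim unfolding J_def by blast
        then have "((\<lambda>x. B + J x) has_vector_derivative (q x - lam) * f x) (at x within {0..1})"
          using has_vector_derivative_add[OF has_vector_derivative_const[of B]] by fastforce
        then show "(D f has_vector_derivative (q x - lam) * f x) (at x within {0..1})"
          by (rule has_vector_derivative_transform[OF x Df, rotated]) simp
      qed
    qed
  qed
  show "f 0 = A" using fp[of 0] by (simp add: schr_op_def)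
  show "D f 0 = B" using Df[of 0] by (simp add: J_def)
qed

lemma edge_sol_schr_sol:
  assumes "q absolutely_integrable_on {0..1}"
  shows "edge_sol q lam (schr_sol q A B lam)" "schr_sol q A B lam 0 = A" "D (schr_sol q A B lam) 0 = B"
  using edge_solI[OF assms continuous_on_schr_sol[OF assms] schr_sol_fixpoint[OF assms]] by auto

lemma edge_sol_lincomb:
  assumes f: "edge_sol q lam f" and g: "edge_sol q lam g"
  shows "edge_sol q lam (\<lambda>x. c * f x + d * g x)"
    and "x \<in> {0..1} \<Longrightarrow> D (\<lambda>x. c * f x + d * g x) x = c * D f x + d * D g x"
proof -
  have der: "((\<lambda>x. c * f x + d * g x) has_vector_derivative c * D f x + d * D g x) (at x within {0..1})"
    if "x \<in> {0..1}" for x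
    by (intro has_vector_derivative_add has_vector_derivative_mult_right edge_sol_D[OF f that] edge_sol_D[OF g that])
  show Dl: "D (\<lambda>x. c * f x + d * g x) x = c * D f x + d * D g x" if "x \<in> {0..1}" for x
    using D_eqI[OF der[OF that] that] .
  show "edge_sol q lam (\<lambda>x. c * f x + d * g x)"
    unfolding edge_sol_def
  proof (intro conjI ballI)
    show "ac_on_interval 0 1 (\<lambda>x. c * f x + d * g x)"
      by (intro ac_on_interval_add ac_on_interval_mult ac_on_interval_const edge_sol_ac[OF f] edge_sol_ac[OF g])
    show "((\<lambda>x. c * f x + d * g x) has_vector_derivative D (\<lambda>x. c * f x + d * g x) x) (at x within {0..1})"
      if "x \<in> {0..1}" for x
      using der[OF that] Dl[OF that] by simp
    have "ac_on_interval 0 1 (\<lambda>x. c * D f x + d * D g x)"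
      by (intro ac_on_interval_add ac_on_interval_mult ac_on_interval_const edge_sol_ac[OF f] edge_sol_ac[OF g])
    then show "ac_on_interval 0 1 (D (\<lambda>x. c * f x + d * g x))"
      by (rule ac_on_interval_cong) (simp add: Dl)
    show "AE x in lborel. x \<in> {0..1} \<longrightarrow>
        (D (\<lambda>x. c * f x + d * g x) has_vector_derivative (q x - lam) * (c * f x + d * g x)) (at x within {0..1})"
      using edge_sol_AE[OF f] edge_sol_AE[OF g]
    proof eventually_elim
      case (elim x)
      show ?case
      proof
        assume x: "x \<in> {0..1}"
        have "((\<lambda>x. c * D f x + d * D g x) has_vector_derivative
            c * ((q x - lam) * f x) + d * ((q x - lam) * g x)) (at x within {0..1})"
          using elim x by (intro has_vector_derivative_add has_vector_derivative_mult_right) auto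
        then have "((\<lambda>x. c * D f x + d * D g x) has_vector_derivative
            (q x - lam) * (c * f x + d * g x)) (at x within {0..1})"
          by (simp add: algebra_simps)
        then show "(D (\<lambda>x. c * f x + d * g x) has_vector_derivative (q x - lam) * (c * f x + d * g x)) (at x within {0..1})"
          by (rule has_vector_derivative_transform[OF x Dl, rotated]) simp
      qed
    qed
  qed
qed

text \<open>The difference has zero Cauchy data, so it is a fixed point of the operator
  itself.\<close>

lemma edge_sol_unique:
  assumes q: "q absolutely_integrable_on {0..1}" and f: "edge_sol q lam f" and g: "edge_sol q lam g"
    and "f 0 = g 0" "D f 0 = D g 0" and x: "x \<in> {0..1}"
  shows "f x = g x" "D f x = D g x"
proof -
  let ?h = "\<lambda>x. 1 * f x + (-1) * g x"
  have h: "edge_sol q lam ?h" by (rule edge_sol_lincomb[OF f g])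
  have "D ?h 0 = 0"
    using edge_sol_lincomb(2)[OF f g, of 0 1 "-1"] assms(5) by simp
  then have h0: "?h y = schr_op q lam ?h y" if "y \<in> {0..1}" for y
    using edge_sol_fixpoint(2)[OF h that] assms(4) by simp
  have z: "?h y = 0" if "y \<in> {0..1}" for y
    by (rule schr_op_fixpoint_zero[OF q edge_sol_continuous(1)[OF h] h0 that])
  then show "f x = g x" using x by simp
  have "integral {0..x} (\<lambda>t. (q t - lam) * f t) = integral {0..x} (\<lambda>t. (q t - lam) * g t)"
    using z x by (intro integral_cong) auto
  then show "D f x = D g x"
    using edge_sol_fixpoint(1)[OF f x] edge_sol_fixpoint(1)[OF g x] assms(5) by simp
qed

lemma AE_lborel_reflect:
  assumes "AE x in lborel. P (x::real)"
  shows "AE x in lborel. P (1 - x)"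
proof -
  have "distr lborel borel (\<lambda>x. 1 - x :: real) = lborel"
    using lborel_real_affine[of "-1" 1] by (simp add: density_1)
  then have "AE x in distr lborel borel (\<lambda>x. 1 - x :: real). P x" by (simp only: assms)
  then show ?thesis
    by (rule AE_distrD[rotated]) simp
qed

text \<open>Reversing an edge turns estimates started at \<open>x = 0\<close> into estimates started
  at \<open>x = 1\<close>, so that only one direction of travel has to be analysed.\<close>

lemma edge_sol_reflect:
  assumes f: "edge_sol q lam f"
  shows "edge_sol (\<lambda>x. q (1 - x)) lam (\<lambda>x. f (1 - x))"
    and "x \<in> {0..1} \<Longrightarrow> D (\<lambda>x. f (1 - x)) x = - D f (1 - x)"
proof -
  have chain: "((\<lambda>x. g (1 - x)) has_vector_derivative - g') (at x within {0..1})"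
    if "x \<in> {0..1}" "(g has_vector_derivative g') (at (1 - x) within {0..1})"
    for g :: "real \<Rightarrow> complex" and g' x
  proof -
    have im: "(\<lambda>x. 1 - x) ` {0..1::real} = {0..1}"
      by (auto simp: image_iff intro!: bexI[of _ "1 - _"])
    have "((\<lambda>x. 1 - x) has_vector_derivative -1) (at x within {0..1::real})"
      by (auto intro!: derivative_eq_intros)
    from vector_diff_chain_within[OF this] that(2) im
    show ?thesis by (simp add: o_def)
  qed
  have der: "((\<lambda>x. f (1 - x)) has_vector_derivative - D f (1 - x)) (at x within {0..1})" if "x \<in> {0..1}" for x
    by (rule chain[OF that edge_sol_D[OF f]]) (use that in auto)
  show Dr: "D (\<lambda>x. f (1 - x)) x = - D f (1 - x)" if "x \<in> {0..1}" for x
    using D_eqI[OF der[OF that] that] .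
  show "edge_sol (\<lambda>x. q (1 - x)) lam (\<lambda>x. f (1 - x))"
    unfolding edge_sol_def
  proof (intro conjI ballI)
    show "ac_on_interval 0 1 (\<lambda>x. f (1 - x))"
      by (rule ac_on_interval_reflect[OF edge_sol_ac(1)[OF f]])
    show "((\<lambda>x. f (1 - x)) has_vector_derivative D (\<lambda>x. f (1 - x)) x) (at x within {0..1})"
      if "x \<in> {0..1}" for x
      using der[OF that] Dr[OF that] by simp
    have "ac_on_interval 0 1 (\<lambda>x. (-1) * D f (1 - x))"
      by (intro ac_on_interval_mult ac_on_interval_const ac_on_interval_reflect edge_sol_ac(2)[OF f])
    then show "ac_on_interval 0 1 (D (\<lambda>x. f (1 - x)))"
      by (rule ac_on_interval_cong) (simp add: Dr)
    show "AE x in lborel. x \<in> {0..1} \<longrightarrow> (D (\<lambda>x. f (1 - x)) has_vector_derivative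
        (q (1 - x) - lam) * f (1 - x)) (at x within {0..1})"
      using AE_lborel_reflect[OF edge_sol_AE[OF f]]
    proof eventually_elim
      case (elim x)
      show ?case
      proof
        assume x: "x \<in> {0..1}"
        then have "(D f has_vector_derivative (q (1 - x) - lam) * f (1 - x)) (at (1 - x) within {0..1})"
          using elim by auto
        from has_vector_derivative_minus[OF chain[OF x this]]
        have "((\<lambda>x. - D f (1 - x)) has_vector_derivative (q (1 - x) - lam) * f (1 - x)) (at x within {0..1})"
          by simp
        then show "(D (\<lambda>x. f (1 - x)) has_vector_derivative (q (1 - x) - lam) * f (1 - x)) (at x within {0..1})"
          by (rule has_vector_derivative_transform[OF x Dr, rotated]) simp
      qed
    qed
  qed
qed

lemma absolutely_integrable_reflect_unit:
  fixes q :: "real \<Rightarrow> complex"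
  assumes "q absolutely_integrable_on {0..1}"
  shows "(\<lambda>x. q (1 - x)) absolutely_integrable_on {0..1}"
proof -
  have *: "(\<lambda>x. h (1 - x)) integrable_on {0..1}" if "h integrable_on {0..1}" for h :: "real \<Rightarrow> 'b::euclidean_space"
    using has_integral_affinity[of h "integral {0..1} h" 0 1 "-1" 1] integrable_integral[OF that]
    by (auto simp: integrable_on_def image_affinity_atLeastAtMost_diff)
  show ?thesis
    unfolding absolutely_integrable_on_def
    using *[OF absolutely_integrable_onD(1)[OF assms]] *[OF absolutely_integrable_onD(2)[OF assms]] by simp
qed

section \<open>Asymptotics for large negative spectral parameter\<close>

text \<open>Factorisation of the equation: \<open>u = y' + \<sigma> y\<close> satisfies
  \<open>u' - \<sigma> u = q y\<close>, and \<open>exp (- \<sigma> x)\<close> is the integrating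
  factor. Taking \<sigma> with either sign gives both first-order equations.\<close>

lemma edge_sol_duhamel:
  assumes q: "q absolutely_integrable_on {0..1}" and y: "edge_sol q lam y"
    and \<sigma>: "\<sigma>\<^sup>2 = - lam" and x: "x \<in> {0..1}"
  shows "D y x + \<sigma> * y x = exp (\<sigma> * of_real x) * (D y 0 + \<sigma> * y 0)
    + integral {0..x} (\<lambda>t. q t * (exp (\<sigma> * of_real (x - t)) * y t))"
proof -
  let ?F = "\<lambda>x. exp (- \<sigma> * of_real x) * (D y x + \<sigma> * y x)"
  have derexp: "((\<lambda>x. exp (- \<sigma> * of_real x)) has_vector_derivative - \<sigma> * exp (- \<sigma> * of_real x)) (at x within S)" for x S
    by (rule has_vector_derivative_real_field) (auto intro!: derivative_eq_intros)
  have "ac_on_interval 0 1 (\<lambda>x. exp (- \<sigma> * of_real x))"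
    by (rule ac_on_interval_C1[OF derexp]) (intro continuous_intros)
  then have ac: "ac_on_interval 0 1 ?F"
    by (intro ac_on_interval_mult ac_on_interval_add ac_on_interval_const edge_sol_ac[OF y])
  have "AE x in lborel. x \<in> {0..1} \<longrightarrow>
      (?F has_vector_derivative exp (- \<sigma> * of_real x) * (q x * y x)) (at x within {0..1})"
    using edge_sol_AE[OF y]
  proof eventually_elim
    case (elim x)
    show ?case
    proof
      assume x: "x \<in> {0..1}"
      have 1: "((\<lambda>x. D y x + \<sigma> * y x) has_vector_derivative (q x - lam) * y x + \<sigma> * D y x) (at x within {0..1})"
        using elim x by (intro has_vector_derivative_add has_vector_derivative_mult_right edge_sol_D[OF y]) auto
      have lam: "lam = - (\<sigma> * \<sigma>)" using \<sigma> by (simp add: power2_eq_square)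
      show "(?F has_vector_derivative exp (- \<sigma> * of_real x) * (q x * y x)) (at x within {0..1})"
        by (rule has_vector_derivative_eq_rhs[OF has_vector_derivative_mult[OF derexp 1]])
          (simp add: lam algebra_simps)
    qed
  qed
  from ac_on_interval_has_integral_initial[OF ac x this]
  have "((\<lambda>t. exp (\<sigma> * of_real x) * (exp (- \<sigma> * of_real t) * (q t * y t))) has_integral
      exp (\<sigma> * of_real x) * (?F x - ?F 0)) {0..x}"
    by (rule has_integral_mult_right)
  moreover have "(\<lambda>t. exp (\<sigma> * of_real x) * (exp (- \<sigma> * of_real t) * (q t * y t))) =
      (\<lambda>t. q t * (exp (\<sigma> * of_real (x - t)) * y t))"
    by (rule ext) (simp add: right_diff_distrib exp_diff exp_minus field_simps)
  moreover have "exp (\<sigma> * of_real x) * (?F x - ?F 0) = D y x + \<sigma> * y x - exp (\<sigma> * of_real x) * (D y 0 + \<sigma> * y 0)"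
    by (simp add: right_diff_distrib mult.assoc[symmetric] exp_add[symmetric])
  ultimately show ?thesis by (simp add: integral_unique)
qed

text \<open>The kernel grows no faster than the weight in the bound for \<open>y\<close>, so the two
  exponentials combine to the weight at \<open>x\<close> and leave the L1 norm of
  \<open>q\<close>.\<close>

lemma edge_sol_duhamel_bound:
  assumes q: "q absolutely_integrable_on {0..1}" and y: "edge_sol q lam y"
    and \<sigma>: "\<sigma>\<^sup>2 = - lam" and x: "x \<in> {0..1}"
    and B: "\<And>t. t \<in> {0..1} \<Longrightarrow> norm (y t) \<le> B * exp (\<bar>Re \<sigma>\<bar> * t)"
  shows "norm (D y x + \<sigma> * y x - exp (\<sigma> * of_real x) * (D y 0 + \<sigma> * y 0))
    \<le> l1norm q * B * exp (\<bar>Re \<sigma>\<bar> * x)"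
proof -
  have "norm (integral {0..x} (\<lambda>t. q t * (exp (\<sigma> * of_real (x - t)) * y t)))
      \<le> l1norm q * (B * exp (\<bar>Re \<sigma>\<bar> * x))"
  proof (rule norm_integral_mult_le[OF q _ x])
    show "continuous_on {0..1} (\<lambda>t. exp (\<sigma> * of_real (x - t)) * y t)"
      by (intro continuous_intros edge_sol_continuous[OF y])
    fix t assume t: "t \<in> {0..x}"
    then have "norm (y t) \<le> B * exp (\<bar>Re \<sigma>\<bar> * t)" using x by (intro B) auto
    moreover have "norm (exp (\<sigma> * of_real (x - t))) \<le> exp (\<bar>Re \<sigma>\<bar> * (x - t))"
      using t by (simp add: norm_exp_eq_Re mult_right_mono)
    ultimately have "norm (exp (\<sigma> * of_real (x - t)) * y t) \<le> exp (\<bar>Re \<sigma>\<bar> * (x - t)) * (B * exp (\<bar>Re \<sigma>\<bar> * t))"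
      unfolding norm_mult by (intro mult_mono) auto
    also have "\<dots> = B * exp (\<bar>Re \<sigma>\<bar> * x)"
      by (simp add: right_diff_distrib exp_diff)
    finally show "norm (exp (\<sigma> * of_real (x - t)) * y t) \<le> B * exp (\<bar>Re \<sigma>\<bar> * x)" .
  qed
  then show ?thesis using edge_sol_duhamel[OF q y \<sigma> x] by (simp add: mult.assoc)
qed

text \<open>A priori estimate. At the point where the weighted modulus of \<open>y\<close> is
  maximal, subtracting the Duhamel formulas for \<sigma> and -\<sigma> gives
  \<open>2 * \<sigma> * y\<close>; the term with \<open>q\<close> is at most half of the left side
  and is absorbed.\<close>

lemma edge_sol_bound:
  assumes q: "q absolutely_integrable_on {0..1}" and y: "edge_sol q lam y"
    and \<sigma>: "\<sigma>\<^sup>2 = - lam" "\<sigma> \<noteq> 0" "2 * l1norm q \<le> norm \<sigma>" and x: "x \<in> {0..1}"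
  defines "N \<equiv> norm (D y 0 + \<sigma> * y 0) + norm (D y 0 - \<sigma> * y 0)"
  shows "norm (y x) \<le> N / norm \<sigma> * exp (\<bar>Re \<sigma>\<bar> * x)"
proof -
  define g where "g t = exp (- \<bar>Re \<sigma>\<bar> * t) * norm (y t)" for t
  have "continuous_on {0..1} g"
    unfolding g_def by (intro continuous_intros edge_sol_continuous[OF y])
  then obtain t0 where t0: "t0 \<in> {0..1}" "\<And>t. t \<in> {0..1} \<Longrightarrow> g t \<le> g t0"
    using continuous_attains_sup[of "{0..1::real}" g] by auto
  let ?B = "g t0"
  have yB: "norm (y t) \<le> ?B * exp (\<bar>Re \<sigma>\<bar> * t)" if "t \<in> {0..1}" for t
    using t0(2)[OF that] by (simp add: g_def exp_minus field_simps)
  have one: "norm (D y t + s * y t) \<le> (norm (D y 0 + s * y 0) + l1norm q * ?B) * exp (\<bar>Re \<sigma>\<bar> * t)"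
    if s: "s = \<sigma> \<or> s = - \<sigma>" and t: "t \<in> {0..1}" for s t
  proof -
    have R: "\<bar>Re s\<bar> = \<bar>Re \<sigma>\<bar>" "s\<^sup>2 = - lam" using s \<sigma> by auto
    have "norm (D y t + s * y t) \<le> norm (exp (s * of_real t) * (D y 0 + s * y 0))
        + norm (D y t + s * y t - exp (s * of_real t) * (D y 0 + s * y 0))"
      by (metis add.commute diff_add_cancel norm_triangle_ineq)
    also have "norm (exp (s * of_real t) * (D y 0 + s * y 0)) \<le> exp (\<bar>Re \<sigma>\<bar> * t) * norm (D y 0 + s * y 0)"
    proof -
      have "Re s * t \<le> \<bar>Re \<sigma>\<bar> * t" using t R(1) by (intro mult_right_mono) auto
      then show ?thesis by (simp add: norm_mult norm_exp_eq_Re mult_right_mono)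
    qed
    also have "norm (D y t + s * y t - exp (s * of_real t) * (D y 0 + s * y 0)) \<le> l1norm q * ?B * exp (\<bar>Re \<sigma>\<bar> * t)"
      using edge_sol_duhamel_bound[OF q y R(2) t, of ?B] yB R(1) by simp
    finally show ?thesis by (simp add: algebra_simps)
  qed
  have "2 * norm \<sigma> * norm (y t0) = norm ((D y t0 + \<sigma> * y t0) - (D y t0 + (- \<sigma>) * y t0))"
    by (simp add: norm_mult)
  also have "\<dots> \<le> norm (D y t0 + \<sigma> * y t0) + norm (D y t0 + (- \<sigma>) * y t0)"
    by (rule norm_triangle_ineq4)
  also have "\<dots> \<le> (N + 2 * l1norm q * ?B) * exp (\<bar>Re \<sigma>\<bar> * t0)"
    using one[of \<sigma> t0] one[of "-\<sigma>" t0] t0(1) by (simp add: N_def algebra_simps)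
  finally have "2 * norm \<sigma> * norm (y t0) \<le> (N + 2 * l1norm q * ?B) * exp (\<bar>Re \<sigma>\<bar> * t0)" .
  moreover have "norm (y t0) = ?B * exp (\<bar>Re \<sigma>\<bar> * t0)"
    by (simp add: g_def exp_minus)
  ultimately have "(2 * norm \<sigma> * ?B) * exp (\<bar>Re \<sigma>\<bar> * t0) \<le> (N + 2 * l1norm q * ?B) * exp (\<bar>Re \<sigma>\<bar> * t0)"
    by (simp only: mult.assoc)
  then have "2 * norm \<sigma> * ?B \<le> N + 2 * l1norm q * ?B"
    by (simp only: mult_le_cancel_right_pos[OF exp_gt_zero])
  moreover have "2 * l1norm q * ?B \<le> norm \<sigma> * ?B"
    using \<sigma>(3) by (intro mult_right_mono) (auto simp: g_def)
  ultimately have "?B \<le> N / norm \<sigma>" using \<sigma>(2) by (simp add: field_simps)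
  then have "?B * exp (\<bar>Re \<sigma>\<bar> * x) \<le> N / norm \<sigma> * exp (\<bar>Re \<sigma>\<bar> * x)" by (intro mult_right_mono) auto
  with yB[OF x] show ?thesis by linarith
qed

text \<open>Each estimate is normalised by the value at the end towards which the solution
  increases. In particular, a solution that vanishes at that end vanishes on the whole edge.\<close>

abbreviation grows :: "real \<Rightarrow> real \<Rightarrow> (real \<Rightarrow> complex) \<Rightarrow> bool" where
  "grows C \<tau> y \<equiv> \<forall>x\<in>{0..1}. norm (y x) \<le> C * exp (\<tau> * (x - 1)) * norm (y 1)"

abbreviation decays :: "real \<Rightarrow> real \<Rightarrow> (real \<Rightarrow> complex) \<Rightarrow> bool" where
  "decays C \<tau> y \<equiv> \<forall>x\<in>{0..1}. norm (y x) \<le> C * exp (- \<tau> * x) * norm (y 0)"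

text \<open>With $\lambda = -\tau^2$, the combination $y' + \tau y$ grows like $e^{\tau x}$ and dominates
  $y' - \tau y$ unless it vanishes to leading order at the starting point, i.e. unless $s = -1$.\<close>

lemma edge_growth:
  fixes \<kappa> :: "real \<Rightarrow> complex"
  assumes q: "q absolutely_integrable_on {0..1}"
    and \<kappa>: "((\<lambda>\<tau>. \<kappa> \<tau> / of_real \<tau>) \<longlongrightarrow> s) at_top" and s: "s \<noteq> -1"
  shows "\<exists>m C. ((\<lambda>\<tau>. m \<tau> / of_real \<tau>) \<longlongrightarrow> 1) at_top \<and>
    (\<forall>\<^sub>F \<tau> in at_top. \<forall>y. edge_sol q (- (of_real \<tau>)\<^sup>2) y \<and> D y 0 = \<kappa> \<tau> * y 0 \<longrightarrow>
      D y 1 = m \<tau> * y 1 \<and> grows C \<tau> y)"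
proof -
  \<comment> \<open>Every solution with \<open>D y 0 = \<kappa> \<tau> * y 0\<close> is
    \<open>y 0\<close> times this one, so its ratio at \<open>x = 1\<close> depends on \<tau>
    only.\<close>
  define Y where "Y \<tau> = schr_sol q 1 (\<kappa> \<tau>) (- (of_real \<tau>)\<^sup>2)" for \<tau> :: real
  have Y: "edge_sol q (- (of_real \<tau>)\<^sup>2) (Y \<tau>)" "Y \<tau> 0 = 1" "D (Y \<tau>) 0 = \<kappa> \<tau>" for \<tau>
    unfolding Y_def using edge_sol_schr_sol[OF q] by auto
  define N where "N \<tau> = norm (\<kappa> \<tau> + of_real \<tau>) + norm (\<kappa> \<tau> - of_real \<tau>)" for \<tau>
  \<comment> \<open>Rescaled growing and decaying combinations at \<open>x = 1\<close>. They tend to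
    \<open>s + 1\<close> and 0, while value and derivative at 1 are proportional to
    \<open>W - U\<close> and \<open>W + U\<close>; so their quotient tends to 1 after division by
    \<tau>.\<close>
  define W where "W \<tau> = (D (Y \<tau>) 1 + of_real \<tau> * Y \<tau> 1) * of_real (exp (-\<tau>)) / of_real \<tau>" for \<tau>
  define U where "U \<tau> = (D (Y \<tau>) 1 - of_real \<tau> * Y \<tau> 1) * of_real (exp (-\<tau>)) / of_real \<tau>" for \<tau>
  define n0 where "n0 = norm (s + 1) + norm (s - 1)"
  let ?L = "l1norm q"
  have ev: "\<forall>\<^sub>F \<tau> in at_top. \<tau> > 0 \<and> 2 * ?L \<le> \<tau>"
    using eventually_gt_at_top[of 0] eventually_ge_at_top[of "2 * ?L"] by eventually_elim auto
  have Nlim: "((\<lambda>\<tau>. N \<tau> / \<tau>) \<longlongrightarrow> n0) at_top"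
  proof -
    have "((\<lambda>\<tau>. norm (\<kappa> \<tau> / of_real \<tau> + 1) + norm (\<kappa> \<tau> / of_real \<tau> - 1)) \<longlongrightarrow> n0) at_top"
      unfolding n0_def by (intro tendsto_intros \<kappa>)
    moreover have "\<forall>\<^sub>F \<tau> in at_top. norm (\<kappa> \<tau> / of_real \<tau> + 1) + norm (\<kappa> \<tau> / of_real \<tau> - 1) = N \<tau> / \<tau>"
      using eventually_gt_at_top[of 0]
    proof eventually_elim
      case (elim \<tau>)
      then have "\<kappa> \<tau> / of_real \<tau> + 1 = (\<kappa> \<tau> + of_real \<tau>) / of_real \<tau>" "\<kappa> \<tau> / of_real \<tau> - 1 = (\<kappa> \<tau> - of_real \<tau>) / of_real \<tau>"
        by (auto simp: field_simps)
      moreover have "N \<tau> / \<tau> = norm ((\<kappa> \<tau> + of_real \<tau>) / of_real \<tau>) + norm ((\<kappa> \<tau> - of_real \<tau>) / of_real \<tau>)"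
        unfolding N_def norm_divide norm_of_real using elim by (simp add: add_divide_distrib)
      ultimately show ?case by (simp only:)
    qed
    ultimately show ?thesis by (rule Lim_transform_eventually)
  qed
  have inv: "((\<lambda>\<tau>::real. 1 / \<tau>) \<longlongrightarrow> 0) at_top"
    by (intro tendsto_divide_0[OF tendsto_const] filterlim_at_top_imp_at_infinity filterlim_ident)
  have err0: "((\<lambda>\<tau>. ?L * (N \<tau> / \<tau>) * (1 / \<tau>)) \<longlongrightarrow> 0) at_top"
    using tendsto_mult[OF tendsto_mult[OF tendsto_const[of ?L] Nlim] inv] by simp
  have bnd: "norm (Y \<tau> x) \<le> N \<tau> / \<tau> * exp (\<tau> * x)" if "\<tau> > 0" "2 * ?L \<le> \<tau>" "x \<in> {0..1}" for \<tau> x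
    using edge_sol_bound[OF q Y(1), of "of_real \<tau>" \<tau> x] that by (simp add: Y N_def)
  have rescale: "norm Z \<le> E * (1 / \<tau>)"
    if "\<tau> > 0" "norm X \<le> E * exp \<tau>" "Z = X * of_real (exp (-\<tau>) / \<tau>)" for Z X :: complex and E \<tau> :: real
  proof -
    have "norm Z = norm X * (exp (-\<tau>) / \<tau>)" using that by (simp add: norm_mult norm_divide)
    also have "\<dots> \<le> E * exp \<tau> * (exp (-\<tau>) / \<tau>)" using that by (intro mult_right_mono) auto
    also have "\<dots> = E * (exp \<tau> * exp (-\<tau>)) / \<tau>" by simp
    also have "\<dots> = E * (1 / \<tau>)" by (simp only: exp_add[symmetric]) simp
    finally show ?thesis .
  qed
  have Werr: "norm (W \<tau> - (\<kappa> \<tau> / of_real \<tau> + 1)) \<le> ?L * (N \<tau> / \<tau>) * (1 / \<tau>)"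
    and Uerr: "norm (U \<tau> - of_real (exp (-2 * \<tau>)) * (\<kappa> \<tau> / of_real \<tau> - 1)) \<le> ?L * (N \<tau> / \<tau>) * (1 / \<tau>)"
    if \<tau>: "\<tau> > 0" "2 * ?L \<le> \<tau>" for \<tau>
  proof -
    have "norm (D (Y \<tau>) 1 + of_real \<tau> * Y \<tau> 1 - exp (of_real \<tau>) * (\<kappa> \<tau> + of_real \<tau>))
        \<le> ?L * (N \<tau> / \<tau>) * exp \<tau>"
      using edge_sol_duhamel_bound[OF q Y(1), of "of_real \<tau>" \<tau> 1 "N \<tau> / \<tau>"] bnd[OF \<tau>] \<tau> by (simp add: Y)
    moreover have "W \<tau> - (\<kappa> \<tau> / of_real \<tau> + 1) =
        (D (Y \<tau>) 1 + of_real \<tau> * Y \<tau> 1 - exp (of_real \<tau>) * (\<kappa> \<tau> + of_real \<tau>)) * of_real (exp (-\<tau>) / \<tau>)"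
      using \<tau> by (simp add: W_def field_simps exp_minus exp_of_real)
    ultimately show "norm (W \<tau> - (\<kappa> \<tau> / of_real \<tau> + 1)) \<le> ?L * (N \<tau> / \<tau>) * (1 / \<tau>)"
      by (intro rescale[OF \<tau>(1)])
    have "norm (D (Y \<tau>) 1 - of_real \<tau> * Y \<tau> 1 - exp (- of_real \<tau>) * (\<kappa> \<tau> - of_real \<tau>))
        \<le> ?L * (N \<tau> / \<tau>) * exp \<tau>"
      using edge_sol_duhamel_bound[OF q Y(1), of "- of_real \<tau>" \<tau> 1 "N \<tau> / \<tau>"] bnd[OF \<tau>] \<tau> by (simp add: Y)
    moreover have "U \<tau> - of_real (exp (-2 * \<tau>)) * (\<kappa> \<tau> / of_real \<tau> - 1) =
        (D (Y \<tau>) 1 - of_real \<tau> * Y \<tau> 1 - exp (- of_real \<tau>) * (\<kappa> \<tau> - of_real \<tau>)) * of_real (exp (-\<tau>) / \<tau>)"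
    proof -
      have "exp (-2 * \<tau>) = exp (-\<tau>) * exp (-\<tau>)" by (simp add: exp_add[symmetric])
      moreover have "exp (- of_real \<tau> :: complex) = of_real (exp (-\<tau>))" by (simp add: exp_of_real[symmetric])
      ultimately show ?thesis using \<tau> by (simp add: U_def field_simps)
    qed
    ultimately show "norm (U \<tau> - of_real (exp (-2 * \<tau>)) * (\<kappa> \<tau> / of_real \<tau> - 1)) \<le> ?L * (N \<tau> / \<tau>) * (1 / \<tau>)"
      by (intro rescale[OF \<tau>(1)])
  qed
  have Wlim: "(W \<longlongrightarrow> s + 1) at_top"
  proof -
    have "((\<lambda>\<tau>. W \<tau> - (\<kappa> \<tau> / of_real \<tau> + 1)) \<longlongrightarrow> 0) at_top"
      by (rule Lim_null_comparison[OF _ err0]) (use ev Werr in \<open>auto elim: eventually_mono\<close>)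
    from tendsto_add[OF this tendsto_add[OF \<kappa> tendsto_const[of 1]]] show ?thesis by simp
  qed
  have Ulim: "(U \<longlongrightarrow> 0) at_top"
  proof -
    have "((\<lambda>\<tau>. U \<tau> - of_real (exp (-2 * \<tau>)) * (\<kappa> \<tau> / of_real \<tau> - 1)) \<longlongrightarrow> 0) at_top"
      by (rule Lim_null_comparison[OF _ err0]) (use ev Uerr in \<open>auto elim: eventually_mono\<close>)
    moreover have "((\<lambda>\<tau>::real. exp (-2 * \<tau>)) \<longlongrightarrow> 0) at_top"
      by (intro filterlim_compose[OF exp_at_bot])
        (auto simp: filterlim_uminus_at_bot intro!: filterlim_tendsto_pos_mult_at_top[OF tendsto_const] filterlim_ident)
    then have "((\<lambda>\<tau>. of_real (exp (-2 * \<tau>)) * (\<kappa> \<tau> / of_real \<tau> - 1)) \<longlongrightarrow> of_real 0 * (s - 1)) at_top"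
      by (intro tendsto_mult tendsto_of_real tendsto_diff \<kappa> tendsto_const)
    ultimately have "((\<lambda>\<tau>. (U \<tau> - of_real (exp (-2 * \<tau>)) * (\<kappa> \<tau> / of_real \<tau> - 1)) +
        of_real (exp (-2 * \<tau>)) * (\<kappa> \<tau> / of_real \<tau> - 1)) \<longlongrightarrow> 0 + of_real 0 * (s - 1)) at_top"
      by (rule tendsto_add)
    then show ?thesis by simp
  qed
  \<comment> \<open>Where \<open>Y \<tau> 1\<close> is zero the quotient is 0 by default; for large
    \<tau> this does not happen, as \<open>W - U\<close> stays away from zero.\<close>
  define m where "m \<tau> = D (Y \<tau>) 1 / Y \<tau> 1" for \<tau>
  have s1: "s + 1 \<noteq> 0" using s by (metis add_eq_0_iff2)
  have YU: "Y \<tau> 1 = of_real (exp \<tau>) * (W \<tau> - U \<tau>) / 2"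
    and DYU: "D (Y \<tau>) 1 = of_real \<tau> * of_real (exp \<tau>) * (W \<tau> + U \<tau>) / 2" if "\<tau> > 0" for \<tau>
    using that by (auto simp: W_def U_def field_simps exp_minus)
  have "((\<lambda>\<tau>. (W \<tau> + U \<tau>) / (W \<tau> - U \<tau>)) \<longlongrightarrow> (s + 1 + 0) / (s + 1 - 0)) at_top"
    using s1 by (intro tendsto_intros Wlim Ulim) simp
  then have "((\<lambda>\<tau>. (W \<tau> + U \<tau>) / (W \<tau> - U \<tau>)) \<longlongrightarrow> 1) at_top" using s1 by simp
  moreover have "\<forall>\<^sub>F \<tau> in at_top. (W \<tau> + U \<tau>) / (W \<tau> - U \<tau>) = m \<tau> / of_real \<tau>"
    using eventually_gt_at_top[of 0]
  proof eventually_elim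
    case (elim \<tau>)
    have "a / b = (t * E * a / 2) / (E * b / 2) / t" if "t \<noteq> 0" "E \<noteq> 0" for a b t E :: complex
      using that by (cases "b = 0") (simp_all add: field_simps)
    from this[of "of_real \<tau>" "of_real (exp \<tau>)"] show ?case
      unfolding m_def YU[OF elim] DYU[OF elim] using elim by simp
  qed
  ultimately have mlim: "((\<lambda>\<tau>. m \<tau> / of_real \<tau>) \<longlongrightarrow> 1) at_top" by (rule Lim_transform_eventually)
  \<comment> \<open>Quotient of the eventual upper bound \<open>(n0 + 1) * exp (\<tau> * x)\<close>
    for the modulus of \<open>Y\<close> and the eventual lower bound
    \<open>exp \<tau> * norm (s + 1) / 4\<close> at \<open>x = 1\<close>.\<close>
  define C where "C = 4 * (n0 + 1) / norm (s + 1)"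
  have "((\<lambda>\<tau>. norm (W \<tau> - U \<tau>)) \<longlongrightarrow> norm (s + 1 - 0)) at_top"
    by (intro tendsto_intros Wlim Ulim)
  then have evWU: "\<forall>\<^sub>F \<tau> in at_top. norm (s + 1) / 2 < norm (W \<tau> - U \<tau>)"
    by (rule order_tendstoD) (use s1 in simp)
  have evN: "\<forall>\<^sub>F \<tau> in at_top. N \<tau> / \<tau> < n0 + 1"
    by (rule order_tendstoD[OF Nlim]) simp
  have "\<forall>\<^sub>F \<tau> in at_top. \<forall>y. edge_sol q (- (of_real \<tau>)\<^sup>2) y \<and> D y 0 = \<kappa> \<tau> * y 0 \<longrightarrow>
      D y 1 = m \<tau> * y 1 \<and> grows C \<tau> y"
    using ev evWU evN
  proof eventually_elim
    case (elim \<tau>)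
    then have \<tau>: "\<tau> > 0" "2 * ?L \<le> \<tau>" by auto
    have Y1: "norm (Y \<tau> 1) = exp \<tau> * norm (W \<tau> - U \<tau>) / 2"
      unfolding YU[OF \<tau>(1)] by (simp add: norm_mult norm_divide)
    have "exp \<tau> * (norm (s + 1) / 2) \<le> exp \<tau> * norm (W \<tau> - U \<tau>)"
      using elim by (intro mult_left_mono) auto
    then have Y1': "exp \<tau> * norm (s + 1) / 4 \<le> norm (Y \<tau> 1)" unfolding Y1 by simp
    have "0 < exp \<tau> * norm (s + 1) / 4" using s1 by simp
    then have Y10: "Y \<tau> 1 \<noteq> 0" using Y1' by auto
    show ?case
    proof (intro allI impI conjI ballI; elim conjE)
      fix y assume y: "edge_sol q (- (of_real \<tau>)\<^sup>2) y" "D y 0 = \<kappa> \<tau> * y 0"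
      \<comment> \<open>The zero summand brings the multiple into the shape of
        \<open>edge_sol_lincomb\<close>.\<close>
      let ?z = "\<lambda>x. y 0 * Y \<tau> x + 0 * Y \<tau> x"
      have z: "edge_sol q (- (of_real \<tau>)\<^sup>2) ?z" by (rule edge_sol_lincomb[OF Y(1) Y(1)])
      have z0: "D ?z x = y 0 * D (Y \<tau>) x" if "x \<in> {0..1}" for x
        using edge_sol_lincomb(2)[OF Y(1)[of \<tau>] Y(1)[of \<tau>] that, of "y 0" 0] by simp
      have D0: "D y 0 = D ?z 0" unfolding y(2) using z0[of 0] by (simp add: Y)
      have yz: "y x = y 0 * Y \<tau> x" "D y x = y 0 * D (Y \<tau>) x" if "x \<in> {0..1}" for x
        using edge_sol_unique[OF q y(1) z _ D0 that] z0[OF that] by (auto simp: Y)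
      show "D y 1 = m \<tau> * y 1" using yz[of 1] Y10 by (simp add: m_def)
      fix x :: real assume x: "x \<in> {0..1}"
      have "norm (Y \<tau> x) \<le> N \<tau> / \<tau> * exp (\<tau> * x)" by (rule bnd[OF \<tau> x])
      also have "\<dots> \<le> (n0 + 1) * exp (\<tau> * x)" using elim by (intro mult_right_mono) auto
      also have "\<dots> = C * exp (\<tau> * (x - 1)) * (exp \<tau> * norm (s + 1) / 4)"
        using s1 by (simp add: C_def right_diff_distrib exp_diff)
      also have "\<dots> \<le> C * exp (\<tau> * (x - 1)) * norm (Y \<tau> 1)"
        using Y1' by (intro mult_left_mono) (auto simp: C_def n0_def)
      finally have "norm (y 0) * norm (Y \<tau> x) \<le> norm (y 0) * (C * exp (\<tau> * (x - 1)) * norm (Y \<tau> 1))"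
        by (intro mult_left_mono) auto
      then show "norm (y x) \<le> C * exp (\<tau> * (x - 1)) * norm (y 1)"
        using yz(1)[OF x] yz(1)[of 1] by (simp add: norm_mult mult.left_commute mult.assoc)
    qed
  qed
  with mlim show ?thesis by blast
qed

text \<open>This is \<open>edge_growth\<close> on the reversed edge. Reversal changes the sign of
  the derivative, so the exceptional initial ratio becomes 1 and the limiting ratio becomes
  -1.\<close>

lemma edge_decay:
  fixes \<kappa> :: "real \<Rightarrow> complex"
  assumes q: "q absolutely_integrable_on {0..1}"
    and \<kappa>: "((\<lambda>\<tau>. \<kappa> \<tau> / of_real \<tau>) \<longlongrightarrow> s) at_top" and s: "s \<noteq> 1"
  shows "\<exists>m C. ((\<lambda>\<tau>. m \<tau> / of_real \<tau>) \<longlongrightarrow> -1) at_top \<and>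
    (\<forall>\<^sub>F \<tau> in at_top. \<forall>y. edge_sol q (- (of_real \<tau>)\<^sup>2) y \<and> D y 1 = \<kappa> \<tau> * y 1 \<longrightarrow>
      D y 0 = m \<tau> * y 0 \<and> decays C \<tau> y)"
proof -
  have "((\<lambda>\<tau>. - \<kappa> \<tau> / of_real \<tau>) \<longlongrightarrow> - s) at_top"
    using tendsto_minus[OF \<kappa>] by simp
  moreover have "- s \<noteq> -1" using s by simp
  ultimately obtain m C where m: "((\<lambda>\<tau>. m \<tau> / of_real \<tau>) \<longlongrightarrow> 1) at_top"
    and ev: "\<forall>\<^sub>F \<tau> in at_top. \<forall>y. edge_sol (\<lambda>x. q (1 - x)) (- (of_real \<tau>)\<^sup>2) y \<and> D y 0 = - \<kappa> \<tau> * y 0 \<longrightarrow>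
      D y 1 = m \<tau> * y 1 \<and> grows C \<tau> y"
    using edge_growth[OF absolutely_integrable_reflect_unit[OF q], of "\<lambda>\<tau>. - \<kappa> \<tau>" "- s"] by blast
  have "\<forall>\<^sub>F \<tau> in at_top. \<forall>y. edge_sol q (- (of_real \<tau>)\<^sup>2) y \<and> D y 1 = \<kappa> \<tau> * y 1 \<longrightarrow>
      D y 0 = - m \<tau> * y 0 \<and> decays C \<tau> y"
    using ev
  proof eventually_elim
    case (elim \<tau>)
    show ?case
    proof (intro allI impI)
      fix y assume y: "edge_sol q (- (of_real \<tau>)\<^sup>2) y \<and> D y 1 = \<kappa> \<tau> * y 1"
      let ?z = "\<lambda>x. y (1 - x)"
      have z: "edge_sol (\<lambda>x. q (1 - x)) (- (of_real \<tau>)\<^sup>2) ?z" using y edge_sol_reflect(1) by blast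
      have Dz: "D ?z x = - D y (1 - x)" if "x \<in> {0..1}" for x
        using y edge_sol_reflect(2) that by blast
      have *: "D ?z 1 = m \<tau> * ?z 1 \<and> grows C \<tau> ?z"
        using elim[rule_format, of ?z] z Dz[of 0] y by simp
      have "norm (y x) \<le> C * exp (- \<tau> * x) * norm (y 0)" if "x \<in> {0..1}" for x
        using *[THEN conjunct2, rule_format, of "1 - x"] that by simp
      then show "D y 0 = - m \<tau> * y 0 \<and> decays C \<tau> y"
        using * Dz[of 1] by (simp add: minus_equation_iff[of "D y 0"] eq_commute[of _ "D y 0"])
    qed
  qed
  moreover have "((\<lambda>\<tau>. - m \<tau> / of_real \<tau>) \<longlongrightarrow> -1) at_top"
    using tendsto_minus[OF m] by simp
  ultimately show ?thesis by (intro exI[of _ "\<lambda>\<tau>. - m \<tau>"] exI[of _ C]) simp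
qed

section \<open>A Phragmen--Lindelof argument\<close>

text \<open>The argument of \<open>w\<close> is below pi/2 in modulus, and 3/4 of it below 3 pi/8,
  where the cosine is still positive. The exponent 3/4 lies between the growth order 1/2, which it
  has to beat, and 1, where positivity would be lost.\<close>

lemma Re_powr_right_half_plane_ge:
  assumes "Re w > 0"
  shows "cos (3 * pi / 8) * norm w powr (3/4) \<le> Re (w powr (3/4))"
proof -
  have "w \<noteq> 0" using assms by auto
  let ?\<theta> = "Im (Ln w)"
  have \<theta>: "\<bar>?\<theta>\<bar> < pi/2" using Re_Ln_pos_lt[OF \<open>w \<noteq> 0\<close>] assms by blast
  have "Re (w powr (3/4)) = exp (3/4 * ln (norm w)) * cos (3/4 * ?\<theta>)"
    using \<open>w \<noteq> 0\<close> by (simp add: powr_def Re_exp Re_divide_numeral)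
  also have "exp (3/4 * ln (norm w)) = norm w powr (3/4)"
    using \<open>w \<noteq> 0\<close> by (simp add: powr_def)
  also have "norm w powr (3/4) * cos (3/4 * ?\<theta>) \<ge> norm w powr (3/4) * cos (3 * pi / 8)"
  proof (rule mult_left_mono)
    have "cos (3 * pi / 8) \<le> cos \<bar>3/4 * ?\<theta>\<bar>"
      using \<theta> by (intro cos_monotone_0_pi_le) (auto simp: abs_mult)
    then show "cos (3 * pi / 8) \<le> cos (3/4 * ?\<theta>)" by (simp only: cos_abs_real)
  qed simp
  finally show ?thesis by (simp add: mult.commute)
qed

text \<open>Maximum principle on a half disc for \<open>f\<close> times a damping factor: on the
  imaginary axis the factor has modulus at most 1, on a large arc it beats the growth of
  \<open>f\<close>. Letting \<open>\<epsilon>\<close> tend to 0 removes it.\<close>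

lemma phragmen_lindelof_half_plane:
  fixes f :: "complex \<Rightarrow> complex"
  assumes f: "f holomorphic_on UNIV"
    and growth: "\<And>z. norm (f z) \<le> A * exp (B * sqrt (norm z))"
    and bdry: "\<And>z. Re z = 0 \<Longrightarrow> norm (f z) \<le> M"
    and "M > 0" and z0: "Re z0 > 0"
  shows "norm (f z0) \<le> M"
proof -
  define c where "c = cos (3 * pi / 8)"
  have "c > 0" unfolding c_def by (intro cos_gt_zero_pi) auto
  have "A \<ge> 0" using growth[of 0] by (simp add: norm_ge_zero order_trans[OF norm_ge_zero])
  have *: "norm (f z0) \<le> M * exp (\<epsilon> * Re ((z0 + 1) powr (3/4)))" if "\<epsilon> > 0" for \<epsilon>
  proof -
    \<comment> \<open>The shift by 1 moves the branch cut of the power away from the closed half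
      plane, so \<open>g\<close> is holomorphic up to and beyond the imaginary axis.\<close>
    define g where "g z = f z * exp (- of_real \<epsilon> * (z + 1) powr (3/4))" for z
    have ng: "norm (g z) = norm (f z) * exp (- \<epsilon> * Re ((z + 1) powr (3/4)))" for z
      by (simp add: g_def norm_mult)
    have Re1: "c * norm z powr (3/4) \<le> Re ((z + 1) powr (3/4))" if "Re z \<ge> 0" for z
    proof -
      have "(norm z)\<^sup>2 \<le> (norm (z + 1))\<^sup>2"
        using that unfolding cmod_power2 by (simp add: power2_eq_square algebra_simps)
      then have "norm z \<le> norm (z + 1)" by (simp add: power2_le_iff_abs_le)
      then have "c * norm z powr (3/4) \<le> c * norm (z + 1) powr (3/4)"
        using \<open>c > 0\<close> by (intro mult_left_mono powr_mono2) auto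
      also have "\<dots> \<le> Re ((z + 1) powr (3/4))"
        unfolding c_def using that by (intro Re_powr_right_half_plane_ge) simp
      finally show ?thesis .
    qed
    \<comment> \<open>Here \<open>R powr (3/4)\<close> is written as
      \<open>sqrt R * sqrt (sqrt R)\<close>, so that factoring out \<open>sqrt R\<close> leaves a
      bracket tending to infinity; a large \<open>R\<close> makes the bound on the arc smaller than
      \<open>M\<close>.\<close>
    have "((\<lambda>R. A * exp (- (sqrt R * (\<epsilon> * c * sqrt (sqrt R) + (- B))))) \<longlongrightarrow> A * 0) at_top"
    proof (intro tendsto_mult tendsto_const filterlim_compose[OF exp_at_bot])
      have "filterlim (\<lambda>R. \<epsilon> * c * sqrt (sqrt R)) at_top at_top"
        using \<open>\<epsilon> > 0\<close> \<open>c > 0\<close>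
        by (intro filterlim_tendsto_pos_mult_at_top[OF tendsto_const] filterlim_compose[OF sqrt_at_top] sqrt_at_top) auto
      then have "filterlim (\<lambda>R. (- B) + \<epsilon> * c * sqrt (sqrt R)) at_top at_top"
        by (intro filterlim_tendsto_add_at_top[OF tendsto_const])
      then have "filterlim (\<lambda>R. sqrt R * (\<epsilon> * c * sqrt (sqrt R) + (- B))) at_top at_top"
        by (intro filterlim_at_top_mult_at_top sqrt_at_top) (simp add: add.commute)
      then show "filterlim (\<lambda>R. - (sqrt R * (\<epsilon> * c * sqrt (sqrt R) + (- B)))) at_bot at_top"
        by (simp add: filterlim_uminus_at_bot)
    qed
    then have "\<forall>\<^sub>F R in at_top. A * exp (- (sqrt R * (\<epsilon> * c * sqrt (sqrt R) + (- B)))) < M"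
      by (rule order_tendstoD) (use \<open>M > 0\<close> in simp)
    then have "\<forall>\<^sub>F R in at_top. A * exp (- (sqrt R * (\<epsilon> * c * sqrt (sqrt R) + (- B)))) < M \<and> R > norm z0 \<and> R > 0"
      using eventually_gt_at_top[of "norm z0"] eventually_gt_at_top[of 0] by eventually_elim auto
    then obtain R where R: "A * exp (- (sqrt R * (\<epsilon> * c * sqrt (sqrt R) + (- B)))) < M" "R > norm z0" "R > 0"
      using eventually_happens[of _ at_top] by (metis (mono_tags, lifting) trivial_limit_at_top_linorder)
    have Rp: "R powr (3/4) = sqrt R * sqrt (sqrt R)"
      using \<open>R > 0\<close> by (simp add: powr_half_sqrt[symmetric] powr_powr powr_add[symmetric])
    define S where "S = {z. Re z > 0} \<inter> ball 0 R"
    have "open S" unfolding S_def by (intro open_Int open_halfspace_Re_gt open_ball)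
    have clS: "closure S \<subseteq> {z. Re z \<ge> 0} \<inter> cball 0 R"
      by (rule closure_minimal) (auto simp: S_def intro!: closed_Int closed_halfspace_Re_ge)
    have gholo: "g holomorphic_on {z. Re z > -1}"
      unfolding g_def
      by (intro holomorphic_intros holomorphic_on_subset[OF f]) (auto simp: complex_nonpos_Reals_iff)
    have "norm (g z0) \<le> M"
    proof (rule maximum_modulus_frontier[of g S M z0])
      show "g holomorphic_on interior S"
        by (rule holomorphic_on_subset[OF gholo]) (use interior_subset in \<open>force simp: S_def\<close>)
      show "continuous_on (closure S) g"
        by (rule continuous_on_subset[OF holomorphic_on_imp_continuous_on[OF gholo]]) (use clS in force)
      show "bounded S" unfolding S_def by (simp add: bounded_Int)
      show "z0 \<in> S" using z0 R by (simp add: S_def)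
      fix z assume "z \<in> frontier S"
      then have z: "z \<in> closure S" "z \<notin> S"
        using \<open>open S\<close> by (auto simp: frontier_def interior_open)
      then have Rez: "Re z \<ge> 0" and nz: "norm z \<le> R" using clS by auto
      have pos: "0 \<le> Re ((z + 1) powr (3/4))"
        using Re1[OF Rez] \<open>c > 0\<close> by (meson less_imp_le mult_nonneg_nonneg order_trans powr_ge_zero)
      show "norm (g z) \<le> M"
      proof (cases "Re z = 0")
        case True
        have "norm (g z) \<le> norm (f z) * 1"
          unfolding ng using pos \<open>\<epsilon> > 0\<close> by (intro mult_left_mono) auto
        with bdry[OF True] show ?thesis by simp
      next
        case False
        with z Rez nz have nz: "norm z = R" by (auto simp: S_def)
        have "norm (g z) \<le> (A * exp (B * sqrt R)) * exp (- \<epsilon> * (c * R powr (3/4)))"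
          unfolding ng using growth[of z] Re1[OF Rez] nz \<open>\<epsilon> > 0\<close> \<open>A \<ge> 0\<close> by (intro mult_mono) auto
        also have "\<dots> = A * exp (- (sqrt R * (\<epsilon> * c * sqrt (sqrt R) + (- B))))"
          unfolding Rp by (simp add: exp_add[symmetric] algebra_simps)
        finally show ?thesis using R(1) by simp
      qed
    qed
    then show ?thesis unfolding ng by (simp add: exp_minus field_simps)
  qed
  have "((\<lambda>\<epsilon>. M * exp (\<epsilon> * Re ((z0 + 1) powr (3/4)))) \<longlongrightarrow> M * exp (0 * Re ((z0 + 1) powr (3/4)))) (at_right 0)"
    by (intro tendsto_intros)
  then show ?thesis
    using * by (intro tendsto_lowerbound[where F="at_right 0" and f="\<lambda>\<epsilon>. M * exp (\<epsilon> * Re ((z0 + 1) powr (3/4)))"])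
      (auto simp: eventually_at_right_less intro: eventually_mono[OF eventually_at_right_less])
qed

text \<open>Multiplication by \<i> or -\<i> carries the right half plane to the upper or lower one
  and the imaginary axis to the real axis. So the bound on the real axis extends to the plane,
  Liouville makes \<open>f\<close> constant, and the limit identifies the constant.\<close>

lemma entire_order_half_eq_zero:
  fixes f :: "complex \<Rightarrow> complex"
  assumes f: "f holomorphic_on UNIV"
    and growth: "\<And>z. norm (f z) \<le> A * exp (B * sqrt (norm z))"
    and real: "\<And>x::real. norm (f (of_real x)) \<le> M"
    and lim: "((\<lambda>\<tau>::real. f (- (of_real \<tau>)\<^sup>2)) \<longlongrightarrow> 0) at_top"
  shows "f z = 0"
proof -
  have M: "\<bar>M\<bar> + 1 > 0" by simp
  have real': "norm (f w) \<le> \<bar>M\<bar> + 1" if "Im w = 0" for w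
  proof -
    have "w = of_real (Re w)" using that by (simp add: complex_eq_iff)
    then show ?thesis using real[of "Re w"] by (metis abs_ge_self add_increasing2 order_trans zero_le_one)
  qed
  have half: "norm (f w) \<le> \<bar>M\<bar> + 1" if e: "e = \<i> \<or> e = -\<i>" and w: "Re (w / e) > 0" for e w
  proof -
    have "e \<noteq> 0" "norm e = 1" "Re e = 0" using e by auto
    have "norm ((\<lambda>z. f (e * z)) (w / e)) \<le> \<bar>M\<bar> + 1"
    proof (rule phragmen_lindelof_half_plane[OF _ _ _ M w])
      have "f \<circ> (\<lambda>z. e * z) holomorphic_on UNIV"
        by (intro holomorphic_on_compose holomorphic_intros holomorphic_on_subset[OF f]) auto
      then show "(\<lambda>z. f (e * z)) holomorphic_on UNIV" by (simp add: o_def)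
      show "norm (f (e * z)) \<le> A * exp (B * sqrt (norm z))" for z
        using growth[of "e * z"] \<open>norm e = 1\<close> by (simp add: norm_mult)
      show "norm (f (e * z)) \<le> \<bar>M\<bar> + 1" if "Re z = 0" for z
        by (rule real') (use e that in auto)
    qed
    then show ?thesis using \<open>e \<noteq> 0\<close> by simp
  qed
  have "norm (f w) \<le> \<bar>M\<bar> + 1" for w
  proof -
    consider "Im w = 0" | "Im w > 0" | "Im w < 0" by linarith
    then show ?thesis
    proof cases
      case 1 then show ?thesis by (rule real')
    next
      case 2 then show ?thesis by (intro half[of \<i>]) (auto simp: Re_divide)
    next
      case 3 then show ?thesis by (intro half[of "-\<i>"]) (auto simp: Re_divide)
    qed
  qed
  then have "bounded (range f)" unfolding bounded_iff by blast
  then obtain c where c: "\<And>z. f z = c"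
    using Liouville_theorem[OF f] by (auto simp: constant_on_def)
  have "c = 0"
    using lim unfolding c by (simp add: tendsto_const_iff)
  then show ?thesis using c by simp
qed

section \<open>The boundary value problem on the tree\<close>

lemma underdetermined_system_nontrivial:
  fixes A :: "'i \<Rightarrow> 'j \<Rightarrow> complex"
  assumes "finite I" "finite J" "card I < card J"
  shows "\<exists>c. (\<exists>j\<in>J. c j \<noteq> 0) \<and> (\<forall>i\<in>I. (\<Sum>j\<in>J. A i j * c j) = 0)"
  using assms
proof (induction I arbitrary: J A rule: finite_induct)
  case empty
  then have "J \<noteq> {}" by auto
  then show ?case by (intro exI[of _ "\<lambda>_. 1"]) auto
next
  case (insert i I)
  show ?case
  proof (cases "\<forall>j\<in>J. A i j = 0")
    case True
    have "card I < card J" using insert by simp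
    from insert.IH[OF insert.prems(1) this, of A] show ?thesis using True by auto
  next
    case False
    then obtain j0 where j0: "j0 \<in> J" "A i j0 \<noteq> 0" by blast
    \<comment> \<open>Gaussian elimination: equation \<open>i\<close> is solved for the unknown
      \<open>j0\<close>, which is then substituted into the remaining equations.\<close>
    define J' where "J' = J - {j0}"
    have J': "finite J'" "card I < card J'" "j0 \<notin> J'" "J = insert j0 J'"
      using insert j0 by (auto simp: J'_def)
    obtain c where c: "\<exists>j\<in>J'. c j \<noteq> 0"
      "\<forall>i'\<in>I. (\<Sum>j\<in>J'. (A i' j - A i' j0 * A i j / A i j0) * c j) = 0"
      using insert.IH[OF J'(1,2), of "\<lambda>i' j. A i' j - A i' j0 * A i j / A i j0"] by blast
    define c' where "c' = c(j0 := - (\<Sum>j\<in>J'. A i j * c j) / A i j0)"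
    have sum: "(\<Sum>j\<in>J. A i' j * c' j) = A i' j0 * c' j0 + (\<Sum>j\<in>J'. A i' j * c j)" for i'
    proof -
      have "(\<Sum>j\<in>J'. A i' j * c' j) = (\<Sum>j\<in>J'. A i' j * c j)"
        using J'(3) by (intro sum.cong) (auto simp: c'_def)
      then show ?thesis using J' by simp
    qed
    have "(\<Sum>j\<in>J. A i j * c' j) = 0"
      unfolding sum using j0 by (simp add: c'_def)
    moreover have "(\<Sum>j\<in>J. A i' j * c' j) = 0" if "i' \<in> I" for i'
    proof -
      have "0 = (\<Sum>j\<in>J'. (A i' j - A i' j0 * A i j / A i j0) * c j)" using c(2) that by simp
      also have "\<dots> = (\<Sum>j\<in>J'. A i' j * c j) - A i' j0 / A i j0 * (\<Sum>j\<in>J'. A i j * c j)"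
        by (simp add: left_diff_distrib sum_subtractf sum_distrib_left mult.assoc)
      finally show ?thesis unfolding sum by (simp add: c'_def algebra_simps)
    qed
    moreover have "\<exists>j\<in>J. c' j \<noteq> 0" using c(1) J' by (auto simp: c'_def)
    ultimately show ?thesis by blast
  qed
qed

text \<open>Append \<open>- b\<close> as one more column, indexed by \<open>None\<close>. The
  enlarged homogeneous system has a nontrivial solution; injectivity makes its \<open>None\<close>
  coordinate nonzero, and dividing by it solves the system for \<open>b\<close>.\<close>

lemma linear_injective_imp_surjective_on_finite:
  fixes F :: "('i \<Rightarrow> complex) \<Rightarrow> 'i \<Rightarrow> complex"
  assumes I: "finite I"
    and lin: "\<And>x c d i. i \<in> I \<Longrightarrow> F (\<lambda>j. x * c j + d j) i = x * F c i + F d i"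
    and cong: "\<And>c d i. i \<in> I \<Longrightarrow> (\<And>j. j \<in> I \<Longrightarrow> c j = d j) \<Longrightarrow> F c i = F d i"
    and inj: "\<And>c j. (\<And>i. i \<in> I \<Longrightarrow> F c i = 0) \<Longrightarrow> j \<in> I \<Longrightarrow> c j = 0"
  shows "\<exists>c. \<forall>i\<in>I. F c i = b i"
proof -
  define A where "A i j = F (\<lambda>j'. if j' = j then 1 else 0) i" for i j
  have zero: "F (\<lambda>_. 0) i = 0" if "i \<in> I" for i
    using lin[OF that, of 1 "\<lambda>_. 0" "\<lambda>_. 0"] by simp
  have FA: "F c i = (\<Sum>j\<in>I. A i j * c j)" if i: "i \<in> I" for c i
  proof -
    have "F (\<lambda>j. if j \<in> J then c j else 0) i = (\<Sum>j\<in>J. A i j * c j)" if "finite J" "J \<subseteq> I" for J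
      using that
    proof (induction J rule: finite_induct)
      case empty then show ?case using zero[OF i] by simp
    next
      case (insert j J)
      have "(\<lambda>j'. if j' \<in> insert j J then c j' else 0) =
          (\<lambda>j'. c j * (if j' = j then 1 else 0) + (if j' \<in> J then c j' else 0))"
        using insert by auto
      then have "F (\<lambda>j'. if j' \<in> insert j J then c j' else 0) i = c j * A i j + F (\<lambda>j'. if j' \<in> J then c j' else 0) i"
        using lin[OF i, of "c j"] by (simp add: A_def)
      then show ?case using insert by (simp add: mult.commute)
    qed
    from this[OF I order_refl] show ?thesis
      using cong[OF i, of c "\<lambda>j. if j \<in> I then c j else 0"] by simp
  qed
  define A' where "A' i j = (case j of None \<Rightarrow> - b i | Some j \<Rightarrow> A i j)" for i j
  have "card I < card (insert None (Some ` I))"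
    using I by (simp add: card_image)
  from underdetermined_system_nontrivial[OF I _ this, of A'] I
  obtain c where c: "\<exists>j\<in>insert None (Some ` I). c j \<noteq> 0"
    "\<forall>i\<in>I. (\<Sum>j\<in>insert None (Some ` I). A' i j * c j) = 0" by auto
  have eq: "F (\<lambda>j. c (Some j)) i = b i * c None" if "i \<in> I" for i
  proof -
    have "(\<Sum>j\<in>insert None (Some ` I). A' i j * c j) = - b i * c None + (\<Sum>j\<in>I. A i j * c (Some j))"
      using I by (simp add: A'_def sum.reindex)
    then show ?thesis using c(2) that FA[OF that] by (simp add: add_eq_0_iff)
  qed
  have "c None \<noteq> 0"
  proof
    assume "c None = 0"
    then have "c (Some j) = 0" if "j \<in> I" for j
      using inj[of "\<lambda>j. c (Some j)"] eq that by simp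
    then show False using c(1) \<open>c None = 0\<close> by auto
  qed
  have "F (\<lambda>j. (1 / c None) * c (Some j)) i = b i" if "i \<in> I" for i
    using lin[OF that, of "1 / c None" "\<lambda>j. c (Some j)" "\<lambda>_. 0"] zero[OF that] eq[OF that] \<open>c None \<noteq> 0\<close> by simp
  then show ?thesis by blast
qed

lemma const_over_tau: "((\<lambda>\<tau>::real. (c::complex) / of_real \<tau>) \<longlongrightarrow> 0) at_top"
proof -
  have "((\<lambda>\<tau>::real. c * of_real (inverse \<tau>)) \<longlongrightarrow> c * of_real 0) at_top"
    by (intro tendsto_mult tendsto_const tendsto_of_real tendsto_inverse_0_at_top filterlim_ident)
  then show ?thesis by (simp add: divide_inverse)
qed

text \<open>One boundary value problem with a distinguished boundary vertex, to be instantiated once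
  for each of the two problems compared.\<close>

locale quantum_tree =
  fixes r p :: nat and par :: "nat \<Rightarrow> nat" and a a1 a0 :: "nat \<Rightarrow> nat \<Rightarrow> complex"
    and q :: "nat \<Rightarrow> real \<Rightarrow> complex" and h :: "nat \<Rightarrow> complex" and k :: nat
  assumes tree: "tree_ok r p par" and coef: "coef_ok r p par a a1"
    and potential: "potential_ok r q" and k: "k \<in> {1..p}"
begin

abbreviation "sol lam Y \<equiv> tree_sol r p par a a1 a0 q lam Y"

text \<open>Boundary conditions are imposed only at leaves outside \<open>A\<close>, and none at the
  root: this is what a branch hanging off \<open>A\<close> sees.\<close>

abbreviation "branch_sol A \<tau> Y \<equiv> sol (- (of_real \<tau>)\<^sup>2) Y \<and> (\<forall>i\<in>{1..p} - A. U0 p h Y i = 0)"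

text \<open>Common to Weyl solutions and solutions of the homogeneous problem: the only boundary
  form left free is that at \<open>v\<^sub>k\<close>.\<close>

abbreviation "path_sol \<tau> Y \<equiv> sol (- (of_real \<tau>)\<^sup>2) Y \<and> (\<forall>i\<le>p. i \<noteq> k \<longrightarrow> U0 p h Y i = 0)"

lemma q_integrable: "j \<in> {1..r} \<Longrightarrow> q j absolutely_integrable_on {0..1}"
  using potential unfolding potential_ok_def by (blast intro: set_integrable_lborel_imp_lebesgue)

lemma par_mem: "j \<in> {1..r} \<Longrightarrow> j \<noteq> Suc p \<Longrightarrow> par j \<in> {Suc p..r}"
  using tree unfolding tree_ok_def by blast

lemma par_less: "j \<in> {Suc p..r} \<Longrightarrow> par j < j"
  using tree unfolding tree_ok_def by blast

lemma par_root: "par (Suc p) = 0" and p_less: "p < r" and Suc_p_mem: "Suc p \<in> {1..r}"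
  using tree unfolding tree_ok_def by auto

lemma Rset_iff: "j \<in> Rset r par l \<longleftrightarrow> j \<in> {1..r} \<and> par j = l"
  unfolding Rset_def by blast

lemma finite_Rset: "finite (Rset r par l)"
  unfolding Rset_def by simp

lemma coef_nonzero:
  assumes "l \<in> {Suc p..r}" "j \<in> Rset r par l"
  shows "a l j \<noteq> 0" "a1 l j \<noteq> 0"
  using coef assms unfolding coef_ok_def by auto

lemma coef_regular: "l \<in> {Suc p..r} \<Longrightarrow> (\<Sum>j\<in>Rset r par l. a1 l j / a l j) \<noteq> -1"
  using coef unfolding coef_ok_def by blast

lemma sol_edge: "sol lam Y \<Longrightarrow> j \<in> {1..r} \<Longrightarrow> edge_sol (q j) lam (Y j)"
  unfolding tree_sol_def by blast

lemma sol_value: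
  "sol lam Y \<Longrightarrow> l \<in> {Suc p..r} \<Longrightarrow> j \<in> Rset r par l \<Longrightarrow> Y l 0 = a l j * Y j 1"
  unfolding tree_sol_def by blast

lemma sol_deriv:
  "sol lam Y \<Longrightarrow> l \<in> {Suc p..r} \<Longrightarrow>
    D (Y l) 0 = (\<Sum>j\<in>Rset r par l. a1 l j * D (Y j) 1 + a0 l j * Y j 1)"
  unfolding tree_sol_def by blast

text \<open>Travel from the leaves towards the root. As \<open>A\<close> is closed under parents,
  the whole subtree beyond an edge outside \<open>A\<close> avoids \<open>A\<close>. At an internal
  vertex the ratios of the emanating edges have limit 1, so the next edge starts with the limit
  \<open>(\<Sum>i\<in>?R. a1 j i / a j i)\<close>, which regularity keeps away from -1; at a leaf
  the limit is 0.\<close>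

lemma branch_ratio:
  assumes "\<And>i. i \<in> A \<Longrightarrow> i \<noteq> 0 \<Longrightarrow> par i \<in> A" and "j \<in> {1..r}" "j \<notin> A"
  shows "\<exists>m C. ((\<lambda>\<tau>. m \<tau> / of_real \<tau>) \<longlongrightarrow> 1) at_top \<and>
    (\<forall>\<^sub>F \<tau> in at_top. \<forall>Y. branch_sol A \<tau> Y \<longrightarrow>
      D (Y j) 1 = m \<tau> * Y j 1 \<and> grows C \<tau> (Y j))"
  using assms(2,3)
\<comment> \<open>Leaves carry the lowest labels, whatever their parents; only internal labels grow
  away from the root. The measure therefore puts leaves first and then counts internal labels
  downwards.\<close>
proof (induction "if j \<le> p then 0 else Suc (r - j)" arbitrary: j rule: less_induct)
  case less
  note qj = q_integrable[OF less.prems(1)]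
  have "\<exists>\<kappa> s. ((\<lambda>\<tau>. \<kappa> \<tau> / of_real \<tau>) \<longlongrightarrow> s) at_top \<and> s \<noteq> -1 \<and>
    (\<forall>\<^sub>F \<tau> in at_top. \<forall>Y. branch_sol A \<tau> Y \<longrightarrow>
      D (Y j) 0 = \<kappa> \<tau> * Y j 0)"
  proof (cases "j \<le> p")
    case True
    then have j: "j \<in> {1..p} - A" using less.prems by auto
    show ?thesis
    proof (intro exI[of _ "\<lambda>\<tau>. - h j"] exI[of _ "0::complex"] conjI)
      show "\<forall>\<^sub>F \<tau> in at_top. \<forall>Y. branch_sol A \<tau> Y \<longrightarrow>
          D (Y j) 0 = - h j * Y j 0"
        using j by (intro always_eventually) (auto simp: U0_def add_eq_0_iff2)
    qed (rule const_over_tau, simp)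
  next
    case False
    then have j: "j \<in> {Suc p..r}" using less.prems by auto
    let ?R = "Rset r par j"
    have "\<forall>i\<in>?R. \<exists>m. ((\<lambda>\<tau>. m \<tau> / of_real \<tau>) \<longlongrightarrow> (1::complex)) at_top \<and>
      (\<forall>\<^sub>F \<tau> in at_top. \<forall>Y. branch_sol A \<tau> Y \<longrightarrow>
        D (Y i) 1 = m \<tau> * Y i 1)"
    proof
      fix i assume i: "i \<in> ?R"
      then have i': "i \<in> {1..r}" "par i = j" by (auto simp: Rset_iff)
      have "i \<notin> A" using assms(1)[of i] i' less.prems by auto
      have "(if i \<le> p then 0 else Suc (r - i)) < (if j \<le> p then 0 else Suc (r - j))"
        using par_less[of i] i' j by auto
      from less.hyps[OF this i'(1) \<open>i \<notin> A\<close>] obtain m C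
        where m: "((\<lambda>\<tau>. m \<tau> / of_real \<tau>) \<longlongrightarrow> (1::complex)) at_top"
        and ev: "\<forall>\<^sub>F \<tau> in at_top. \<forall>Y. branch_sol A \<tau> Y \<longrightarrow>
          D (Y i) 1 = m \<tau> * Y i 1 \<and> grows C \<tau> (Y i)"
        by blast
      from ev have "\<forall>\<^sub>F \<tau> in at_top. \<forall>Y. branch_sol A \<tau> Y \<longrightarrow>
          D (Y i) 1 = m \<tau> * Y i 1"
        by (rule eventually_mono) blast
      with m show "\<exists>m. ((\<lambda>\<tau>. m \<tau> / of_real \<tau>) \<longlongrightarrow> (1::complex)) at_top \<and>
        (\<forall>\<^sub>F \<tau> in at_top. \<forall>Y. branch_sol A \<tau> Y \<longrightarrow>
          D (Y i) 1 = m \<tau> * Y i 1)"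
        by blast
    qed
    then obtain m where m: "\<And>i. i \<in> ?R \<Longrightarrow> ((\<lambda>\<tau>. m i \<tau> / of_real \<tau>) \<longlongrightarrow> (1::complex)) at_top"
      and ev: "\<And>i. i \<in> ?R \<Longrightarrow> \<forall>\<^sub>F \<tau> in at_top. \<forall>Y. branch_sol A \<tau> Y \<longrightarrow> D (Y i) 1 = m i \<tau> * Y i 1"
      unfolding bchoice_iff by blast
    \<comment> \<open>The derivative condition at the vertex, with each \<open>Y i 1\<close>
      replaced by \<open>Y j 0 / a j i\<close>.\<close>
    define \<kappa> where "\<kappa> \<tau> = (\<Sum>i\<in>?R. (a1 j i * m i \<tau> + a0 j i) / a j i)" for \<tau>
    have "((\<lambda>\<tau>. \<Sum>i\<in>?R. (a1 j i * (m i \<tau> / of_real \<tau>) + a0 j i / of_real \<tau>) / a j i) \<longlongrightarrow>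
        (\<Sum>i\<in>?R. (a1 j i * 1 + 0) / a j i)) at_top"
      using coef_nonzero[OF j] by (intro tendsto_intros m const_over_tau) auto
    moreover have "(\<lambda>\<tau>. \<Sum>i\<in>?R. (a1 j i * (m i \<tau> / of_real \<tau>) + a0 j i / of_real \<tau>) / a j i) = (\<lambda>\<tau>. \<kappa> \<tau> / of_real \<tau>)"
      unfolding \<kappa>_def sum_divide_distrib by (rule ext, rule sum.cong) (auto simp: add_divide_distrib mult.commute)
    ultimately have \<kappa>: "((\<lambda>\<tau>. \<kappa> \<tau> / of_real \<tau>) \<longlongrightarrow> (\<Sum>i\<in>?R. a1 j i / a j i)) at_top" by simp
    have "\<forall>\<^sub>F \<tau> in at_top. \<forall>i\<in>?R. \<forall>Y. branch_sol A \<tau> Y \<longrightarrow> D (Y i) 1 = m i \<tau> * Y i 1"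
      using ev finite_Rset by (intro eventually_ball_finite) auto
    then have "\<forall>\<^sub>F \<tau> in at_top. \<forall>Y. branch_sol A \<tau> Y \<longrightarrow>
      D (Y j) 0 = \<kappa> \<tau> * Y j 0"
    proof eventually_elim
      case (elim \<tau>)
      show ?case
      proof (intro allI impI)
        fix Y assume Y: "branch_sol A \<tau> Y"
        have "D (Y j) 0 = (\<Sum>i\<in>?R. a1 j i * D (Y i) 1 + a0 j i * Y i 1)"
          using sol_deriv Y j by blast
        also have "\<dots> = (\<Sum>i\<in>?R. (a1 j i * m i \<tau> + a0 j i) / a j i * Y j 0)"
        proof (rule sum.cong)
          fix i assume i: "i \<in> ?R"
          have "D (Y i) 1 = m i \<tau> * Y i 1" using elim i Y by blast
          moreover have "Y j 0 = a j i * Y i 1" using sol_value Y j i by blast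
          ultimately show "a1 j i * D (Y i) 1 + a0 j i * Y i 1 = (a1 j i * m i \<tau> + a0 j i) / a j i * Y j 0"
            using coef_nonzero[OF j i] by (simp add: field_simps)
        qed simp
        finally show "D (Y j) 0 = \<kappa> \<tau> * Y j 0" by (simp add: \<kappa>_def sum_distrib_right)
      qed
    qed
    with \<kappa> coef_regular[OF j] show ?thesis by blast
  qed
  then obtain \<kappa> s where \<kappa>: "((\<lambda>\<tau>. \<kappa> \<tau> / of_real \<tau>) \<longlongrightarrow> s) at_top" "s \<noteq> -1"
    and ev: "\<forall>\<^sub>F \<tau> in at_top. \<forall>Y. branch_sol A \<tau> Y \<longrightarrow>
      D (Y j) 0 = \<kappa> \<tau> * Y j 0" by blast
  obtain m C where m: "((\<lambda>\<tau>. m \<tau> / of_real \<tau>) \<longlongrightarrow> 1) at_top"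
    and ev2: "\<forall>\<^sub>F \<tau> in at_top. \<forall>y. edge_sol (q j) (- (of_real \<tau>)\<^sup>2) y \<and> D y 0 = \<kappa> \<tau> * y 0 \<longrightarrow>
      D y 1 = m \<tau> * y 1 \<and> grows C \<tau> y"
    using edge_growth[OF qj \<kappa>] by blast
  show ?case
  proof (intro exI conjI)
    show "\<forall>\<^sub>F \<tau> in at_top. \<forall>Y. branch_sol A \<tau> Y \<longrightarrow>
      D (Y j) 1 = m \<tau> * Y j 1 \<and> grows C \<tau> (Y j)"
      using ev ev2
    proof eventually_elim
      case (elim \<tau>)
      show ?case
      proof (intro allI impI)
        fix Y assume Y: "branch_sol A \<tau> Y"
        have "edge_sol (q j) (- (of_real \<tau>)\<^sup>2) (Y j)" "D (Y j) 0 = \<kappa> \<tau> * Y j 0"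
          using Y elim sol_edge less.prems(1) by blast+
        then show "D (Y j) 1 = m \<tau> * Y j 1 \<and> grows C \<tau> (Y j)"
          using elim(2) by blast
      qed
    qed
  qed (rule m)
qed

section \<open>The path from the distinguished boundary vertex to the root\<close>

text \<open>The value of \<^term>\<open>par\<close> at the root \<open>0\<close> is arbitrary, hence the guard.\<close>

definition up :: "nat \<Rightarrow> nat" where "up j = (if j = 0 then 0 else par j)"

text \<open>The labels met when climbing from \<open>v\<^sub>k\<close>, read both as vertices and as
  the edges ending in them.\<close>

definition path :: "nat set" where "path = range (\<lambda>n. (up ^^ n) k)"

lemma k_mem: "k \<in> {1..r}"
  using k p_less by auto

lemma k_in_path: "k \<in> path"
  unfolding path_def by (rule range_eqI[of _ _ 0]) simp

lemma path_par: "i \<in> path \<Longrightarrow> i \<noteq> 0 \<Longrightarrow> par i \<in> path"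
proof -
  assume "i \<in> path" "i \<noteq> 0"
  then obtain n where n: "i = (up ^^ n) k" unfolding path_def by auto
  have "par i = (up ^^ Suc n) k" using \<open>i \<noteq> 0\<close> by (simp add: n[symmetric] up_def)
  then show "par i \<in> path" unfolding path_def by blast
qed

lemma up_iter_le:
  assumes "l \<in> {Suc p..r} \<or> l = 0"
  shows "((up ^^ n) l \<in> {Suc p..r} \<or> (up ^^ n) l = 0) \<and> (up ^^ n) l \<le> l"
proof (induction n)
  case (Suc n)
  let ?x = "(up ^^ n) l"
  show ?case
  proof (cases "?x = 0")
    case True
    have "up 0 = 0" by (simp add: up_def)
    with True show ?thesis by simp
  next
    case False
    then have x: "?x \<in> {Suc p..r}" "?x \<le> l" using Suc by auto
    then have "up ?x = par ?x" "par ?x < ?x" using par_less by (auto simp: up_def)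
    moreover have "par ?x \<in> {Suc p..r} \<or> par ?x = 0"
      using par_mem[of ?x] par_root x by (cases "?x = Suc p") auto
    ultimately show ?thesis using x by simp
  qed
qed (use assms in simp)

text \<open>Climbing never increases internal labels. After passing from one edge to its initial
  vertex \<open>l\<close>, all later labels are at most \<open>l\<close>, whereas an edge emanating
  from \<open>l\<close> and ending at an internal vertex has a larger label.\<close>

lemma path_siblings:
  assumes "i \<in> path" "j \<in> path" "i \<in> Rset r par l" "j \<in> Rset r par l" "l \<in> {Suc p..r}"
  shows "i = j"
proof -
  have *: False if "i = (up ^^ m) k" "j = (up ^^ n) k" "m < n" "i \<in> Rset r par l" "j \<in> Rset r par l" for i j m n
  proof -
    have ij: "i \<noteq> 0" "par i = l" "j \<noteq> 0" "par j = l" using that by (auto simp: Rset_iff)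
    obtain d where d: "n = d + Suc m" using \<open>m < n\<close> less_iff_Suc_add by auto
    have "j = (up ^^ d) (up i)" using that by (simp add: d funpow_add funpow_swap1)
    then have "j = (up ^^ d) l" using ij by (simp add: up_def)
    with up_iter_le[of l d] assms(5) ij have "j \<in> {Suc p..r}" "j \<le> l" by auto
    with par_less[of j] ij show False by simp
  qed
  obtain m n where "i = (up ^^ m) k" "j = (up ^^ n) k" using assms unfolding path_def by auto
  then show ?thesis using *[of i m j n] *[of j n i m] assms by (metis linorder_neqE_nat)
qed

text \<open>Travel from the root towards \<open>v\<^sub>k\<close>. At each vertex the incoming path
  edge has limiting ratio -1 and the side branches have limiting ratio 1, so the matching conditions
  can be solved for the ratio on the next path edge; regularity says exactly that its limit differs
  from 1, and \<open>edge_decay\<close> applies.\<close>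

lemma path_ratio:
  assumes "j \<in> {1..r}" "j \<in> path"
  shows "\<exists>m C. ((\<lambda>\<tau>. m \<tau> / of_real \<tau>) \<longlongrightarrow> -1) at_top \<and>
    (\<forall>\<^sub>F \<tau> in at_top. \<forall>Y. path_sol \<tau> Y \<longrightarrow>
      D (Y j) 0 = m \<tau> * Y j 0 \<and> decays C \<tau> (Y j))"
  using assms
\<comment> \<open>Internal labels decrease towards the root, so they serve as measure; leaves are
  moved behind all of them.\<close>
proof (induction "if j \<le> p then Suc r else j" arbitrary: j rule: less_induct)
  case less
  note qj = q_integrable[OF less.prems(1)]
  have "\<exists>\<kappa> s. ((\<lambda>\<tau>. \<kappa> \<tau> / of_real \<tau>) \<longlongrightarrow> s) at_top \<and> s \<noteq> 1 \<and>
    (\<forall>\<^sub>F \<tau> in at_top. \<forall>Y. path_sol \<tau> Y \<longrightarrow>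
      D (Y j) 1 = \<kappa> \<tau> * Y j 1)"
  proof (cases "j = Suc p")
    case True
    have "0 \<noteq> k" using k by auto
    show ?thesis
    proof (intro exI[of _ "\<lambda>\<tau>. - h 0"] exI[of _ "0::complex"] conjI)
      have "D (Y j) 1 = - h 0 * Y j 1" if "\<forall>i\<le>p. i \<noteq> k \<longrightarrow> U0 p h Y i = 0" for Y
      proof -
        have "U0 p h Y 0 = 0" using that \<open>0 \<noteq> k\<close> by blast
        then show ?thesis by (simp add: U0_def True add_eq_0_iff2)
      qed
      then show "\<forall>\<^sub>F \<tau> in at_top. \<forall>Y. path_sol \<tau> Y \<longrightarrow>
          D (Y j) 1 = - h 0 * Y j 1"
        by (intro always_eventually) blast
    qed (rule const_over_tau, simp)
  next
    case False
    define l where "l = par j"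
    have l: "l \<in> {Suc p..r}" unfolding l_def by (rule par_mem[OF less.prems(1) False])
    then have l': "l \<in> {1..r}" "\<not> l \<le> p" by auto
    have jl: "j \<in> Rset r par l" using less.prems by (simp add: Rset_iff l_def)
    have "l \<in> path" unfolding l_def using path_par less.prems by auto
    have "(if l \<le> p then Suc r else l) < (if j \<le> p then Suc r else j)"
      using par_less[of j] less.prems l unfolding l_def by auto
    from less.hyps[OF this l'(1) \<open>l \<in> path\<close>] obtain n C
      where n: "((\<lambda>\<tau>. n \<tau> / of_real \<tau>) \<longlongrightarrow> (-1::complex)) at_top"
      and evn: "\<forall>\<^sub>F \<tau> in at_top. \<forall>Y. path_sol \<tau> Y \<longrightarrow>
        D (Y l) 0 = n \<tau> * Y l 0 \<and> decays C \<tau> (Y l)"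
      by blast
    define S where "S = Rset r par l - {j}"
    have finS: "finite S" using finite_Rset by (simp add: S_def)
    have "\<forall>i\<in>S. \<exists>m. ((\<lambda>\<tau>. m \<tau> / of_real \<tau>) \<longlongrightarrow> (1::complex)) at_top \<and>
      (\<forall>\<^sub>F \<tau> in at_top. \<forall>Y. branch_sol path \<tau> Y \<longrightarrow>
        D (Y i) 1 = m \<tau> * Y i 1)"
    proof
      fix i assume i: "i \<in> S"
      then have iR: "i \<in> Rset r par l" "i \<noteq> j" by (auto simp: S_def)
      then have i': "i \<in> {1..r}" by (auto simp: Rset_iff)
      have "i \<notin> path" using path_siblings[OF _ less.prems(2) iR(1) jl l] iR(2) by blast
      from branch_ratio[of path, OF path_par i' this] obtain m C
        where m: "((\<lambda>\<tau>. m \<tau> / of_real \<tau>) \<longlongrightarrow> (1::complex)) at_top"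
        and ev: "\<forall>\<^sub>F \<tau> in at_top. \<forall>Y. branch_sol path \<tau> Y \<longrightarrow>
          D (Y i) 1 = m \<tau> * Y i 1 \<and> grows C \<tau> (Y i)"
        by blast
      from ev have "\<forall>\<^sub>F \<tau> in at_top. \<forall>Y. branch_sol path \<tau> Y \<longrightarrow>
          D (Y i) 1 = m \<tau> * Y i 1"
        by (rule eventually_mono) blast
      with m show "\<exists>m. ((\<lambda>\<tau>. m \<tau> / of_real \<tau>) \<longlongrightarrow> (1::complex)) at_top \<and>
        (\<forall>\<^sub>F \<tau> in at_top. \<forall>Y. branch_sol path \<tau> Y \<longrightarrow>
          D (Y i) 1 = m \<tau> * Y i 1)"
        by blast
    qed
    then obtain m where m: "\<And>i. i \<in> S \<Longrightarrow> ((\<lambda>\<tau>. m i \<tau> / of_real \<tau>) \<longlongrightarrow> (1::complex)) at_top"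
      and ev: "\<And>i. i \<in> S \<Longrightarrow> \<forall>\<^sub>F \<tau> in at_top. \<forall>Y. branch_sol path \<tau> Y \<longrightarrow> D (Y i) 1 = m i \<tau> * Y i 1"
      unfolding bchoice_iff by blast
    \<comment> \<open>The derivative condition at \<open>l\<close> solved for
      \<open>D (Y j) 1\<close>, after every other edge value has been expressed through
      \<open>Y l 0 = a l j * Y j 1\<close>.\<close>
    define \<kappa> where "\<kappa> \<tau> = (n \<tau> * a l j - a0 l j - (\<Sum>i\<in>S. (a1 l i * m i \<tau> + a0 l i) / a l i) * a l j) / a1 l j" for \<tau>
    have nzS: "a l i \<noteq> 0" if "i \<in> S" for i
      using coef_nonzero(1)[OF l] that by (auto simp: S_def)
    note nzj = coef_nonzero[OF l jl]
    let ?s = "((-1) * a l j - 0 - (\<Sum>i\<in>S. (a1 l i * 1 + 0) / a l i) * a l j) / a1 l j"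
    have "((\<lambda>\<tau>. (n \<tau> / of_real \<tau> * a l j - a0 l j / of_real \<tau> -
        (\<Sum>i\<in>S. (a1 l i * (m i \<tau> / of_real \<tau>) + a0 l i / of_real \<tau>) / a l i) * a l j) / a1 l j) \<longlongrightarrow> ?s) at_top"
      using nzS nzj by (intro tendsto_intros n m const_over_tau) auto
    moreover have "(\<lambda>\<tau>. (n \<tau> / of_real \<tau> * a l j - a0 l j / of_real \<tau> -
        (\<Sum>i\<in>S. (a1 l i * (m i \<tau> / of_real \<tau>) + a0 l i / of_real \<tau>) / a l i) * a l j) / a1 l j) = (\<lambda>\<tau>. \<kappa> \<tau> / of_real \<tau>)"
    proof (rule ext)
      fix \<tau> :: real
      have "(\<Sum>i\<in>S. (a1 l i * (m i \<tau> / of_real \<tau>) + a0 l i / of_real \<tau>) / a l i) =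
          (\<Sum>i\<in>S. (a1 l i * m i \<tau> + a0 l i) / a l i) / of_real \<tau>"
        unfolding sum_divide_distrib by (rule sum.cong) (auto simp: add_divide_distrib mult.commute)
      then show "(n \<tau> / of_real \<tau> * a l j - a0 l j / of_real \<tau> -
        (\<Sum>i\<in>S. (a1 l i * (m i \<tau> / of_real \<tau>) + a0 l i / of_real \<tau>) / a l i) * a l j) / a1 l j = \<kappa> \<tau> / of_real \<tau>"
        unfolding \<kappa>_def by (simp add: diff_divide_distrib mult.commute)
    qed
    ultimately have \<kappa>: "((\<lambda>\<tau>. \<kappa> \<tau> / of_real \<tau>) \<longlongrightarrow> ?s) at_top" by simp
    \<comment> \<open>Solving \<open>?s = 1\<close> for \<open>a1 l j / a l j\<close> and adding the
      other summands would give -1 for the sum over all edges emanating from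
      \<open>l\<close>.\<close>
    have s: "?s \<noteq> 1"
    proof
      assume "?s = 1"
      then have eq: "- a l j - (\<Sum>i\<in>S. a1 l i / a l i) * a l j = a1 l j"
        using nzj by (simp add: field_simps)
      have "(\<Sum>i\<in>Rset r par l. a1 l i / a l i) = a1 l j / a l j + (\<Sum>i\<in>S. a1 l i / a l i)"
        unfolding S_def by (rule sum.remove[OF finite_Rset jl])
      also have "a1 l j / a l j = -1 - (\<Sum>i\<in>S. a1 l i / a l i)"
        using nzj by (simp add: eq[symmetric] diff_divide_distrib)
      finally show False using coef_regular[OF l] by simp
    qed
    have "\<forall>\<^sub>F \<tau> in at_top. \<forall>i\<in>S. \<forall>Y. branch_sol path \<tau> Y \<longrightarrow> D (Y i) 1 = m i \<tau> * Y i 1"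
      using ev finS by (intro eventually_ball_finite) auto
    then have "\<forall>\<^sub>F \<tau> in at_top. \<forall>Y. path_sol \<tau> Y \<longrightarrow>
      D (Y j) 1 = \<kappa> \<tau> * Y j 1"
      using evn
    proof eventually_elim
      case (elim \<tau>)
      show ?case
      proof (intro allI impI)
        fix Y assume Y: "path_sol \<tau> Y"
        then have Y': "\<forall>i\<in>{1..p} - path. U0 p h Y i = 0" using k_in_path by auto
        have vl: "Y l 0 = a l i * Y i 1" if "i \<in> Rset r par l" for i
          using sol_value Y l that by blast
        have "n \<tau> * Y l 0 = D (Y l) 0" using elim(2) Y by simp
        also have "\<dots> = (\<Sum>i\<in>Rset r par l. a1 l i * D (Y i) 1 + a0 l i * Y i 1)"
          using sol_deriv Y l by blast
        also have "\<dots> = a1 l j * D (Y j) 1 + a0 l j * Y j 1 + (\<Sum>i\<in>S. a1 l i * D (Y i) 1 + a0 l i * Y i 1)"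
          unfolding S_def by (rule sum.remove[OF finite_Rset jl])
        also have "(\<Sum>i\<in>S. a1 l i * D (Y i) 1 + a0 l i * Y i 1) = (\<Sum>i\<in>S. (a1 l i * m i \<tau> + a0 l i) / a l i * Y l 0)"
        proof (rule sum.cong)
          fix i assume i: "i \<in> S"
          have "D (Y i) 1 = m i \<tau> * Y i 1" using elim(1) i Y Y' by blast
          moreover have "Y l 0 = a l i * Y i 1" using vl i by (simp add: S_def)
          ultimately show "a1 l i * D (Y i) 1 + a0 l i * Y i 1 = (a1 l i * m i \<tau> + a0 l i) / a l i * Y l 0"
            using nzS[OF i] by (simp add: field_simps)
        qed simp
        also have "\<dots> = (\<Sum>i\<in>S. (a1 l i * m i \<tau> + a0 l i) / a l i) * Y l 0"
          by (rule sum_distrib_right[symmetric])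
        finally show "D (Y j) 1 = \<kappa> \<tau> * Y j 1"
          unfolding vl[OF jl] \<kappa>_def using nzj by (simp add: field_simps)
      qed
    qed
    with \<kappa> s show ?thesis by blast
  qed
  then obtain \<kappa> s where \<kappa>: "((\<lambda>\<tau>. \<kappa> \<tau> / of_real \<tau>) \<longlongrightarrow> s) at_top" "s \<noteq> 1"
    and ev: "\<forall>\<^sub>F \<tau> in at_top. \<forall>Y. path_sol \<tau> Y \<longrightarrow>
      D (Y j) 1 = \<kappa> \<tau> * Y j 1" by blast
  obtain m C where m: "((\<lambda>\<tau>. m \<tau> / of_real \<tau>) \<longlongrightarrow> -1) at_top"
    and ev2: "\<forall>\<^sub>F \<tau> in at_top. \<forall>y. edge_sol (q j) (- (of_real \<tau>)\<^sup>2) y \<and> D y 1 = \<kappa> \<tau> * y 1 \<longrightarrow>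
      D y 0 = m \<tau> * y 0 \<and> decays C \<tau> y"
    using edge_decay[OF qj \<kappa>] by blast
  show ?case
  proof (intro exI conjI)
    show "\<forall>\<^sub>F \<tau> in at_top. \<forall>Y. path_sol \<tau> Y \<longrightarrow>
      D (Y j) 0 = m \<tau> * Y j 0 \<and> decays C \<tau> (Y j)"
      using ev ev2
    proof eventually_elim
      case (elim \<tau>)
      show ?case
      proof (intro allI impI)
        fix Y assume Y: "path_sol \<tau> Y"
        have "edge_sol (q j) (- (of_real \<tau>)\<^sup>2) (Y j)" "D (Y j) 1 = \<kappa> \<tau> * Y j 1"
          using Y elim sol_edge less.prems(1) by blast+
        then show "D (Y j) 0 = m \<tau> * Y j 0 \<and> decays C \<tau> (Y j)"
          using elim(2) by blast
      qed
    qed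
  qed (rule m)
qed

section \<open>Solvability of the boundary value problem on the tree\<close>

lemma U0_lincomb:
  assumes "sol lam Y" "sol lam Z" "j \<le> p"
  shows "U0 p h (\<lambda>j x. c * Y j x + d * Z j x) j = c * U0 p h Y j + d * U0 p h Z j"
proof (cases "j = 0")
  case True
  have "D (\<lambda>x. c * Y (Suc p) x + d * Z (Suc p) x) 1 = c * D (Y (Suc p)) 1 + d * D (Z (Suc p)) 1"
    using assms Suc_p_mem by (intro edge_sol_lincomb(2)) (auto intro: sol_edge)
  then show ?thesis using True by (simp add: U0_def algebra_simps)
next
  case False
  then have "j \<in> {1..r}" using assms p_less by auto
  then have "D (\<lambda>x. c * Y j x + d * Z j x) 0 = c * D (Y j) 0 + d * D (Z j) 0"
    using assms by (intro edge_sol_lincomb(2)) (auto intro: sol_edge)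
  then show ?thesis using False by (simp add: U0_def algebra_simps)
qed

lemma sol_lincomb:
  assumes Y: "sol lam Y" and Z: "sol lam Z"
  shows "sol lam (\<lambda>j x. c * Y j x + d * Z j x)"
  unfolding tree_sol_def
proof (intro conjI ballI)
  show "edge_sol (q j) lam (\<lambda>x. c * Y j x + d * Z j x)" if "j \<in> {1..r}" for j
    by (intro edge_sol_lincomb(1) sol_edge[OF Y that] sol_edge[OF Z that])
  fix l assume l: "l \<in> {Suc p..r}"
  show "c * Y l 0 + d * Z l 0 = a l j * (c * Y j 1 + d * Z j 1)" if "j \<in> Rset r par l" for j
    using sol_value[OF Y l that] sol_value[OF Z l that] by (simp add: algebra_simps)
  have Dl: "D (\<lambda>x. c * Y j x + d * Z j x) x = c * D (Y j) x + d * D (Z j) x"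
    if "j \<in> {1..r}" "x \<in> {0..1}" for j x
    by (rule edge_sol_lincomb(2)[OF sol_edge[OF Y that(1)] sol_edge[OF Z that(1)] that(2)])
  have "D (\<lambda>x. c * Y l x + d * Z l x) 0 = c * D (Y l) 0 + d * D (Z l) 0"
    using l by (intro Dl) auto
  also have "\<dots> = (\<Sum>j\<in>Rset r par l. c * (a1 l j * D (Y j) 1 + a0 l j * Y j 1) + d * (a1 l j * D (Z j) 1 + a0 l j * Z j 1))"
    unfolding sol_deriv[OF Y l] sol_deriv[OF Z l] by (simp only: sum_distrib_left sum.distrib[symmetric])
  also have "\<dots> = (\<Sum>j\<in>Rset r par l. a1 l j * D (\<lambda>x. c * Y j x + d * Z j x) 1 + a0 l j * (c * Y j 1 + d * Z j 1))"
  proof (rule sum.cong)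
    fix j assume "j \<in> Rset r par l"
    then have "D (\<lambda>x. c * Y j x + d * Z j x) 1 = c * D (Y j) 1 + d * D (Z j) 1"
      by (intro Dl) (auto simp: Rset_iff)
    then show "c * (a1 l j * D (Y j) 1 + a0 l j * Y j 1) + d * (a1 l j * D (Z j) 1 + a0 l j * Z j 1) =
      a1 l j * D (\<lambda>x. c * Y j x + d * Z j x) 1 + a0 l j * (c * Y j 1 + d * Z j 1)"
      by (simp add: algebra_simps)
  qed simp
  finally show "D (\<lambda>x. c * Y l x + d * Z l x) 0 =
    (\<Sum>j\<in>Rset r par l. a1 l j * D (\<lambda>x. c * Y j x + d * Z j x) 1 + a0 l j * (c * Y j 1 + d * Z j 1))" .
qed

text \<open>The negation of \<open>eigenvalue_B\<close>, written in the form in which it is applied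
  to a given solution.\<close>

definition regular :: "complex \<Rightarrow> bool" where
  "regular lam \<longleftrightarrow> (\<forall>Y. sol lam Y \<and> (\<forall>j\<le>p. U0 p h Y j = 0) \<longrightarrow> (\<forall>j\<in>{1..r}. \<forall>x\<in>{0..1}. Y j x = 0))"

text \<open>With no edge excluded, the ratio at the root is asymptotic to \<tau>, which contradicts
  the root condition unless the solution vanishes there. By \<open>grows\<close> it then vanishes on
  the root edge, and the value matching carries this from each edge to those emanating from its
  end.\<close>

lemma eventually_regular: "\<forall>\<^sub>F \<tau> in at_top. regular (- (of_real \<tau>)\<^sup>2)"
proof -
  have "\<forall>j\<in>{1..r}. \<exists>m C. ((\<lambda>\<tau>. m \<tau> / of_real \<tau>) \<longlongrightarrow> (1::complex)) at_top \<and>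
    (\<forall>\<^sub>F \<tau> in at_top. \<forall>Y. branch_sol {} \<tau> Y \<longrightarrow>
      D (Y j) 1 = m \<tau> * Y j 1 \<and> grows C \<tau> (Y j))"
    by (intro ballI branch_ratio) auto
  then obtain m C where m: "\<And>j. j \<in> {1..r} \<Longrightarrow> ((\<lambda>\<tau>. m j \<tau> / of_real \<tau>) \<longlongrightarrow> (1::complex)) at_top"
    and ev: "\<And>j. j \<in> {1..r} \<Longrightarrow> \<forall>\<^sub>F \<tau> in at_top. \<forall>Y. branch_sol {} \<tau> Y \<longrightarrow>
      D (Y j) 1 = m j \<tau> * Y j 1 \<and> grows (C j) \<tau> (Y j)"
    unfolding bchoice_iff by blast
  \<comment> \<open>The root condition reads
    \<open>(m (Suc p) \<tau> + h 0) * Y (Suc p) 1 = 0\<close>; divided by \<tau>, the first factor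
    has limit 1.\<close>
  have "((\<lambda>\<tau>. m (Suc p) \<tau> / of_real \<tau> + h 0 / of_real \<tau>) \<longlongrightarrow> 1 + 0) at_top"
    by (intro tendsto_add m Suc_p_mem const_over_tau)
  then have "\<forall>\<^sub>F \<tau> in at_top. m (Suc p) \<tau> / of_real \<tau> + h 0 / of_real \<tau> \<noteq> 0"
    by (rule tendsto_imp_eventually_ne) simp
  moreover have "\<forall>\<^sub>F \<tau> in at_top. \<forall>j\<in>{1..r}. \<forall>Y. branch_sol {} \<tau> Y \<longrightarrow>
      D (Y j) 1 = m j \<tau> * Y j 1 \<and> grows (C j) \<tau> (Y j)"
    using ev by (intro eventually_ball_finite) auto
  ultimately show ?thesis
  proof eventually_elim
    case (elim \<tau>)
    have "Y j 1 = 0 \<and> (\<forall>x\<in>{0..1}. Y j x = 0)"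
      if Y: "sol (- (of_real \<tau>)\<^sup>2) Y" "\<forall>j\<le>p. U0 p h Y j = 0" and j: "j \<in> {1..r}" for Y j
      using j
    proof (induction "if j \<le> p then Suc r else j" arbitrary: j rule: less_induct)
      case less
      have Yj: "D (Y j) 1 = m j \<tau> * Y j 1" "\<forall>x\<in>{0..1}. norm (Y j x) \<le> C j * exp (\<tau> * (x - 1)) * norm (Y j 1)"
        using elim(2) less.prems Y by auto
      have "Y j 1 = 0"
      proof (cases "j = Suc p")
        case True
        have "D (Y j) 1 + h 0 * Y j 1 = 0"
          using Y(2)[rule_format, of 0] True by (simp add: U0_def)
        then have "(m j \<tau> + h 0) * Y j 1 = 0" unfolding Yj(1) by (simp add: distrib_right)
        moreover have "m j \<tau> + h 0 \<noteq> 0" using elim(1) True by (auto simp: add_divide_distrib[symmetric])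
        ultimately show ?thesis by simp
      next
        case False
        let ?l = "par j"
        have l: "?l \<in> {Suc p..r}" by (rule par_mem[OF less.prems False])
        then have l': "?l \<in> {1..r}" by auto
        have jl: "j \<in> Rset r par ?l" using less.prems by (simp add: Rset_iff)
        have "(if ?l \<le> p then Suc r else ?l) < (if j \<le> p then Suc r else j)"
          using par_less[of j] less.prems l by auto
        from less.hyps[OF this l'] have "Y ?l 0 = 0" by simp
        then show ?thesis using sol_value[OF Y(1) l jl] coef_nonzero[OF l jl] by simp
      qed
      then show ?case using Yj(2) by simp
    qed
    then show ?case unfolding regular_def by blast
  qed
qed

lemma regular_not_eigenvalue: "regular lam \<Longrightarrow> \<not> eigenvalue_B r p par a a1 a0 q h lam"
proof
  assume reg: "regular lam" and "eigenvalue_B r p par a a1 a0 q h lam"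
  then obtain Y where "sol lam Y \<and> (\<forall>j\<le>p. U0 p h Y j = 0)" "\<exists>j\<in>{1..r}. \<exists>x\<in>{0..1}. Y j x \<noteq> 0"
    unfolding eigenvalue_B_def by (elim exE conjE) simp
  moreover from this(1) have "\<forall>j\<in>{1..r}. \<forall>x\<in>{0..1}. Y j x = 0"
    using reg unfolding regular_def by simp
  ultimately show False by simp
qed

text \<open>Writing each component through its Cauchy data at \<open>x = 0\<close>, the matching and boundary
  conditions become a linear system with two unknowns and two equations per edge.\<close>

lemma weyl_solution_exists:
  assumes reg: "regular lam"
  shows "\<exists>Psi. weyl_solution r p par a a1 a0 q h k lam Psi"
proof -
  \<comment> \<open>The label \<open>True\<close> marks the unknown value and \<open>False\<close>
    the unknown derivative at the end point of an edge.\<close>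
  define I where "I = {1..r} \<times> (UNIV::bool set)"
  define Y where "Y c j x = c (j, True) * schr_sol (q j) 1 0 lam x + c (j, False) * schr_sol (q j) 0 1 lam x"
    for c :: "nat \<times> bool \<Rightarrow> complex" and j x
  have basis: "edge_sol (q j) lam (schr_sol (q j) A B lam)" "schr_sol (q j) A B lam 0 = A"
    "D (schr_sol (q j) A B lam) 0 = B" if "j \<in> {1..r}" for j A B
    using edge_sol_schr_sol[OF q_integrable[OF that]] by auto
  have Yedge: "edge_sol (q j) lam (Y c j)" if "j \<in> {1..r}" for c j
    unfolding Y_def by (intro edge_sol_lincomb(1) basis that)
  have DY: "D (Y c j) x = c (j, True) * D (schr_sol (q j) 1 0 lam) x + c (j, False) * D (schr_sol (q j) 0 1 lam) x"
    if "j \<in> {1..r}" "x \<in> {0..1}" for c j x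
    unfolding Y_def by (rule edge_sol_lincomb(2)[OF basis(1)[OF that(1)] basis(1)[OF that(1)] that(2)])
  have Y0: "Y c j 0 = c (j, True)" and DY0: "D (Y c j) 0 = c (j, False)" if "j \<in> {1..r}" for c j
    using basis[OF that] DY[OF that, of 0 c] by (auto simp: Y_def)
  define Sg where "Sg c j = (\<Sum>i\<in>Rset r par j. a1 j i * D (Y c i) 1 + a0 j i * Y c i 1)" for c j
  \<comment> \<open>Equations have the same labels as unknowns: \<open>True\<close> is the condition
    at the end point of the edge (boundary form or derivative matching), \<open>False\<close> the
    one at its initial point (root form or value matching).\<close>
  define F where "F c i = (case i of (j, b) \<Rightarrow>
      if b then (if j \<le> p then U0 p h (Y c) j
        else D (Y c j) 0 - Sg c j)
      else (if j = Suc p then U0 p h (Y c) 0 else Y c (par j) 0 - a (par j) j * Y c j 1))" for c i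
  \<comment> \<open>The case \<open>e = 0\<close> gives injectivity through regularity, the case
    \<open>e = 1\<close> gives the Weyl solution.\<close>
  have conv: "sol lam (Y c) \<and> (\<forall>j\<le>p. U0 p h (Y c) j = (if j = k then e else 0))"
    if F: "\<And>i. i \<in> I \<Longrightarrow> F c i = (if i = (k, True) then e else 0)" for c e
  proof -
    have "sol lam (Y c)"
      unfolding tree_sol_def
    proof (intro conjI ballI)
      show "edge_sol (q j) lam (Y c j)" if "j \<in> {1..r}" for j by (rule Yedge[OF that])
      fix l assume l: "l \<in> {Suc p..r}"
      then have "(l, True) \<in> I" "l \<noteq> k" using k by (auto simp: I_def)
      from F[OF this(1)] this(2) l
      show "D (Y c l) 0 = (\<Sum>j\<in>Rset r par l. a1 l j * D (Y c j) 1 + a0 l j * Y c j 1)"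
        by (simp add: F_def Sg_def)
      fix j assume j: "j \<in> Rset r par l"
      then have "(j, False) \<in> I" "par j = l" by (auto simp: I_def Rset_iff)
      moreover have "j \<noteq> Suc p" using j l par_root by (auto simp: Rset_iff)
      ultimately show "Y c l 0 = a l j * Y c j 1"
        using F[of "(j, False)"] by (simp add: F_def)
    qed
    moreover have "U0 p h (Y c) j = (if j = k then e else 0)" if "j \<le> p" for j
    proof (cases "j = 0")
      case True
      have "(Suc p, False) \<in> I" using Suc_p_mem by (auto simp: I_def)
      then show ?thesis using F[of "(Suc p, False)"] True k by (simp add: F_def)
    next
      case False
      then have "(j, True) \<in> I" using that p_less by (auto simp: I_def)
      then show ?thesis using F[of "(j, True)"] that by (simp add: F_def)
    qed
    ultimately show ?thesis by blast
  qed
  define lc where "lc x c d = (\<lambda>j. x * c j + d j)" for x and c d :: "nat \<times> bool \<Rightarrow> complex"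
  have Ylin: "Y (lc x c d) j t = x * Y c j t + Y d j t" for x c d j t
    by (simp add: Y_def lc_def algebra_simps)
  have DYlin: "D (Y (lc x c d) j) t = x * D (Y c j) t + D (Y d j) t"
    if "j \<in> {1..r}" "t \<in> {0..1}" for x c d j t
    by (simp add: DY[OF that] lc_def algebra_simps)
  have Ulin: "U0 p h (Y (lc x c d)) j = x * U0 p h (Y c) j + U0 p h (Y d) j" if "j \<le> p" for x c d j
  proof (cases "j = 0")
    case True
    then show ?thesis using DYlin[OF Suc_p_mem, of 1 x c d] by (simp add: U0_def Ylin algebra_simps)
  next
    case False
    then have "j \<in> {1..r}" using that p_less by auto
    then show ?thesis using False DYlin[of j 0 x c d] by (simp add: U0_def Ylin algebra_simps)
  qed
  have lin: "F (lc x c d) i = x * F c i + F d i" if "i \<in> I" for x c d i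
  proof -
    obtain j b where i: "i = (j, b)" "j \<in> {1..r}" using \<open>i \<in> I\<close> by (cases i) (auto simp: I_def)
    have S: "Sg (lc x c d) j = x * Sg c j + Sg d j"
      unfolding Sg_def sum_distrib_left sum.distrib[symmetric]
    proof (rule sum.cong)
      fix i assume "i \<in> Rset r par j"
      then have "i \<in> {1..r}" by (simp add: Rset_iff)
      then show "a1 j i * D (Y (lc x c d) i) 1 + a0 j i * Y (lc x c d) i 1 =
          x * (a1 j i * D (Y c i) 1 + a0 j i * Y c i 1) + (a1 j i * D (Y d i) 1 + a0 j i * Y d i 1)"
        using DYlin[of i 1 x c d] by (simp add: Ylin algebra_simps)
    qed simp
    show ?thesis
      using DYlin[OF i(2), of 0 x c d] S
      by (cases "j = Suc p"; cases "j \<le> p"; cases b) (simp_all add: F_def i(1) Ulin Ylin algebra_simps)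
  qed
  have cong: "F c i = F d i" if "i \<in> I" "\<And>j. j \<in> I \<Longrightarrow> c j = d j" for c d i
  proof -
    have Ycd: "Y c j = Y d j" if "j \<in> {1..r}" for j
      using \<open>\<And>j. j \<in> I \<Longrightarrow> c j = d j\<close>[of "(j, True)"] \<open>\<And>j. j \<in> I \<Longrightarrow> c j = d j\<close>[of "(j, False)"] that
      by (auto simp: Y_def I_def)
    have U: "U0 p h (Y c) j = U0 p h (Y d) j" if "j \<le> p" for j
      using Ycd[of j] Ycd[OF Suc_p_mem] that p_less by (cases "j = 0") (auto simp: U0_def)
    obtain j b where i: "i = (j, b)" "j \<in> {1..r}" using \<open>i \<in> I\<close> by (cases i) (auto simp: I_def)
    have "Sg c j = Sg d j"
      unfolding Sg_def by (rule sum.cong) (auto simp: Rset_iff Ycd)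
    moreover have "Y c (par j) = Y d (par j)" if "j \<noteq> Suc p"
      using par_mem[OF i(2) that] by (intro Ycd) auto
    ultimately show ?thesis
      using Ycd[OF i(2)] U by (cases "j = Suc p"; cases "j \<le> p"; cases b) (simp_all add: F_def i(1))
  qed
  have inj: "c j = 0" if F0: "\<And>i. i \<in> I \<Longrightarrow> F c i = 0" and jI: "j \<in> I" for c j
  proof -
    have "sol lam (Y c) \<and> (\<forall>j\<le>p. U0 p h (Y c) j = 0)"
      using conv[of c 0] F0 by simp
    then have z: "Y c i x = 0" if "i \<in> {1..r}" "x \<in> {0..1}" for i x
      using reg that unfolding regular_def by blast
    obtain i b where i: "j = (i, b)" "i \<in> {1..r}" using jI by (cases j) (auto simp: I_def)
    have "(Y c i has_vector_derivative 0) (at 0 within {0..1})"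
      by (rule has_vector_derivative_transform[of 0 "{0..1}" _ "\<lambda>_. 0"]) (use z[OF i(2)] in auto)
    then have "D (Y c i) 0 = 0" by (rule D_eqI) simp
    then show ?thesis using z[OF i(2), of 0] Y0[OF i(2)] DY0[OF i(2)] i(1) by (cases b) auto
  qed
  have "finite I" by (simp add: I_def)
  then have "\<exists>c. \<forall>i\<in>I. F c i = (if i = (k, True) then 1 else 0)"
    by (rule linear_injective_imp_surjective_on_finite) (fact lin[unfolded lc_def] cong inj)+
  then obtain c where "\<forall>i\<in>I. F c i = (if i = (k, True) then 1 else 0)" by blast
  then have "sol lam (Y c) \<and> (\<forall>j\<le>p. U0 p h (Y c) j = (if j = k then 1 else 0))"
    by (intro conv) auto
  then show ?thesis unfolding weyl_solution_def by blast
qed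

text \<open>Two Weyl solutions differ by a solution of the homogeneous problem, so the definite
  description in \<open>weyl_fun\<close> has a unique referent.\<close>

lemma weyl_fun_eq:
  assumes reg: "regular lam" and Psi: "weyl_solution r p par a a1 a0 q h k lam Psi"
  shows "weyl_fun r p par a a1 a0 q h k lam = Psi k 0"
  unfolding weyl_fun_def
proof (rule the_equality)
  show "\<exists>Psi'. weyl_solution r p par a a1 a0 q h k lam Psi' \<and> Psi' k 0 = Psi k 0" using Psi by blast
  fix m assume "\<exists>Psi'. weyl_solution r p par a a1 a0 q h k lam Psi' \<and> Psi' k 0 = m"
  then obtain Psi' where Psi': "weyl_solution r p par a a1 a0 q h k lam Psi'" "Psi' k 0 = m" by blast
  let ?Y = "\<lambda>j x. 1 * Psi' j x + (-1) * Psi j x"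
  have s: "sol lam Psi'" "sol lam Psi" using Psi Psi' unfolding weyl_solution_def by auto
  have "sol lam ?Y" by (rule sol_lincomb[OF s])
  moreover have "U0 p h ?Y j = 0" if "j \<le> p" for j
    unfolding U0_lincomb[OF s that] using Psi Psi' that unfolding weyl_solution_def by simp
  ultimately have "?Y k 0 = 0" using reg k_mem unfolding regular_def by (auto simp del: mult_1)
  then show "m = Psi k 0" using Psi' by simp
qed

text \<open>Everything the recovery uses about the tree, reduced to the one edge
  \<open>e\<^sub>k\<close>; the function \<open>y\<close> is the component of the Weyl solution
  there.\<close>

lemma weyl_asymptotics:
  "\<exists>m C. ((\<lambda>\<tau>. m \<tau> / of_real \<tau>) \<longlongrightarrow> -1) at_top \<and>
    (\<forall>\<^sub>F \<tau> in at_top. \<not> eigenvalue_B r p par a a1 a0 q h (- (of_real \<tau>)\<^sup>2) \<and>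
      (\<exists>y. edge_sol (q k) (- (of_real \<tau>)\<^sup>2) y \<and> D y 0 + h k * y 0 = 1 \<and>
        y 0 = weyl_fun r p par a a1 a0 q h k (- (of_real \<tau>)\<^sup>2) \<and> D y 0 = m \<tau> * y 0 \<and>
        decays C \<tau> y))"
proof -
  obtain m C where m: "((\<lambda>\<tau>. m \<tau> / of_real \<tau>) \<longlongrightarrow> -1) at_top"
    and ev: "\<forall>\<^sub>F \<tau> in at_top. \<forall>Y. path_sol \<tau> Y \<longrightarrow>
      D (Y k) 0 = m \<tau> * Y k 0 \<and> decays C \<tau> (Y k)"
    using path_ratio[OF k_mem k_in_path] by blast
  have "\<forall>\<^sub>F \<tau> in at_top. \<not> eigenvalue_B r p par a a1 a0 q h (- (of_real \<tau>)\<^sup>2) \<and>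
      (\<exists>y. edge_sol (q k) (- (of_real \<tau>)\<^sup>2) y \<and> D y 0 + h k * y 0 = 1 \<and>
        y 0 = weyl_fun r p par a a1 a0 q h k (- (of_real \<tau>)\<^sup>2) \<and> D y 0 = m \<tau> * y 0 \<and>
        decays C \<tau> y)"
    using ev eventually_regular
  proof eventually_elim
    case (elim \<tau>)
    obtain Psi where Psi: "weyl_solution r p par a a1 a0 q h k (- (of_real \<tau>)\<^sup>2) Psi"
      using weyl_solution_exists[OF elim(2)] by blast
    then have s: "sol (- (of_real \<tau>)\<^sup>2) Psi" and U: "\<forall>j\<le>p. U0 p h Psi j = (if j = k then 1 else 0)"
      unfolding weyl_solution_def by auto
    have "D (Psi k) 0 + h k * Psi k 0 = 1" using U k by (auto simp: U0_def)
    moreover have "D (Psi k) 0 = m \<tau> * Psi k 0 \<and> decays C \<tau> (Psi k)"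
      using elim(1) s U by simp
    ultimately show ?case
      using regular_not_eigenvalue[OF elim(2)] sol_edge[OF s k_mem] weyl_fun_eq[OF elim(2) Psi] by metis
  qed
  with m show ?thesis by blast
qed

end

section \<open>Recovering the potential\<close>

lemma has_vector_derivative_eq_on_unit_interval:
  fixes f g :: "real \<Rightarrow> complex"
  assumes "(f has_vector_derivative f') (at x within {0..1})" "(g has_vector_derivative g') (at x within {0..1})"
    and "\<And>y. y \<in> {0..1} \<Longrightarrow> f y = g y" and x: "x \<in> {0..1::real}"
  shows "f' = g'"
proof -
  have "(f has_vector_derivative g') (at x within {0..1})"
    by (rule has_vector_derivative_transform[OF x _ assms(2)]) (simp add: assms(3))
  with assms(1) show ?thesis using D_eqI x by metis
qed

text \<open>The derivative is zero almost everywhere, and absolute continuity turns this into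
  constancy.\<close>

lemma edge_sol_wronskian:
  assumes f: "edge_sol q lam f" and g: "edge_sol q lam g" and x: "x \<in> {0..1}"
  shows "f x * D g x - D f x * g x = f 0 * D g 0 - D f 0 * g 0"
proof -
  let ?W = "\<lambda>x. f x * D g x + (-1) * (D f x * g x)"
  have "ac_on_interval 0 1 ?W"
    by (intro ac_on_interval_add ac_on_interval_mult ac_on_interval_const edge_sol_ac[OF f] edge_sol_ac[OF g])
  moreover have "AE x in lborel. x \<in> {0..1} \<longrightarrow> (?W has_vector_derivative 0) (at x within {0..1})"
    using edge_sol_AE[OF f] edge_sol_AE[OF g]
  proof eventually_elim
    case (elim x)
    show ?case
    proof
      assume x: "x \<in> {0..1}"
      have "(?W has_vector_derivative (f x * ((q x - lam) * g x) + D f x * D g x) +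
          (-1) * (D f x * D g x + (q x - lam) * f x * g x)) (at x within {0..1})"
        using elim x by (intro has_vector_derivative_add has_vector_derivative_mult_right
            has_vector_derivative_mult edge_sol_D[OF f] edge_sol_D[OF g]) auto
      then show "(?W has_vector_derivative 0) (at x within {0..1})" by (simp add: algebra_simps)
    qed
  qed
  ultimately have "((\<lambda>x. 0) has_integral ?W x - ?W 0) {0..x}"
    using x by (intro ac_on_interval_has_integral_initial)
  then have "?W x - ?W 0 = 0" by (simp add: has_integral_0_eq)
  then show ?thesis by (simp add: algebra_simps)
qed

text \<open>One differentiation gives \<open>f f' = g g'\<close>. Squaring this and cancelling the
  common square gives \<open>f'\<^sup>2 = g'\<^sup>2\<close> where \<open>f\<close> is nonzero, so a
  second differentiation leaves only the terms with the potentials. No sign of \<open>f / g\<close>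
  has to be chosen.\<close>

lemma edge_sol_equal_squares:
  assumes f: "edge_sol q lam f" and g: "edge_sol q' lam g"
    and eq: "\<And>x. x \<in> {0..1} \<Longrightarrow> f x * f x = g x * g x"
  shows "\<And>x. x \<in> {0..1} \<Longrightarrow> f x * D f x = g x * D g x"
    and "AE x in lborel. x \<in> {0..1} \<longrightarrow> f x \<noteq> 0 \<longrightarrow> q x = q' x"
proof -
  show D1: "f x * D f x = g x * D g x" if x: "x \<in> {0..1}" for x
  proof -
    have "f x * D f x + D f x * f x = g x * D g x + D g x * g x"
      by (rule has_vector_derivative_eq_on_unit_interval[OF
            has_vector_derivative_mult[OF edge_sol_D[OF f x] edge_sol_D[OF f x]]
            has_vector_derivative_mult[OF edge_sol_D[OF g x] edge_sol_D[OF g x]] eq x])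
    then have "2 * (f x * D f x) = 2 * (g x * D g x)" by (simp add: mult.commute)
    then show ?thesis by simp
  qed
  show "AE x in lborel. x \<in> {0..1} \<longrightarrow> f x \<noteq> 0 \<longrightarrow> q x = q' x"
    using edge_sol_AE[OF f] edge_sol_AE[OF g]
  proof eventually_elim
    case (elim x)
    show ?case
    proof (intro impI)
      assume x: "x \<in> {0..1}" and nz: "f x \<noteq> 0"
      have "f x * ((q x - lam) * f x) + D f x * D f x = g x * ((q' x - lam) * g x) + D g x * D g x"
        by (rule has_vector_derivative_eq_on_unit_interval[OF
            has_vector_derivative_mult[OF edge_sol_D[OF f x]] has_vector_derivative_mult[OF edge_sol_D[OF g x]] D1 x])
          (use elim x in auto)
      then have 1: "(q x - lam) * (f x * f x) + D f x * D f x = (q' x - lam) * (g x * g x) + D g x * D g x"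
        by (simp add: algebra_simps)
      have "(f x * D f x) * (f x * D f x) = (g x * D g x) * (g x * D g x)"
        using D1[OF x] by simp
      then have "(f x * f x) * (D f x * D f x) = (g x * g x) * (D g x * D g x)" by (simp add: algebra_simps)
      moreover have "g x \<noteq> 0" using eq[OF x] nz by auto
      ultimately have "D f x * D f x = D g x * D g x" using eq[OF x] by simp
      then have "(q x - lam) * (f x * f x) = (q' x - lam) * (f x * f x)" using 1 eq[OF x] by simp
      then show "q x = q' x" using nz by simp
    qed
  qed
qed

text \<open>With \<open>\<sigma> = \<i> * csqrt lam\<close> the weight exponent becomes the modulus
  of the imaginary part of the root: 0 for positive \<open>lam\<close>, \<tau> for
  \<open>lam = -\<tau>\<^sup>2\<close>. The threshold makes the modulus of \<sigma> at least 1 and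
  at least \<open>2 * l1norm q\<close>.\<close>

lemma schr_sol_growth:
  assumes q: "q absolutely_integrable_on {0..1}"
    and lam: "(1 + 2 * l1norm q)\<^sup>2 \<le> norm lam" and x: "x \<in> {0..1}"
  shows "norm (schr_sol q A B lam x) \<le> 2 * (norm A + norm B) * exp (\<bar>Im (csqrt lam)\<bar> * x)"
proof -
  define \<sigma> where "\<sigma> = \<i> * csqrt lam"
  have s2: "\<sigma>\<^sup>2 = - lam" by (simp add: \<sigma>_def power_mult_distrib)
  have n\<sigma>: "norm \<sigma> = sqrt (norm lam)" by (simp add: \<sigma>_def norm_mult)
  have L: "0 \<le> l1norm q" by (rule l1norm_nonneg)
  have "1 + 2 * l1norm q \<le> norm \<sigma>"
    unfolding n\<sigma> using lam L by (intro real_le_rsqrt) auto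
  then have ge: "1 \<le> norm \<sigma>" "2 * l1norm q \<le> norm \<sigma>" using L by auto
  then have "\<sigma> \<noteq> 0" by auto
  have Re: "\<bar>Re \<sigma>\<bar> = \<bar>Im (csqrt lam)\<bar>" by (simp add: \<sigma>_def)
  note Y = edge_sol_schr_sol[OF q, where lam=lam and A=A and B=B]
  let ?N = "norm (B + \<sigma> * A) + norm (B - \<sigma> * A)"
  have "norm (schr_sol q A B lam x) \<le> ?N / norm \<sigma> * exp (\<bar>Re \<sigma>\<bar> * x)"
    using edge_sol_bound[OF q Y(1) s2 \<open>\<sigma> \<noteq> 0\<close> ge(2) x] Y by simp
  also have "\<dots> \<le> 2 * (norm A + norm B) * exp (\<bar>Re \<sigma>\<bar> * x)"
  proof (rule mult_right_mono)
    have "?N \<le> 2 * (norm B + norm \<sigma> * norm A)"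
      using norm_triangle_ineq[of B "\<sigma> * A"] norm_triangle_ineq4[of B "\<sigma> * A"] by (simp add: norm_mult)
    also have "\<dots> \<le> 2 * (norm B * norm \<sigma> + norm \<sigma> * norm A)"
      using mult_left_mono[OF ge(1) norm_ge_zero[of B]] by simp
    finally show "?N / norm \<sigma> \<le> 2 * (norm A + norm B)"
      using \<open>\<sigma> \<noteq> 0\<close> by (simp add: divide_le_eq algebra_simps)
  qed simp
  finally show ?thesis by (simp add: Re)
qed

lemma csqrt_neg_square:
  assumes "\<tau> > 0"
  shows "\<bar>Im (csqrt (- (of_real \<tau>)\<^sup>2))\<bar> = \<tau>"
proof -
  have "- (of_real \<tau>)\<^sup>2 = (of_real (- (\<tau>\<^sup>2)) :: complex)" by simp
  then show ?thesis using assms by (simp only: csqrt.sel) (simp add: norm_power)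
qed

text \<open>On \<open>\<lambda> = -\<tau>\<^sup>2\<close> the two Weyl solutions decay, which makes the cross term \<open>g\<close> tend to zero there;
  on \<open>\<lambda> > 0\<close> it is bounded because solutions do not grow; being of order one half, it vanishes.\<close>

lemma cross_term_vanishes:
  assumes q: "q absolutely_integrable_on {0..1}" and q': "q' absolutely_integrable_on {0..1}"
    and m: "((\<lambda>\<tau>. m \<tau> / of_real \<tau>) \<longlongrightarrow> -1) at_top"
    and ev: "\<forall>\<^sub>F \<tau> in at_top. \<exists>y. edge_sol q (- (of_real \<tau>)\<^sup>2) y \<and> D y 0 + b * y 0 = 1 \<and>
        y 0 = M \<tau> \<and> D y 0 = m \<tau> * y 0 \<and> decays C \<tau> y"
    and ev': "\<forall>\<^sub>F \<tau> in at_top. \<exists>y. edge_sol q' (- (of_real \<tau>)\<^sup>2) y \<and> D y 0 + b' * y 0 = 1 \<and>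
        y 0 = M \<tau> \<and> decays C' \<tau> y"
    and x: "x \<in> {0..1}"
  shows "schr_sol q' 0 1 lam x * schr_sol q 1 (-b) lam x = schr_sol q 0 1 lam x * schr_sol q' 1 (-b') lam x"
proof -
  define g where "g lam = schr_sol q' 0 1 lam x * schr_sol q 1 (-b) lam x - schr_sol q 0 1 lam x * schr_sol q' 1 (-b') lam x" for lam
  have holo: "g holomorphic_on UNIV"
    unfolding g_def by (intro holomorphic_intros holomorphic_schr_sol q q' x)
  define R where "R = max ((1 + 2 * l1norm q)\<^sup>2) ((1 + 2 * l1norm q')\<^sup>2)"
  \<comment> \<open>One constant dominating \<open>2 * (norm A + norm B)\<close> for all four
    choices of Cauchy data.\<close>
  define K where "K = 2 * (1 + norm b) + 2 * (1 + norm b')"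
  have "K \<ge> 0" by (simp add: K_def)
  have R: "(1 + 2 * l1norm q)\<^sup>2 \<le> R" "(1 + 2 * l1norm q')\<^sup>2 \<le> R" by (auto simp: R_def)
  have bd: "norm (schr_sol q 0 1 lam x) \<le> K * exp (\<bar>Im (csqrt lam)\<bar> * x)"
    "norm (schr_sol q' 0 1 lam x) \<le> K * exp (\<bar>Im (csqrt lam)\<bar> * x)"
    "norm (schr_sol q 1 (-b) lam x) \<le> K * exp (\<bar>Im (csqrt lam)\<bar> * x)"
    "norm (schr_sol q' 1 (-b') lam x) \<le> K * exp (\<bar>Im (csqrt lam)\<bar> * x)" if "norm lam \<ge> R" for lam
  proof -
    have *: "z \<le> K * exp (\<bar>Im (csqrt lam)\<bar> * x)" if "z \<le> c * exp (\<bar>Im (csqrt lam)\<bar> * x)" "c \<le> K" for z c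
      using that(1) mult_right_mono[OF that(2) exp_ge_zero, of "\<bar>Im (csqrt lam)\<bar> * x"] by linarith
    have l: "(1 + 2 * l1norm q)\<^sup>2 \<le> norm lam" "(1 + 2 * l1norm q')\<^sup>2 \<le> norm lam" using R that by auto
    show "norm (schr_sol q 0 1 lam x) \<le> K * exp (\<bar>Im (csqrt lam)\<bar> * x)"
      by (rule *[OF schr_sol_growth[OF q l(1) x]]) (simp add: K_def)
    show "norm (schr_sol q' 0 1 lam x) \<le> K * exp (\<bar>Im (csqrt lam)\<bar> * x)"
      by (rule *[OF schr_sol_growth[OF q' l(2) x]]) (simp add: K_def)
    show "norm (schr_sol q 1 (-b) lam x) \<le> K * exp (\<bar>Im (csqrt lam)\<bar> * x)"
      by (rule *[OF schr_sol_growth[OF q l(1) x]]) (simp add: K_def)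
    show "norm (schr_sol q' 1 (-b') lam x) \<le> K * exp (\<bar>Im (csqrt lam)\<bar> * x)"
      by (rule *[OF schr_sol_growth[OF q' l(2) x]]) (simp add: K_def)
  qed
  have gbd: "norm (g lam) \<le> 2 * K\<^sup>2 * exp (2 * \<bar>Im (csqrt lam)\<bar>)" if "norm lam \<ge> R" for lam
  proof -
    let ?E = "K * exp (\<bar>Im (csqrt lam)\<bar> * x)"
    have "norm (g lam) \<le> norm (schr_sol q' 0 1 lam x) * norm (schr_sol q 1 (-b) lam x) +
        norm (schr_sol q 0 1 lam x) * norm (schr_sol q' 1 (-b') lam x)"
      unfolding g_def by (metis norm_mult norm_triangle_ineq4)
    also have "\<dots> \<le> ?E * ?E + ?E * ?E"
      using \<open>K \<ge> 0\<close> by (intro add_mono mult_mono bd[OF that]) auto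
    also have "\<dots> = 2 * K\<^sup>2 * exp (2 * (\<bar>Im (csqrt lam)\<bar> * x))"
      by (simp add: power2_eq_square exp_add[symmetric] algebra_simps flip: exp_add)
    also have "\<dots> \<le> 2 * K\<^sup>2 * exp (2 * \<bar>Im (csqrt lam)\<bar>)"
      using x by (intro mult_left_mono) (auto simp: mult_left_le)
    finally show ?thesis .
  qed
  have lim: "((\<lambda>\<tau>::real. g (- (of_real \<tau>)\<^sup>2)) \<longlongrightarrow> 0) at_top"
  proof -
    \<comment> \<open>The boundary form reads \<open>(m \<tau> + b) * M \<tau> = 1\<close>. As
      \<open>m \<tau> + b\<close> is asymptotic to -\<tau>, the modulus of \<open>M \<tau>\<close>
      is eventually at most \<open>2 * inverse \<tau>\<close>, which is where the smallness of
      \<open>g\<close> comes from.\<close>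
    have "((\<lambda>\<tau>. m \<tau> / of_real \<tau> + b * of_real (inverse \<tau>)) \<longlongrightarrow> -1 + b * of_real 0) at_top"
      by (intro tendsto_add m tendsto_mult tendsto_const tendsto_of_real tendsto_inverse_0_at_top filterlim_ident)
    from tendsto_norm[OF this] have "((\<lambda>\<tau>. norm (m \<tau> / of_real \<tau> + b * of_real (inverse \<tau>))) \<longlongrightarrow> 1) at_top" by simp
    then have evm: "\<forall>\<^sub>F \<tau> in at_top. norm (m \<tau> / of_real \<tau> + b * of_real (inverse \<tau>)) > 1/2"
      by (rule order_tendstoD) simp
    have "\<forall>\<^sub>F \<tau> in at_top. norm (g (- (of_real \<tau>)\<^sup>2)) \<le> 2 * K * (\<bar>C\<bar> + \<bar>C'\<bar>) * inverse \<tau>"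
      using ev ev' evm eventually_gt_at_top[of 0] eventually_ge_at_top[of "sqrt R"]
    proof eventually_elim
      case (elim \<tau>)
      let ?lam = "- (of_real \<tau>)\<^sup>2 :: complex"
      obtain y where y: "edge_sol q ?lam y" "D y 0 + b * y 0 = 1" "y 0 = M \<tau>" "D y 0 = m \<tau> * y 0"
        "\<And>x. x \<in> {0..1} \<Longrightarrow> norm (y x) \<le> C * exp (- \<tau> * x) * norm (y 0)" using elim(1) by blast
      obtain y' where y': "edge_sol q' ?lam y'" "D y' 0 + b' * y' 0 = 1" "y' 0 = M \<tau>"
        "\<And>x. x \<in> {0..1} \<Longrightarrow> norm (y' x) \<le> C' * exp (- \<tau> * x) * norm (y' 0)" using elim(2) by blast
      have expand: "z x = schr_sol p 0 1 ?lam x + M \<tau> * schr_sol p 1 (-c) ?lam x"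
        if p: "p absolutely_integrable_on {0..1}" and z: "edge_sol p ?lam z" "D z 0 + c * z 0 = 1" "z 0 = M \<tau>" for p z c
      proof -
        note S = edge_sol_schr_sol[OF p, where lam="?lam" and A=0 and B=1]
          and P = edge_sol_schr_sol[OF p, where lam="?lam" and A=1 and B="-c"]
        let ?w = "\<lambda>x. 1 * schr_sol p 0 1 ?lam x + M \<tau> * schr_sol p 1 (-c) ?lam x"
        have w: "edge_sol p ?lam ?w" by (rule edge_sol_lincomb(1)[OF S(1) P(1)])
        have "D ?w 0 = 1 * D (schr_sol p 0 1 ?lam) 0 + M \<tau> * D (schr_sol p 1 (-c) ?lam) 0"
          by (rule edge_sol_lincomb(2)[OF S(1) P(1)]) simp
        then have "D ?w 0 = 1 - c * M \<tau>" using S P by simp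
        moreover have "D z 0 = 1 - c * M \<tau>" using z by (simp add: algebra_simps eq_diff_eq)
        ultimately have "D z 0 = D ?w 0" by simp
        moreover have "z 0 = ?w 0" using S P z by simp
        ultimately have "z x = ?w x" using edge_sol_unique(1)[OF p z(1) w _ _ x] by blast
        then show ?thesis by simp
      qed
      have lamR: "norm ?lam \<ge> R"
      proof -
        have "sqrt R \<le> \<tau>" using elim by simp
        then show ?thesis by (simp add: norm_power real_sqrt_le_iff sqrt_le_D)
      qed
      have E: "\<bar>Im (csqrt ?lam)\<bar> = \<tau>" using elim by (intro csqrt_neg_square) simp
      \<comment> \<open>Both expansions contain the same \<open>M \<tau>\<close>, so the products
        multiplied by it cancel. What remains pairs a decaying with a growing factor, whose
        exponentials cancel.\<close>
      have "g ?lam = y' x * schr_sol q 1 (-b) ?lam x - y x * schr_sol q' 1 (-b') ?lam x"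
        unfolding expand[OF q y(1-3)] expand[OF q' y'(1-3)] g_def by (simp add: algebra_simps)
      then have "norm (g ?lam) \<le> norm (y' x) * norm (schr_sol q 1 (-b) ?lam x) + norm (y x) * norm (schr_sol q' 1 (-b') ?lam x)"
        by (metis norm_mult norm_triangle_ineq4)
      also have "\<dots> \<le> (\<bar>C'\<bar> * exp (- \<tau> * x) * norm (M \<tau>)) * (K * exp (\<tau> * x)) +
          (\<bar>C\<bar> * exp (- \<tau> * x) * norm (M \<tau>)) * (K * exp (\<tau> * x))"
      proof (intro add_mono mult_mono)
        show "norm (y' x) \<le> \<bar>C'\<bar> * exp (- \<tau> * x) * norm (M \<tau>)"
          using y'(4)[OF x] unfolding y'(3) by (rule order_trans) (intro mult_right_mono, auto)
        show "norm (y x) \<le> \<bar>C\<bar> * exp (- \<tau> * x) * norm (M \<tau>)"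
          using y(5)[OF x] unfolding y(3) by (rule order_trans) (intro mult_right_mono, auto)
      qed (use bd[OF lamR] E \<open>K \<ge> 0\<close> in auto)
      also have "\<dots> = K * (\<bar>C\<bar> + \<bar>C'\<bar>) * norm (M \<tau>) * (exp (- \<tau> * x) * exp (\<tau> * x))"
        by (simp add: algebra_simps)
      also have "exp (- \<tau> * x) * exp (\<tau> * x) = 1" by (simp flip: exp_add)
      also have "K * (\<bar>C\<bar> + \<bar>C'\<bar>) * norm (M \<tau>) * 1 \<le> K * (\<bar>C\<bar> + \<bar>C'\<bar>) * (2 * inverse \<tau>)"
      proof -
        have "(m \<tau> + b) * M \<tau> = 1" using y(2,4) unfolding y(3) by (simp add: algebra_simps)
        then have "(m \<tau> / of_real \<tau> + b * of_real (inverse \<tau>)) * M \<tau> = of_real (inverse \<tau>)"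
          using elim by (simp add: field_simps)
        then have "norm (m \<tau> / of_real \<tau> + b * of_real (inverse \<tau>)) * norm (M \<tau>) = inverse \<tau>"
          using elim by (metis norm_mult norm_of_real abs_of_pos positive_imp_inverse_positive)
        moreover have "(1/2) * norm (M \<tau>) \<le> norm (m \<tau> / of_real \<tau> + b * of_real (inverse \<tau>)) * norm (M \<tau>)"
          using elim by (intro mult_right_mono) auto
        ultimately have "norm (M \<tau>) \<le> 2 * inverse \<tau>" by simp
        then show ?thesis using \<open>K \<ge> 0\<close> unfolding mult_1_right by (intro mult_left_mono) auto
      qed
      finally show ?case by simp
    qed
    moreover have "((\<lambda>\<tau>. 2 * K * (\<bar>C\<bar> + \<bar>C'\<bar>) * inverse \<tau>) \<longlongrightarrow> 2 * K * (\<bar>C\<bar> + \<bar>C'\<bar>) * 0) at_top"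
      by (intro tendsto_mult tendsto_const tendsto_inverse_0_at_top filterlim_ident)
    ultimately show ?thesis using Lim_null_comparison by fastforce
  qed
  obtain B where B: "\<And>lam. norm lam \<le> R' \<Longrightarrow> norm (g lam) \<le> B R'" for R'
  proof -
    have "\<forall>R'. \<exists>B. \<forall>lam. norm lam \<le> R' \<longrightarrow> norm (g lam) \<le> B"
    proof
      fix R' :: real
      have "compact (g ` cball 0 R')"
        by (intro compact_continuous_image holomorphic_on_imp_continuous_on holomorphic_on_subset[OF holo]) auto
      then show "\<exists>B. \<forall>lam. norm lam \<le> R' \<longrightarrow> norm (g lam) \<le> B"
        by (force dest!: compact_imp_bounded simp: bounded_iff)
    qed
    then show thesis using that by metis
  qed
  have "\<forall>\<^sub>F \<tau> in at_top. norm (g (- (of_real \<tau>)\<^sup>2)) < 1"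
    using tendsto_norm[OF lim] by (rule order_tendstoD) simp
  then obtain T0 where T0: "\<And>\<tau>. \<tau> \<ge> T0 \<Longrightarrow> norm (g (- (of_real \<tau>)\<^sup>2)) < 1"
    unfolding eventually_at_top_linorder by blast
  \<comment> \<open>Beyond \<open>R'\<close> the growth estimate holds, and every
    \<open>t < - R'\<close> is minus the square of a number at least \<open>T0\<close>.\<close>
  define R' where "R' = max R (T0\<^sup>2)"
  have "g lam = 0"
  proof (rule entire_order_half_eq_zero[OF holo _ _ lim])
    \<comment> \<open>The growth estimate covers large \<open>z\<close>; the additional constant is
      the maximum bound on the disc of radius \<open>R\<close>.\<close>
    show "norm (g z) \<le> (2 * K\<^sup>2 + \<bar>B R\<bar>) * exp (2 * sqrt (norm z))" for z
    proof (cases "norm z \<ge> R")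
      case True
      have "\<bar>Im (csqrt z)\<bar> \<le> norm (csqrt z)" by (rule abs_Im_le_cmod)
      then have "\<bar>Im (csqrt z)\<bar> \<le> sqrt (norm z)" by simp
      then have "2 * K\<^sup>2 * exp (2 * \<bar>Im (csqrt z)\<bar>) \<le> (2 * K\<^sup>2 + \<bar>B R\<bar>) * exp (2 * sqrt (norm z))"
        by (intro mult_mono) auto
      then show ?thesis using gbd[OF True] by simp
    next
      case False
      then have "norm (g z) \<le> \<bar>B R\<bar> * 1" using B[of z R] by simp
      also have "\<dots> \<le> (2 * K\<^sup>2 + \<bar>B R\<bar>) * exp (2 * sqrt (norm z))"
        by (intro mult_mono) auto
      finally show ?thesis .
    qed
    show "norm (g (of_real t)) \<le> \<bar>B R'\<bar> + 2 * K\<^sup>2 + 1" for t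
    proof -
      \<comment> \<open>Compactness in the middle; for large positive \<open>t\<close> the root is
        real and the exponential is 1; for large negative \<open>t\<close> the limit along
        \<open>-\<tau>\<^sup>2\<close> applies.\<close>
      consider "\<bar>t\<bar> \<le> R'" | "t > R'" | "t < - R'" by linarith
      then show ?thesis
      proof cases
        case 1
        then have "norm (g (of_real t)) \<le> B R'" by (intro B) simp
        then show ?thesis by (simp add: add.assoc add_increasing2)
      next
        case 2
        have "R' \<ge> 0" by (auto simp: R'_def R_def max_def)
        then have "t \<ge> 0" "norm (of_real t :: complex) \<ge> R" using 2 by (auto simp: R'_def)
        then have "norm (g (of_real t)) \<le> 2 * K\<^sup>2 * exp (2 * \<bar>Im (csqrt (of_real t))\<bar>)" by (intro gbd)
        also have "Im (csqrt (of_real t)) = 0" using \<open>t \<ge> 0\<close> by (simp add: csqrt_of_real_nonneg)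
        finally show ?thesis by simp
      next
        case 3
        have "R' \<ge> 0" by (auto simp: R'_def R_def max_def)
        have "T0\<^sup>2 \<le> -t" using 3 by (auto simp: R'_def)
        then have "T0 \<le> sqrt (-t)" by (rule real_le_rsqrt)
        from T0[OF this] have "norm (g (- (of_real (sqrt (-t)))\<^sup>2)) < 1" .
        moreover have "- (of_real (sqrt (-t)))\<^sup>2 = (of_real t :: complex)"
          using 3 \<open>R' \<ge> 0\<close> by (simp flip: of_real_power)
        ultimately have "norm (g (of_real t)) < 1" by simp
        then show ?thesis by (simp add: add_increasing)
      qed
    qed
  qed
  then show ?thesis by (simp add: g_def)
qed

theorem theorem2p5:
  fixes r p :: nat and par :: "nat \<Rightarrow> nat"
    and a a1 a0 :: "nat \<Rightarrow> nat \<Rightarrow> complex"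
    and q q' :: "nat \<Rightarrow> real \<Rightarrow> complex"
    and h h' :: "nat \<Rightarrow> complex"
    and k :: nat
  assumes "tree_ok r p par"
    and "coef_ok r p par a a1"
    and "potential_ok r q" and "potential_ok r q'"
    and "k \<in> {1..p}"
    and "\<forall>lam. \<not> eigenvalue_B r p par a a1 a0 q h lam \<and> \<not> eigenvalue_B r p par a a1 a0 q' h' lam
           \<longrightarrow> weyl_fun r p par a a1 a0 q h k lam = weyl_fun r p par a a1 a0 q' h' k lam"
  shows "(AE x in lborel. x \<in> {0..1} \<longrightarrow> q k x = q' k x) \<and> h k = h' k"
proof -
  interpret T: quantum_tree r p par a a1 a0 q h k
    by unfold_locales (use assms in auto)
  interpret T': quantum_tree r p par a a1 a0 q' h' k
    by unfold_locales (use assms in auto)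
  have qk: "q k absolutely_integrable_on {0..1}" "q' k absolutely_integrable_on {0..1}"
    using T.q_integrable T'.q_integrable T.k_mem by auto
  define M where "M \<tau> = weyl_fun r p par a a1 a0 q h k (- (of_real \<tau>)\<^sup>2)" for \<tau> :: real
  obtain m C where m: "((\<lambda>\<tau>. m \<tau> / of_real \<tau>) \<longlongrightarrow> -1) at_top"
    and ev: "\<forall>\<^sub>F \<tau> in at_top. \<not> eigenvalue_B r p par a a1 a0 q h (- (of_real \<tau>)\<^sup>2) \<and>
      (\<exists>y. edge_sol (q k) (- (of_real \<tau>)\<^sup>2) y \<and> D y 0 + h k * y 0 = 1 \<and>
        y 0 = M \<tau> \<and> D y 0 = m \<tau> * y 0 \<and> decays C \<tau> y)"
    using T.weyl_asymptotics unfolding M_def by blast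
  obtain m' C' where ev': "\<forall>\<^sub>F \<tau> in at_top. \<not> eigenvalue_B r p par a a1 a0 q' h' (- (of_real \<tau>)\<^sup>2) \<and>
      (\<exists>y. edge_sol (q' k) (- (of_real \<tau>)\<^sup>2) y \<and> D y 0 + h' k * y 0 = 1 \<and>
        y 0 = weyl_fun r p par a a1 a0 q' h' k (- (of_real \<tau>)\<^sup>2) \<and> D y 0 = m' \<tau> * y 0 \<and>
        decays C' \<tau> y)"
    using T'.weyl_asymptotics by blast
  have ev1: "\<forall>\<^sub>F \<tau> in at_top. \<exists>y. edge_sol (q k) (- (of_real \<tau>)\<^sup>2) y \<and> D y 0 + h k * y 0 = 1 \<and>
        y 0 = M \<tau> \<and> D y 0 = m \<tau> * y 0 \<and> decays C \<tau> y"
    using ev by (rule eventually_mono) blast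
  have ev2: "\<forall>\<^sub>F \<tau> in at_top. \<exists>y. edge_sol (q' k) (- (of_real \<tau>)\<^sup>2) y \<and> D y 0 + h' k * y 0 = 1 \<and>
        y 0 = M \<tau> \<and> decays C' \<tau> y"
    using ev ev'
  proof eventually_elim
    case (elim \<tau>)
    \<comment> \<open>Neither problem has an eigenvalue at this point of the ray, so the hypothesis
      on the Weyl functions applies.\<close>
    have "M \<tau> = weyl_fun r p par a a1 a0 q' h' k (- (of_real \<tau>)\<^sup>2)"
      unfolding M_def using assms(6) elim by blast
    then show ?case using elim(2) by auto
  qed
  \<comment> \<open>The cross identity holds for all values of the spectral parameter; from here on
    0 is as good as any. Primes denote the second problem, not derivatives.\<close>
  define \<phi> S \<phi>' S' where "\<phi> = schr_sol (q k) 1 (- h k) 0" and "S = schr_sol (q k) 0 1 0"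
    and "\<phi>' = schr_sol (q' k) 1 (- h' k) 0" and "S' = schr_sol (q' k) 0 1 0"
  have cross: "S' x * \<phi> x = S x * \<phi>' x" if "x \<in> {0..1}" for x
    unfolding \<phi>_def S_def \<phi>'_def S'_def by (rule cross_term_vanishes[OF qk m ev1 ev2 that])
  have sols: "edge_sol (q k) 0 \<phi>" "edge_sol (q k) 0 S" "edge_sol (q' k) 0 \<phi>'" "edge_sol (q' k) 0 S'"
    unfolding \<phi>_def S_def \<phi>'_def S'_def using edge_sol_schr_sol(1) qk by blast+
  have init: "\<phi> 0 = 1" "D \<phi> 0 = - h k" "S 0 = 0" "D S 0 = 1" "\<phi>' 0 = 1" "D \<phi>' 0 = - h' k" "S' 0 = 0" "D S' 0 = 1"
    unfolding \<phi>_def S_def \<phi>'_def S'_def using edge_sol_schr_sol(2,3) qk by auto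
  have W: "\<phi> x * D S x - D \<phi> x * S x = 1" "\<phi>' x * D S' x - D \<phi>' x * S' x = 1" if "x \<in> {0..1}" for x
    using edge_sol_wronskian[OF sols(1,2) that] edge_sol_wronskian[OF sols(3,4) that] by (simp_all add: init)
  have sq: "\<phi> x * \<phi> x = \<phi>' x * \<phi>' x" "S x * S x = S' x * S' x" if x: "x \<in> {0..1}" for x
  proof -
    \<comment> \<open>In quotient form: \<open>S / \<phi>\<close> is the same for both problems and
      by the Wronskian has derivative \<open>1 / \<phi>\<^sup>2\<close>; likewise
      \<open>\<phi> / S\<close> has derivative \<open>-1 / S\<^sup>2\<close>. The polynomial version
      is valid at zeros as well.\<close>
    have der: "S' x * D \<phi> x + D S' x * \<phi> x = S x * D \<phi>' x + D S x * \<phi>' x"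
      by (rule has_vector_derivative_eq_on_unit_interval[OF
            has_vector_derivative_mult[OF edge_sol_D[OF sols(4) x] edge_sol_D[OF sols(1) x]]
            has_vector_derivative_mult[OF edge_sol_D[OF sols(2) x] edge_sol_D[OF sols(3) x]] cross x])
    note c = cross[OF x] and w = W[OF x]
    show "\<phi> x * \<phi> x = \<phi>' x * \<phi>' x" using der c w by algebra
    show "S x * S x = S' x * S' x" using der c w by algebra
  qed
  \<comment> \<open>At \<open>x = 0\<close> the products \<open>\<phi> D \<phi>\<close> of the two
    problems are \<open>- h k\<close> and \<open>- h' k\<close>.\<close>
  have "h k = h' k"
    using edge_sol_equal_squares(1)[OF sols(1,3) sq(1), of 0] by (simp add: init)
  have AE_phi: "AE x in lborel. x \<in> {0..1} \<longrightarrow> \<phi> x \<noteq> 0 \<longrightarrow> q k x = q' k x"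
    by (rule edge_sol_equal_squares(2)[OF sols(1,3)]) (rule sq(1))
  have AE_S: "AE x in lborel. x \<in> {0..1} \<longrightarrow> S x \<noteq> 0 \<longrightarrow> q k x = q' k x"
    by (rule edge_sol_equal_squares(2)[OF sols(2,4)]) (rule sq(2))
  have "AE x in lborel. x \<in> {0..1} \<longrightarrow> q k x = q' k x"
    using AE_phi AE_S
  proof eventually_elim
    case (elim x)
    \<comment> \<open>Since the Wronskian is 1, \<open>\<phi>\<close> and \<open>S\<close> have no
      common zero, so one of the two alternatives applies at \<open>x\<close>.\<close>
    then show ?case using W(1)[of x] by auto
  qed
  with \<open>h k = h' k\<close> show ?thesis by blast
qed

end
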